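(* If search reduces to decision for $\mathsf{S}_2^{\mathsf{P}}$, then $\Sigma_2^{\mathsf{P}} \cap \Pi_2^{\mathsf{P}} \subseteq \mathsf{ZPP}^{\mathsf{NP}}$.
   Context: All strings are over $\{0,1\}$. $\mathsf{S}_2^{\mathsf{P}}$: A language $L$ is in $\mathsf{S}_2^{\mathsf{P}}$ if there exist a polynomial-time predicate $P$ and a polynomial $q$ such that, for every string $x$: - if $x \in L$, then $\exists y \in \{0,1\}^{q(|x|)}\ \forall z \in \{0,1\}^{q(|x|)}\ P(x,y,z)=1$; - if $x \notin L$, then $\exists z \in \{0,1\}^{q(|x|)}\ \forall y \in \{0,1\}^{q(|x|)}\ P(x,y,z)=0$. An "$\mathsf{S}_2^{\mathsf{P}}$ predicate" is a polynomial-time predicate $P$ that, together with some polynomial $q$, defines a language $L \in \mathsf{S}_2^{\mathsf{P}}$ in this way. $\mathsf{S}_2^{\mathsf{P}}$-Search for $P$: given $x$, output either a string $y \in \{0,1\}^{q(|x|)}$, marked as a first-player witness, such that $P(x,y,z)=1$ for all $z \in \{0,1\}^{q(|x|)}$, or a string $z \in \{0,1\}^{q(|x|)}$, marked as a second-player witness, such that $P(x,y,z)=0$ for all $y \in \{0,1\}^{q(|x|)}$. "Search reduces to decision for $\mathsf{S}_2^{\mathsf{P}}$" means: for every $\mathsf{S}_2^{\mathsf{P}}$ predicate $P$ there are a language $L' \in \mathsf{S}_2^{\mathsf{P}}$ and a deterministic polynomial-time oracle machine that, given $x$ and oracle access to $L'$, outputs a solution of $\mathsf{S}_2^{\mathsf{P}}$-Search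 for $P$ on $x$. $\Sigma_2^{\mathsf{P}}$, $\Pi_2^{\mathsf{P}}$ are the usual second-level classes of the polynomial hierarchy, and $\mathsf{ZPP}^{\mathsf{NP}}$ is the class of languages decidable by zero-error probabilistic expected-polynomial-time machines with an $\mathsf{NP}$ oracle. It is a known theorem of Cai that $\mathsf{S}_2^{\mathsf{P}} \subseteq \mathsf{ZPP}^{\mathsf{NP}}$. *)

theory Defs
  imports "HOL-Probability.Probability" "HOL-Computational_Algebra.Polynomial"
begin

section \<open>Machines\<close>

text \<open>
  The machine model is the multi-stack machine (equivalently, up to a constant factor in time, the
  multi-tape Turing machine: two stacks form a tape), presented by structured programs. There are
  finitely many stacks in each program, every elementary step inspects or changes a single bit and
  costs one time unit, and so the cost is the bit cost. A query is charged one unit once its text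
  has been written on a stack.
\<close>

type_synonym word = "bool list"
type_synonym reg = nat
type_synonym state = "reg \<Rightarrow> word"

datatype com =
    Skip
  | Push reg bool
  | Pop reg
  | Flip reg                 \<comment> \<open>push a fair coin flip\<close>
  | Query reg                \<comment> \<open>replace the stack content by the oracle's one-bit answer to it\<close>
  | Seq com com
  | Branch reg com com com   \<comment> \<open>stack empty / top bit 0 / top bit 1\<close>
  | While reg com            \<comment> \<open>loop as long as the stack is nonempty\<close>

text \<open>
  \<open>exec A c s bs t s'\<close>: with oracle \<open>A\<close> and started in state \<open>s\<close>, the program \<open>c\<close> halts after exactly
  \<open>t\<close> steps in state \<open>s'\<close>, provided that the coins come up \<open>bs\<close>, where \<open>bs\<close> lists precisely the
  flips made during the run. In particular, a run with \<open>bs = []\<close> is deterministic.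
\<close>

inductive exec :: "word set \<Rightarrow> com \<Rightarrow> state \<Rightarrow> bool list \<Rightarrow> nat \<Rightarrow> state \<Rightarrow> bool" for A where
  Skip: "exec A Skip s [] 1 s"
| Push: "exec A (Push r b) s [] 1 (s(r := b # s r))"
| Pop: "exec A (Pop r) s [] 1 (s(r := tl (s r)))"
| Flip: "exec A (Flip r) s [b] 1 (s(r := b # s r))"
| Query: "exec A (Query r) s [] 1 (s(r := [s r \<in> A]))"
| Seq: "exec A c s bs t s' \<Longrightarrow> exec A d s' bs' t' s'' \<Longrightarrow>
    exec A (Seq c d) s (bs @ bs') (t + t') s''"
| Branch_Empty: "s r = [] \<Longrightarrow> exec A c s bs t s' \<Longrightarrow> exec A (Branch r c d e) s bs (Suc t) s'"
| Branch_0: "s r = False # w \<Longrightarrow> exec A d s bs t s' \<Longrightarrow> exec A (Branch r c d e) s bs (Suc t) s'"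
| Branch_1: "s r = True # w \<Longrightarrow> exec A e s bs t s' \<Longrightarrow> exec A (Branch r c d e) s bs (Suc t) s'"
| While_Empty: "s r = [] \<Longrightarrow> exec A (While r c) s [] 1 s"
| While_Loop: "s r \<noteq> [] \<Longrightarrow> exec A c s bs t s' \<Longrightarrow> exec A (While r c) s' bs' t' s'' \<Longrightarrow>
    exec A (While r c) s (bs @ bs') (Suc (t + t')) s''"

text \<open>Inputs are placed on the first stacks; stack 0 holds the output.\<close>

definition init :: "word list \<Rightarrow> state" where
  "init ws = (\<lambda>r. if r < length ws then ws ! r else [])"

definition computes_within :: "word set \<Rightarrow> com \<Rightarrow> word list \<Rightarrow> nat \<Rightarrow> word \<Rightarrow> bool" where
  "computes_within A c ws n w \<longleftrightarrow> (\<exists>t\<le>n. \<exists>s. exec A c (init ws) [] t s \<and> s 0 = w)"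


section \<open>Polynomial time, NP, and the second level\<close>

text \<open>
  Machines without an oracle are machines with the empty oracle, which answers every query by 0.
\<close>

definition polytime2 :: "(word \<Rightarrow> word \<Rightarrow> bool) \<Rightarrow> bool" where
  "polytime2 V \<longleftrightarrow> (\<exists>c (p :: nat poly). \<forall>x u.
     computes_within {} c [x, u] (poly p (length x + length u)) [V x u])"

definition polytime3 :: "(word \<Rightarrow> word \<Rightarrow> word \<Rightarrow> bool) \<Rightarrow> bool" where
  "polytime3 P \<longleftrightarrow> (\<exists>c (p :: nat poly). \<forall>x y z.
     computes_within {} c [x, y, z] (poly p (length x + length y + length z)) [P x y z])"

definition words :: "nat \<Rightarrow> word set" where
  "words n = {w. length w = n}"

definition NP :: "word set set" where
  "NP = {L. \<exists>V (q :: nat poly). polytime2 V \<and>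
     (\<forall>x. x \<in> L \<longleftrightarrow> (\<exists>u\<in>words (poly q (length x)). V x u))}"

definition Sigma2P :: "word set set" where
  "Sigma2P = {L. \<exists>P (q :: nat poly). polytime3 P \<and>
     (\<forall>x. x \<in> L \<longleftrightarrow>
        (\<exists>y\<in>words (poly q (length x)). \<forall>z\<in>words (poly q (length x)). P x y z))}"

definition Pi2P :: "word set set" where
  "Pi2P = {L. - L \<in> Sigma2P}"


section \<open>Symmetric alternation\<close>

definition S2P_defines :: "(word \<Rightarrow> word \<Rightarrow> word \<Rightarrow> bool) \<Rightarrow> nat poly \<Rightarrow> word set \<Rightarrow> bool" where
  "S2P_defines P q L \<longleftrightarrow> polytime3 P \<and>
     (\<forall>x. (x \<in> L \<longrightarrow>
             (\<exists>y\<in>words (poly q (length x)). \<forall>z\<in>words (poly q (length x)). P x y z)) \<and>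
          (x \<notin> L \<longrightarrow>
             (\<exists>z\<in>words (poly q (length x)). \<forall>y\<in>words (poly q (length x)). \<not> P x y z)))"

definition S2P :: "word set set" where
  "S2P = {L. \<exists>P q. S2P_defines P q L}"

text \<open>The leading bit of a solution marks the player: 1 for the first, 0 for the second.\<close>

definition S2P_search_solution ::
    "(word \<Rightarrow> word \<Rightarrow> word \<Rightarrow> bool) \<Rightarrow> nat poly \<Rightarrow> word \<Rightarrow> word \<Rightarrow> bool" where
  "S2P_search_solution P q x w \<longleftrightarrow>
     (\<exists>y\<in>words (poly q (length x)). w = True # y \<and> (\<forall>z\<in>words (poly q (length x)). P x y z)) \<or>
     (\<exists>z\<in>words (poly q (length x)). w = False # z \<and> (\<forall>y\<in>words (poly q (length x)). \<not> P x y z))"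

definition search_reduces_to_decision_S2P :: bool where
  "search_reduces_to_decision_S2P \<longleftrightarrow>
     (\<forall>P q L. S2P_defines P q L \<longrightarrow>
        (\<exists>L'\<in>S2P. \<exists>c (p :: nat poly). \<forall>x. \<exists>w.
           computes_within L' c [x] (poly p (length x)) w \<and> S2P_search_solution P q x w))"


section \<open>Zero-error probabilistic computation\<close>

definition coins :: "bool stream measure" where
  "coins = stream_space (measure_pmf (bernoulli_pmf (1 / 2)))"

text \<open>
  At most one \<open>t\<close> qualifies in the following infimum; if none does, the run on \<open>\<omega>\<close> does not halt and
  the value is infinite.
\<close>

definition run_time :: "word set \<Rightarrow> com \<Rightarrow> word \<Rightarrow> bool stream \<Rightarrow> ennreal" where
  "run_time A c x \<omega> = (INF t \<in> {t. \<exists>n s. exec A c (init [x]) (stake n \<omega>) t s}. of_nat t)"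

definition ZPP :: "word set \<Rightarrow> word set set" where
  "ZPP A = {L. \<exists>c (p :: nat poly). \<forall>x.
     (\<integral>\<^sup>+ \<omega>. run_time A c x \<omega> \<partial>coins) \<le> of_nat (poly p (length x)) \<and>
     (\<forall>bs t s. exec A c (init [x]) bs t s \<longrightarrow> s 0 = [x \<in> L])}"

definition ZPP_NP :: "word set set" where
  "ZPP_NP = (\<Union>A\<in>NP. ZPP A)"

end

theory Submission imports Defs begin

text \<open>
  Let \<open>L\<close> be in both classes. In the game where the first player announces a bit and a \<open>\<Sigma>\<close>-witness for
  \<open>x \<in> L\<close> or \<open>x \<notin> L\<close> accordingly, the first player always wins, so a solution of the search problem
  reveals whether \<open>x \<in> L\<close>. Hence \<open>L\<close> is decided in polynomial time with queries to some \<open>L'\<close> in \<open>S2P\<close>,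
  and it remains to answer each query by a Las Vegas computation with an NP language (Cai's theorem).

  For the latter, keep a list of pairs of moves and let \<open>W\<close> be the set of all pairs \<open>(y, z)\<close> such that
  \<open>y\<close> beats all recorded moves of the second player and \<open>z\<close> all recorded moves of the first. A pair that
  is nearly uniform in \<open>W\<close> is obtained with an NP language by isolating an element with random parities
  and reading off its bits. For two members \<open>u\<close> and \<open>w\<close> of \<open>W\<close>, recording \<open>u\<close> removes \<open>w\<close> or recording \<open>w\<close>
  removes \<open>u\<close>, so recording the sampled pair shrinks \<open>W\<close> by a constant factor in expectation, and after
  linearly many rounds \<open>W\<close> is probably empty. Then one player has no move that beats all
  recorded ones, which certifies that this player loses; NP queries find out which one it is.
  If \<open>W\<close> is not empty, start again.
\<close>

section \<open>Program combinators\<close>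

text \<open>Pairs are sampled because the moves of a single player admit no such comparison:
  \<open>w\<close> survives the recording of \<open>u\<close> only if the first move of
  \<open>w\<close> beats the second of \<open>u\<close> and the first move of \<open>u\<close> loses
  to the second of \<open>w\<close>, and this cannot hold both ways. Recorded moves restrict the two
  components separately, so \<open>W\<close> is a product; it is empty iff one factor is, and the
  factor of the winning player always contains the winning move. So the answer is right for all
  coins, even after useless samples, and randomness affects only the running time. The loss of 1/16
  per round is 1/8 (price of sampling) times 1/2 (asymmetry). The size of \<open>W\<close> is never
  estimated: a random parity is kept iff it leaves the set nonempty. \<open>ZPP_NP\<close> grants
  one oracle, so parities, single bits and recorded moves are all constraints of one NP language.
  Expected time concerns infinite coin sequences; every attempt flips a fixed number of coins and,
  on failure, restores its start state, so only counting over words of that length remains.\<close>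

definition runs :: "word set \<Rightarrow> com \<Rightarrow> state \<Rightarrow> bool list \<Rightarrow> nat \<Rightarrow> state \<Rightarrow> bool" where
  "runs A c s bs T s' \<longleftrightarrow> (\<exists>t\<le>T. exec A c s bs t s')"

lemma runsI: "exec A c s bs t s' \<Longrightarrow> runs A c s bs t s'"
  by (auto simp: runs_def)

lemma runs_mono: "runs A c s bs T s' \<Longrightarrow> T \<le> T' \<Longrightarrow> runs A c s bs T' s'"
  by (meson runs_def order_trans)

lemma runs_Skip: "runs A Skip s [] 1 s"
  by (rule runsI[OF exec.Skip])

lemma runs_Push: "runs A (Push r b) s [] 1 (s(r := b # s r))"
  by (rule runsI[OF exec.Push])

lemma runs_Pop: "runs A (Pop r) s [] 1 (s(r := tl (s r)))"
  by (rule runsI[OF exec.Pop])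

lemma runs_Flip: "runs A (Flip r) s [b] 1 (s(r := b # s r))"
  by (rule runsI[OF exec.Flip])

lemma runs_Query: "runs A (Query r) s [] 1 (s(r := [s r \<in> A]))"
  by (rule runsI[OF exec.Query])

lemma runs_Seq:
  "runs A c s bs T s' \<Longrightarrow> runs A d s' bs' T' s'' \<Longrightarrow> runs A (Seq c d) s (bs @ bs') (T + T') s''"
  unfolding runs_def by (meson add_mono exec.Seq)

lemma runs_Seq0:
  "runs A c s [] T s' \<Longrightarrow> runs A d s' [] T' s'' \<Longrightarrow> runs A (Seq c d) s [] (T + T') s''"
  using runs_Seq[of A c s "[]" T s' d "[]"] by simp

lemma runs_Branch:
  assumes "runs A (case s r of [] \<Rightarrow> c | b # _ \<Rightarrow> if b then e else d) s bs T s'"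
  shows "runs A (Branch r c d e) s bs (Suc T) s'"
  using assms unfolding runs_def
  by (auto split: list.splits if_splits intro: exec.intros)

lemma runs_While_empty: "s r = [] \<Longrightarrow> runs A (While r c) s [] 1 s"
  by (rule runsI[OF exec.While_Empty])

lemma runs_While_step:
  assumes "s r \<noteq> []" "runs A c s bs T s'" "runs A (While r c) s' bs' T' s''"
  shows "runs A (While r c) s (bs @ bs') (Suc (T + T')) s''"
  using assms unfolding runs_def by (meson Suc_le_mono add_mono exec.While_Loop)

lemma runs_While_step0:
  assumes "s r \<noteq> []" "runs A c s [] T s'" "runs A (While r c) s' [] T' s''"
  shows "runs A (While r c) s [] (Suc (T + T')) s''"
  using runs_While_step[of s r A c "[]" T s' "[]"] assms by simp

lemma runs_eq:
  "runs A c s bs T s' \<Longrightarrow> s' = s'' \<Longrightarrow> T \<le> T' \<Longrightarrow> runs A c s bs T' s''"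
  using runs_mono by blast

lemma runs_Seq_eq:
  "runs A c s bs T s' \<Longrightarrow> runs A d s' bs' T' s'' \<Longrightarrow> bs'' = bs @ bs' \<Longrightarrow> s'' = s3 \<Longrightarrow> T + T' \<le> T''
   \<Longrightarrow> runs A (Seq c d) s bs'' T'' s3"
  using runs_Seq runs_mono by blast

lemma runs_Seq0_eq:
  "runs A c s [] T s' \<Longrightarrow> runs A d s' [] T' s'' \<Longrightarrow> s'' = s3 \<Longrightarrow> T + T' \<le> T''
   \<Longrightarrow> runs A (Seq c d) s [] T'' s3"
  using runs_Seq0 runs_mono by blast

text \<open>\<open>R\<close> maps a state at the head of the loop to the state in which the loop will be left.\<close>

lemma runs_loop:
  assumes step: "\<And>s. s a \<noteq> [] \<Longrightarrow> runs A c s [] k (F s)"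
    and "\<And>s. s a \<noteq> [] \<Longrightarrow> F s a = tl (s a)"
    and "\<And>s. s a \<noteq> [] \<Longrightarrow> R (F s) = R s"
    and "\<And>s. s a = [] \<Longrightarrow> R s = s"
  shows "runs A (While a c) s [] (Suc k * length (s a) + 1) (R s)"
proof -
  have "s a = w \<Longrightarrow> runs A (While a c) s [] (Suc k * length w + 1) (R s)" for w
  proof (induction w arbitrary: s)
    case Nil
    then show ?case using runs_While_empty[of s a A c] assms(4)[of s] by simp
  next
    case (Cons x w)
    have ne: "s a \<noteq> []" using Cons by simp
    have "runs A (While a c) (F s) [] (Suc k * length w + 1) (R (F s))"
      by (rule Cons.IH) (simp add: assms(2) ne Cons.prems)
    from runs_While_step0[OF ne step[where s = s, OF ne] this] show ?case
      by (rule runs_eq) (use ne in \<open>auto simp: assms(3)\<close>)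
  qed
  then show ?thesis by simp
qed

fun seqs :: "com list \<Rightarrow> com" where
  "seqs [] = Skip"
| "seqs (c # cs) = Seq c (seqs cs)"

lemma runs_seqs_Nil: "runs A (seqs []) s [] 1 s"
  unfolding seqs.simps by (rule runs_Skip)

lemma runs_seqs_Cons:
  "runs A c s [] T s' \<Longrightarrow> runs A (seqs cs) s' [] T' s'' \<Longrightarrow> runs A (seqs (c # cs)) s [] (T + T') s''"
  by (simp add: runs_Seq0)

definition mv :: "reg \<Rightarrow> reg \<Rightarrow> com" where
  "mv a b = Branch a Skip (Seq (Pop a) (Push b False)) (Seq (Pop a) (Push b True))"

lemma runs_mv:
  assumes "a \<noteq> b"
  shows "runs A (mv a b) s [] 3 (s(a := tl (s a), b := take 1 (s a) @ s b))"
proof -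
  have *: "runs A (Seq (Pop a) (Push b c)) s [] 2 (s(a := tl (s a), b := c # s b))" for c
    by (rule runs_Seq0_eq[OF runs_Pop runs_Push]) (use assms in auto)
  have **: "s a = [] \<Longrightarrow> runs A Skip s [] 2 (s(a := tl (s a), b := take 1 (s a) @ s b))"
    by (rule runs_eq[OF runs_Skip]) (auto simp: fun_eq_iff)
  have e: "(3 :: nat) = Suc 2" by simp
  show ?thesis unfolding mv_def e
    by (rule runs_Branch) (use * ** in \<open>auto split: list.split\<close>)
qed

definition clear :: "reg \<Rightarrow> com" where
  "clear a = While a (Pop a)"

lemma runs_clear: "runs A (clear a) s [] (2 * length (s a) + 1) (s(a := []))"
  unfolding clear_def
  by (rule runs_eq[OF runs_loop[where R = "\<lambda>s. s(a := [])", OF runs_Pop]]) (auto simp: fun_eq_iff)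

definition moves :: "reg \<Rightarrow> reg \<Rightarrow> com" where
  "moves a b = While a (mv a b)"

lemma runs_moves:
  assumes "a \<noteq> b"
  shows "runs A (moves a b) s [] (4 * length (s a) + 1) (s(a := [], b := rev (s a) @ s b))"
proof -
  have [simp]: "rev (tl w) @ take (Suc 0) w = rev w" for w :: word
    by (cases w) auto
  show ?thesis unfolding moves_def
    by (rule runs_eq[OF runs_loop[where R = "\<lambda>s. s(a := [], b := rev (s a) @ s b)", OF runs_mv]])
      (use assms in \<open>auto simp: fun_eq_iff simp flip: append_assoc\<close>)
qed

text \<open>Moving reverses a word; the second pass back from \<open>t\<close> restores the order on
  both targets. Whatever \<open>b\<close> held before stays below the copy.\<close>

definition copy :: "reg \<Rightarrow> reg \<Rightarrow> reg \<Rightarrow> com" where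
  "copy a b t = Seq (moves a t)
     (While t (Branch t Skip (seqs [Pop t, Push a False, Push b False])
                             (seqs [Pop t, Push a True, Push b True])))"

lemma runs_copy:
  assumes "a \<noteq> b" "a \<noteq> t" "b \<noteq> t" "s t = []"
  shows "runs A (copy a b t) s [] (10 * length (s a) + 2) (s(b := s a @ s b))"
proof -
  define c where "c = Branch t Skip (seqs [Pop t, Push a False, Push b False])
                             (seqs [Pop t, Push a True, Push b True])"
  have step: "runs A c s [] 5 (s(t := tl (s t), a := hd (s t) # s a, b := hd (s t) # s b))"
    if "s t \<noteq> []" for s
  proof -
    have *: "runs A (seqs [Pop t, Push a x, Push b x]) s [] 4 (s(t := tl (s t), a := x # s a, b := x # s b))" for x
      by (rule runs_eq[OF runs_seqs_Cons[OF runs_Pop runs_seqs_Cons[OF runs_Push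
            runs_seqs_Cons[OF runs_Push runs_seqs_Nil]]]]) (use assms(1-3) in auto)
    have e: "(5 :: nat) = Suc 4" by simp
    show ?thesis unfolding c_def e
      by (rule runs_Branch) (use * that in \<open>auto split: list.split\<close>)
  qed
  have loop: "runs A (While t c) s [] (6 * length (s t) + 1)
      (s(t := [], a := rev (s t) @ s a, b := rev (s t) @ s b))" for s
    by (rule runs_eq[OF runs_loop[where R = "\<lambda>s. s(t := [], a := rev (s t) @ s a, b := rev (s t) @ s b)",
      OF step]]) (use assms in \<open>auto simp: fun_eq_iff neq_Nil_conv\<close>)
  let ?s = "s(a := [], t := rev (s a) @ s t)"
  have "runs A (Seq (moves a t) (While t c)) s []
    ((4 * length (s a) + 1) + (6 * length (?s t) + 1))
    (?s(t := [], a := rev (?s t) @ ?s a, b := rev (?s t) @ ?s b))"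
    by (rule runs_Seq0[OF runs_moves[OF assms(2)] loop])
  moreover have "?s(t := [], a := rev (?s t) @ ?s a, b := rev (?s t) @ ?s b) = s(b := s a @ s b)"
    using assms by (auto simp: fun_eq_iff)
  ultimately show ?thesis using assms unfolding copy_def c_def by simp
qed

subsection \<open>Self-delimiting codes\<close>

text \<open>The bits of the word are listed last to first, so that popping and pushing them one by one
  restores the word on another stack.\<close>

definition enc :: "word \<Rightarrow> word" where
  "enc w = concat (map (\<lambda>b. [True, b]) (rev w)) @ [False]"

text \<open>Total on purpose: a missing end mark or a marker without its bit just ends the word, so
  that a verifier may be run on arbitrary text.\<close>

fun dec :: "word \<Rightarrow> word \<Rightarrow> word \<times> word" where
  "dec acc [] = (acc, [])"
| "dec acc [True] = (acc, [])"
| "dec acc (False # D) = (acc, D)"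
| "dec acc (True # b # D) = dec (b # acc) D"

lemma length_enc: "length (enc w) = 2 * length w + 1"
  by (induction w) (auto simp: enc_def)

lemma dec_enc: "dec [] (enc w @ D) = (w, D)"
proof -
  have "dec acc (concat (map (\<lambda>b. [True, b]) u) @ False # D) = (rev u @ acc, D)" for u acc
    by (induction u arbitrary: acc) auto
  from this[of "[]" "rev w"] show ?thesis by (simp add: enc_def)
qed

lemma dec_length: "length (fst (dec acc D)) + length (snd (dec acc D)) \<le> length acc + length D"
  by (induction acc D rule: dec.induct) auto

text \<open>Even malformed text loses at least one bit per call, which makes reading a list of codes
  terminate.\<close>

lemma dec_length_snd: "D \<noteq> [] \<Longrightarrow> length (snd (dec acc D)) < length D"
proof (induction acc D rule: dec.induct)
  case (4 acc b D)
  then show ?case by (cases "D = []") auto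
qed auto

text \<open>The end mark goes to the bottom and every bit receives its marker on top. Since
  \<open>a\<close> is emptied from its first bit on, the last bit comes out on top.\<close>

definition encode :: "reg \<Rightarrow> reg \<Rightarrow> com" where
  "encode a b = Seq (Push b False) (While a (Seq (mv a b) (Push b True)))"

lemma runs_encode:
  assumes "a \<noteq> b"
  shows "runs A (encode a b) s [] (5 * length (s a) + 2) (s(a := [], b := enc (s a) @ s b))"
proof -
  define c where "c = Seq (mv a b) (Push b True)"
  have step: "runs A c s [] 4 (s(a := tl (s a), b := True # hd (s a) # s b))" if "s a \<noteq> []" for s
  proof -
    have "take 1 (s a) = [hd (s a)]" using that by (cases "s a") auto
    then show ?thesis
      using runs_Seq0[OF runs_mv[OF assms, of A s] runs_Push[of A b True]] assms
      by (simp add: c_def)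
  qed
  have loop: "runs A (While a c) s [] (5 * length (s a) + 1)
      (s(a := [], b := concat (map (\<lambda>b. [True, b]) (rev (s a))) @ s b))" for s
    by (rule runs_eq[OF runs_loop[where R =
          "\<lambda>s. s(a := [], b := concat (map (\<lambda>b. [True, b]) (rev (s a))) @ s b)",
      OF step]]) (use assms in \<open>auto simp: fun_eq_iff neq_Nil_conv\<close>)
  let ?s = "s(b := False # s b)"
  have "runs A (encode a b) s [] (1 + (5 * length (?s a) + 1))
    (?s(a := [], b := concat (map (\<lambda>b. [True, b]) (rev (?s a))) @ ?s b))"
    unfolding encode_def c_def[symmetric] by (rule runs_Seq0[OF runs_Push loop])
  moreover have "?s(a := [], b := concat (map (\<lambda>b. [True, b]) (rev (?s a))) @ ?s b) =
      s(a := [], b := enc (s a) @ s b)"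
    using assms by (auto simp: fun_eq_iff enc_def)
  ultimately show ?thesis using assms by simp
qed

text \<open>A loop can stop only on an empty stack, but the rest of \<open>a\<close> must survive;
  hence the flag on \<open>f\<close>.\<close>

definition decode :: "reg \<Rightarrow> reg \<Rightarrow> reg \<Rightarrow> com" where
  "decode a b f = Seq (Push f True)
     (While f (Branch a (Pop f) (Seq (Pop a) (Pop f)) (Seq (Pop a) (mv a b))))"

lemma runs_decode:
  assumes "a \<noteq> b" "a \<noteq> f" "b \<noteq> f" "s f = []"
  shows "runs A (decode a b f) s [] (6 * length (s a) + 6)
    (s(a := snd (dec (s b) (s a)), b := fst (dec (s b) (s a))))"
proof -
  define c where "c = Branch a (Pop f) (Seq (Pop a) (Pop f)) (Seq (Pop a) (mv a b))"
  have loop: "s f = [True] \<Longrightarrow> s b = acc \<Longrightarrow> s a = D \<Longrightarrow> runs A (While f c) s [] (6 * length D + 5)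
      (s(f := [], a := snd (dec acc D), b := fst (dec acc D)))" for s acc D
  proof (induction acc D arbitrary: s rule: dec.induct)
    case (1 acc)
    have "runs A c s [] 2 (s(f := []))" unfolding c_def numeral_2_eq_2
      by (rule runs_Branch) (use 1 runs_Pop[of A f s] in auto)
    from runs_While_step0[OF _ this runs_While_empty] 1
    have "runs A (While f c) s [] 4 (s(f := []))" by simp
    then show ?case by (rule runs_eq) (use 1 assms in \<open>auto simp: fun_eq_iff\<close>)
  next
    \<comment> \<open>A dangling marker takes two passes: the first pops it and finds no bit to
      move, the second sees \<open>a\<close> empty and drops the flag.\<close>
    case (2 acc)
    have "runs A (Seq (Pop a) (mv a b)) s [] 4 (s(a := []))"
      by (rule runs_Seq0_eq[OF runs_Pop runs_mv[OF assms(1)]]) (use 2 assms in \<open>auto simp: fun_eq_iff\<close>)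
    then have "runs A c s [] 5 (s(a := []))"
      unfolding c_def eval_nat_numeral One_nat_def
      by (intro runs_Branch) (use 2 in simp)
    moreover have "runs A c (s(a := [])) [] 2 (s(a := [], f := []))" unfolding c_def numeral_2_eq_2
      by (rule runs_Branch) (use 2 runs_Pop[of A f "s(a := [])"] assms in auto)
    then have "runs A (While f c) (s(a := [])) [] (Suc (2 + 1)) (s(a := [], f := []))"
      by (rule runs_While_step0[rotated, OF _ runs_While_empty]) (use 2 assms in auto)
    ultimately have "runs A (While f c) s [] (Suc (5 + Suc (2 + 1))) (s(a := [], f := []))"
      by (intro runs_While_step0[where s = s]) (use 2 in auto)
    then show ?case by (rule runs_eq) (use 2 assms in \<open>auto simp: fun_eq_iff\<close>)
  next
    case (3 acc D)
    have "runs A (Seq (Pop a) (Pop f)) s [] 2 (s(a := D, f := []))"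
      by (rule runs_Seq0_eq[OF runs_Pop runs_Pop]) (use 3 assms in \<open>auto simp: fun_eq_iff\<close>)
    then have "runs A c s [] 3 (s(a := D, f := []))"
      unfolding c_def eval_nat_numeral One_nat_def
      by (intro runs_Branch) (use 3 in simp)
    then have "runs A (While f c) s [] (Suc (3 + 1)) (s(a := D, f := []))"
      by (rule runs_While_step0[rotated, OF _ runs_While_empty]) (use 3 assms in auto)
    then show ?case by (rule runs_eq) (use 3 assms in \<open>auto simp: fun_eq_iff\<close>)
  next
    case (4 acc x D)
    let ?s = "s(a := D, b := x # acc)"
    have "runs A (Seq (Pop a) (mv a b)) s [] 4 ?s"
      by (rule runs_Seq0_eq[OF runs_Pop runs_mv[OF assms(1)]]) (use 4(2-) assms in \<open>auto simp: fun_eq_iff\<close>)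
    then have "runs A c s [] 5 ?s"
      unfolding c_def eval_nat_numeral One_nat_def
      by (intro runs_Branch) (use 4(2-) in simp)
    moreover have "runs A (While f c) ?s [] (6 * length D + 5)
      (?s(f := [], a := snd (dec (x # acc) D), b := fst (dec (x # acc) D)))"
      by (rule 4(1)) (use 4(2-) assms in auto)
    ultimately have "runs A (While f c) s [] (Suc (5 + (6 * length D + 5)))
      (?s(f := [], a := snd (dec (x # acc) D), b := fst (dec (x # acc) D)))"
      using 4(2) by (intro runs_While_step0[where s = s]) auto
    then show ?case by (rule runs_eq) (use assms in \<open>auto simp: fun_eq_iff\<close>)
  qed
  let ?s = "s(f := [True])"
  have "runs A (decode a b f) s [] (1 + (6 * length (s a) + 5))
    (?s(f := [], a := snd (dec (s b) (s a)), b := fst (dec (s b) (s a))))"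
    unfolding decode_def c_def[symmetric]
    by (rule runs_Seq0[OF _ loop]) (use runs_Push[of A f True s] assms in auto)
  moreover have "?s(f := [], a := snd (dec (s b) (s a)), b := fst (dec (s b) (s a))) =
      s(a := snd (dec (s b) (s a)), b := fst (dec (s b) (s a)))"
    using assms by (auto simp: fun_eq_iff)
  ultimately show ?thesis by (simp add: add.commute)
qed

section \<open>Polynomial bounds\<close>

lemma poly_nat_mono: "m \<le> n \<Longrightarrow> poly (p :: nat poly) m \<le> poly p n"
  by (induction p) (auto intro!: add_mono mult_mono)

text \<open>Running times are written as natural expressions, and closure rules supply the
  polynomial only at the end.\<close>

definition poly_bounded :: "(nat \<Rightarrow> nat) \<Rightarrow> bool" where
  "poly_bounded f \<longleftrightarrow> (\<exists>p. \<forall>n. f n \<le> poly p n)"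

lemma poly_bounded_const [intro!]: "poly_bounded (\<lambda>n. c)"
  unfolding poly_bounded_def by (rule exI[of _ "[:c:]"]) simp

lemma poly_bounded_id [intro!]: "poly_bounded (\<lambda>n. n)"
  unfolding poly_bounded_def by (rule exI[of _ "[:0, 1:]"]) simp

lemma poly_bounded_add [intro!]: assumes "poly_bounded f" "poly_bounded g" shows "poly_bounded (\<lambda>n. f n + g n)"
proof -
  from assms obtain p q where "\<forall>n. f n \<le> poly p n" "\<forall>n. g n \<le> poly q n"
    unfolding poly_bounded_def by blast
  then show ?thesis unfolding poly_bounded_def by (intro exI[of _ "p + q"]) (simp add: add_mono)
qed

lemma poly_bounded_mult [intro!]: assumes "poly_bounded f" "poly_bounded g" shows "poly_bounded (\<lambda>n. f n * g n)"
proof -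
  from assms obtain p q where "\<forall>n. f n \<le> poly p n" "\<forall>n. g n \<le> poly q n"
    unfolding poly_bounded_def by blast
  then show ?thesis unfolding poly_bounded_def by (intro exI[of _ "p * q"]) (simp add: mult_mono)
qed

lemma poly_bounded_Suc [intro!]: "poly_bounded f \<Longrightarrow> poly_bounded (\<lambda>n. Suc (f n))"
  using poly_bounded_add[OF _ poly_bounded_const[of 1]] by simp

lemma poly_bounded_comp [intro!]: assumes "poly_bounded f" shows "poly_bounded (\<lambda>n. poly p (f n))"
proof -
  from assms obtain q where q: "\<forall>n. f n \<le> poly q n"
    unfolding poly_bounded_def by blast
  show ?thesis unfolding poly_bounded_def
    by (rule exI[of _ "pcompose p q"]) (simp add: poly_pcompose poly_nat_mono q)
qed


section \<open>Computing polynomials in unary\<close>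

text \<open>Horner's scheme carried out on lengths. The bits of the result are arbitrary; it serves
  only as a number in unary.\<close>

fun poly_word :: "nat list \<Rightarrow> word \<Rightarrow> word" where
  "poly_word [] x = []"
| "poly_word (a # as) x = replicate a True @ concat (replicate (length (poly_word as x)) x)"

lemma length_poly_word: "length (poly_word (coeffs q) x) = poly q (length x)"
proof -
  have "length (poly_word as x) = foldr (\<lambda>a b. a + length x * b) as 0" for as
    by (induction as) (auto simp: length_concat sum_list_replicate)
  then show ?thesis
    by (simp add: poly_def horner_sum_foldr)
qed

fun polyc :: "reg \<Rightarrow> reg \<Rightarrow> reg \<Rightarrow> reg \<Rightarrow> nat list \<Rightarrow> com" where
  "polyc x y t t' [] = Skip"
| "polyc x y t t' (a # as) = seqs [polyc x y t t' as, moves y t, While t (Seq (Pop t) (copy x y t')),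
     seqs (replicate a (Push y True))]"

lemma runs_pushes:
  "runs A (seqs (replicate a (Push y b))) s [] (a + 1) (s(y := replicate a b @ s y))"
proof (induction a arbitrary: s)
  case 0
  then show ?case using runs_seqs_Nil by auto
next
  case (Suc a)
  show ?case unfolding replicate.simps
    by (rule runs_eq[OF runs_seqs_Cons[OF runs_Push Suc]])
      (auto simp: fun_eq_iff replicate_app_Cons_same)
qed

text \<open>The polynomial is fixed before the input stack, the oracle and the state, because the
  program will be run on varying stacks with one common bound.\<close>

lemma runs_polyc:
  "\<exists>p. \<forall>x A s. distinct [x, y, t, t'] \<longrightarrow> s y = [] \<longrightarrow> s t = [] \<longrightarrow> s t' = [] \<longrightarrow>
    runs A (polyc x y t t' as) s [] (poly p (length (s x))) (s(y := poly_word as (s x)))"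
proof (induction as)
  case Nil
  have "runs A (polyc x y t t' []) s [] (poly [:1:] (length (s x))) (s(y := poly_word [] (s x)))"
    if "s y = []" for x A s
    unfolding polyc.simps by (rule runs_eq[OF runs_Skip]) (use that in \<open>auto simp: fun_eq_iff\<close>)
  then show ?case by blast
next
  case (Cons a as)
  then obtain p where p: "\<And>x A s. distinct [x, y, t, t'] \<Longrightarrow> s y = [] \<Longrightarrow> s t = [] \<Longrightarrow> s t' = [] \<Longrightarrow>
    runs A (polyc x y t t' as) s [] (poly p (length (s x))) (s(y := poly_word as (s x)))"
    by blast
  have loop: "runs A (While t (Seq (Pop t) (copy x y t'))) s [] (Suc (10 * length w + 3) * length (s t) + 1)
      (s(t := [], y := concat (replicate (length (s t)) w) @ s y))"
    if assms: "distinct [x, y, t, t']" and "s t' = []" "s x = w" for x A s w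
  proof -
    have "s t = v \<Longrightarrow> s t' = [] \<Longrightarrow> s x = w \<Longrightarrow>
      runs A (While t (Seq (Pop t) (copy x y t'))) s [] (Suc (10 * length w + 3) * length v + 1)
      (s(t := [], y := concat (replicate (length v) w) @ s y))" for v
    proof (induction v arbitrary: s)
      case Nil
      then show ?case by (intro runs_eq[OF runs_While_empty]) (auto simp: fun_eq_iff)
    next
      case (Cons b v)
      let ?s = "s(t := tl (s t), y := w @ s y)"
      have "runs A (Seq (Pop t) (copy x y t')) s [] (10 * length w + 3) ?s"
        by (rule runs_Seq0_eq[OF runs_Pop runs_copy]) (use Cons assms in auto)
      moreover have "runs A (While t (Seq (Pop t) (copy x y t'))) ?s [] (Suc (10 * length w + 3) * length v + 1)
        (?s(t := [], y := concat (replicate (length v) w) @ ?s y))"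
        by (rule Cons.IH) (use Cons assms in auto)
      ultimately have "runs A (While t (Seq (Pop t) (copy x y t'))) s []
         (Suc ((10 * length w + 3) + (Suc (10 * length w + 3) * length v + 1)))
        (?s(t := [], y := concat (replicate (length v) w) @ ?s y))"
        by (intro runs_While_step0[where s = s]) (use Cons in auto)
      moreover have "concat (replicate n w) @ w @ u = w @ concat (replicate n w) @ u" for n u
        by (induction n) auto
      ultimately show ?case
        by (elim runs_eq) (use assms in \<open>auto simp: fun_eq_iff\<close>)
    qed
    then show ?thesis using that by simp
  qed
  define T where "T n L = poly p n + ((4 * L + 1) + ((Suc (10 * n + 3) * L + 1) + ((a + 1) + 1)))" for n L
  have main: "runs A (polyc x y t t' (a # as)) s [] (T (length (s x)) (length (poly_word as (s x))))
      (s(y := poly_word (a # as) (s x)))"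
    if assms: "distinct [x, y, t, t']" and "s y = []" "s t = []" "s t' = []" for x A s
    unfolding polyc.simps
    by (rule runs_eq[OF runs_seqs_Cons[OF p runs_seqs_Cons[OF runs_moves
          runs_seqs_Cons[OF loop[where w = "s x"] runs_seqs_Cons[OF runs_pushes runs_seqs_Nil]]]]])
      (use that assms in \<open>auto simp: fun_eq_iff T_def\<close>)
  \<comment> \<open>The intermediate result has a length that depends only on the length of the
    input, so the second argument of \<open>T\<close> can be eliminated.\<close>
  have L: "length (poly_word as u) = foldr (\<lambda>a b. a + length u * b) as 0" for u
    by (induction as) (auto simp: length_concat sum_list_replicate)
  have "poly_bounded (\<lambda>n. foldr (\<lambda>a b. a + n * b) as 0)"
    by (induction as) auto
  then have "poly_bounded (\<lambda>n. T n (foldr (\<lambda>a b. a + n * b) as 0))"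
    unfolding T_def by auto
  then obtain p' where "T n (foldr (\<lambda>a b. a + n * b) as 0) \<le> poly p' n" for n
    unfolding poly_bounded_def by blast
  then show ?case
    by (intro exI[of _ p'] allI impI runs_mono[OF main]) (simp_all only: L)
qed


section \<open>Embedding a program in the stacks from 30 on\<close>

text \<open>Used in two ways: with \<open>Query\<close> for \<open>q\<close> it only relocates a
  program, and with a subroutine for \<open>q\<close> it eliminates the oracle. Stacks below 30
  become scratch space.\<close>

fun embed :: "(reg \<Rightarrow> com) \<Rightarrow> com \<Rightarrow> com" where
  "embed q Skip = Skip"
| "embed q (Push r b) = Push (r + 30) b"
| "embed q (Pop r) = Pop (r + 30)"
| "embed q (Flip r) = Flip (r + 30)"
| "embed q (Query r) = q (r + 30)"
| "embed q (Seq c d) = Seq (embed q c) (embed q d)"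
| "embed q (Branch r c d e) = Branch (r + 30) (embed q c) (embed q d) (embed q e)"
| "embed q (While r c) = While (r + 30) (embed q c)"

definition up :: "state \<Rightarrow> state \<Rightarrow> state" where
  "up l s = (\<lambda>r. if r < 30 then l r else s (r - 30))"

lemma up_upd: "up l (s(r := w)) = (up l s)(r + 30 := w)"
  by (auto simp: up_def fun_eq_iff)

lemma up_plus [simp]: "up l s (r + 30) = s r"
  by (simp add: up_def)

lemma exec_embed: "exec A c s bs t s' \<Longrightarrow> exec A (embed Query c) (up l s) bs t (up l s')"
proof (induction rule: exec.induct)
  case (Query r s)
  then show ?case unfolding up_upd embed.simps using exec.Query[where A = A and s = "up l s" and r = "r + 30"] by (simp add: fun_upd_def)
next
  case (Push r b s)
  then show ?case using exec.Push[where A = A and s = "up l s" and r = "r + 30" and b = b] by (simp add: up_upd[unfolded fun_upd_def] fun_upd_def)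
next
  case (Pop r s)
  then show ?case using exec.Pop[where A = A and s = "up l s" and r = "r + 30"] by (simp add: up_upd[unfolded fun_upd_def] fun_upd_def)
next
  case (Flip r s b)
  then show ?case using exec.Flip[where A = A and s = "up l s" and r = "r + 30" and b = b] by (simp add: up_upd[unfolded fun_upd_def] fun_upd_def)
qed (auto intro: exec.intros exec.Skip[unfolded One_nat_def] exec.While_Empty[unfolded One_nat_def])

text \<open>Bounds the stacks that may be changed. Stacks that are merely tested by
  \<open>Branch\<close> or \<open>While\<close> need not be erased afterwards and do not
  count.\<close>

fun bnd :: "com \<Rightarrow> nat" where
  "bnd Skip = 0"
| "bnd (Push r b) = Suc r"
| "bnd (Pop r) = Suc r"
| "bnd (Flip r) = Suc r"
| "bnd (Query r) = Suc r"
| "bnd (Seq c d) = max (bnd c) (bnd d)"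
| "bnd (Branch r c d e) = max (bnd c) (max (bnd d) (bnd e))"
| "bnd (While r c) = bnd c"

lemma exec_frame: "exec A c s bs t s' \<Longrightarrow> bnd c \<le> r \<Longrightarrow> s' r = s r"
  by (induction rule: exec.induct) auto

text \<open>A step adds at most one bit to a stack, an oracle answer included. This bounds the texts
  of queries and the cost of erasing what a call leaves behind.\<close>

lemma exec_length: "exec A c s bs t s' \<Longrightarrow> length (s' r) \<le> length (s r) + t"
  by (induction rule: exec.induct) auto

definition clears :: "nat \<Rightarrow> com" where
  "clears n = seqs (map (\<lambda>i. clear (i + 30)) [0..<n])"

lemma runs_clears:
  assumes "\<And>r. length (s r) \<le> S"
  shows "runs A (clears n) s [] (n * (2 * S + 1) + 1) (\<lambda>r. if 30 \<le> r \<and> r < 30 + n then [] else s r)"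
proof -
  have "\<forall>r. length (s r) \<le> S \<Longrightarrow> runs A (seqs (map (\<lambda>i. clear (i + 30)) is)) s []
      (length is * (2 * S + 1) + 1) (\<lambda>r. if r \<in> (\<lambda>i. i + 30) ` set is then [] else s r)" for "is" s
  proof (induction "is" arbitrary: s)
    case Nil
    then show ?case using runs_seqs_Nil by simp
  next
    case (Cons i "is")
    have 1: "runs A (clear (i + 30)) s [] (2 * S + 1) (s(i + 30 := []))"
      by (rule runs_mono[OF runs_clear]) (use Cons.prems in simp)
    have "runs A (seqs (map (\<lambda>i. clear (i + 30)) is)) (s(i + 30 := [])) []
      (length is * (2 * S + 1) + 1) (\<lambda>r. if r \<in> (\<lambda>i. i + 30) ` set is then [] else (s(i + 30 := [])) r)"
      by (rule Cons.IH) (use Cons.prems in simp)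
    from runs_seqs_Cons[OF 1 this] show ?case unfolding list.map
      by (rule runs_eq) (auto simp: fun_eq_iff)
  qed
  from this[OF allI[OF assms], of "[0..<n]"] show ?thesis
    unfolding clears_def
    by (rule runs_eq) (auto simp: fun_eq_iff image_iff intro!: bexI[of _ "_ - 30"])
qed

text \<open>A negative answer is recorded by an additional bit on stack \<open>out\<close>.\<close>

definition call :: "com \<Rightarrow> reg \<Rightarrow> reg \<Rightarrow> reg \<Rightarrow> reg \<Rightarrow> reg \<Rightarrow> com" where
  "call c x y z out t = seqs [copy x 30 t, copy y 31 t, copy z 32 t, embed Query c,
     Branch 30 Skip (Push out True) Skip, clears (max 3 (bnd c))]"

definition call_time :: "com \<Rightarrow> nat \<Rightarrow> nat \<Rightarrow> nat" where
  "call_time c S T = 3 * (10 * S + 2) + T + 4 + max 3 (bnd c) * (2 * (Suc S + T) + 1)"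

lemma runs_call:
  assumes c: "computes_within A c [s x, s y, s z] T [b]"
    and reg: "x < 30" "y < 30" "z < 30" "out < 30" "t < 30" "distinct [x, y, z, out, t]"
    and s: "s t = []" "\<And>r. 30 \<le> r \<Longrightarrow> s r = []"
    and S: "\<And>r. length (s r) \<le> S"
  shows "runs A (call c x y z out t) s [] (call_time c S T) (s(out := (if b then [] else [True]) @ s out))"
proof -
  from c obtain s' \<tau> where s': "exec A c (init [s x, s y, s z]) [] \<tau> s'" "s' 0 = [b]" "\<tau> \<le> T"
    unfolding computes_within_def by blast
  define s1 where "s1 = s(30 := s x, 31 := s y, 32 := s z)"
  have cp: "runs A (copy a d t) u [] (10 * S + 2) (u(d := u a))"
    if "a < 30" "a \<noteq> t" "length (u a) \<le> S" "u d = []" "30 \<le> d" "u t = []" for a d u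
    by (rule runs_eq[OF runs_copy]) (use that reg in auto)
  have 1: "runs A (copy x 30 t) s [] (10 * S + 2) (s(30 := s x))"
    by (rule cp) (use reg s S in auto)
  have 2: "runs A (copy y 31 t) (s(30 := s x)) [] (10 * S + 2) (s(30 := s x, 31 := s y))"
    by (rule runs_eq[OF cp]) (use reg s S in auto)
  have 3: "runs A (copy z 32 t) (s(30 := s x, 31 := s y)) [] (10 * S + 2) s1"
    unfolding s1_def by (rule runs_eq[OF cp]) (use reg s S in auto)
  have s1_up: "s1 = up s (init [s x, s y, s z])"
  proof
    fix r :: nat
    consider "r < 30" | "r = 30" | "r = 31" | "r = 32" | "r > 32" by linarith
    then show "s1 r = up s (init [s x, s y, s z]) r"
      by cases (auto simp: s1_def up_def init_def s(2))
  qed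
  define s2 where "s2 = up s s'"
  have 4: "runs A (embed Query c) s1 [] T s2"
    unfolding s1_up s2_def runs_def using exec_embed[OF s'(1)] s'(3) by blast
  have s230: "s2 30 = [b]" using s' by (simp add: s2_def up_def)
  define s3 where "s3 = s2(out := (if b then [] else [True]) @ s2 out)"
  have 5: "runs A (Branch 30 Skip (Push out True) Skip) s2 [] 2 s3"
    unfolding numeral_2_eq_2 s3_def
    by (rule runs_Branch) (use s230 runs_Skip[of A s2] runs_Push[of A out True s2] in auto)
  have l2: "length (s2 r) \<le> S + T" for r
    using exec_length[OF s'(1), of "r - 30"] s'(3) S[of r] S[of x] S[of y] S[of z]
    by (auto simp: s2_def up_def init_def nth_Cons split: if_splits nat.splits)
  have l3: "length (s3 r) \<le> Suc S + T" for r
    using l2[of r] by (auto simp: s3_def)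
  let ?f = "\<lambda>r. if 30 \<le> r \<and> r < 30 + max 3 (bnd c) then [] else s3 r"
  have 6: "runs A (clears (max 3 (bnd c))) s3 [] (max 3 (bnd c) * (2 * (Suc S + T) + 1) + 1) ?f"
    by (rule runs_clears[OF l3])
  have f: "?f = s(out := (if b then [] else [True]) @ s out)"
  proof
    fix r :: nat
    consider "r < 30" | "30 \<le> r" "r < 30 + max 3 (bnd c)" | "30 + max 3 (bnd c) \<le> r" by linarith
    then show "?f r = (s(out := (if b then [] else [True]) @ s out)) r"
    proof cases
      case 3
      \<comment> \<open>Above the erased block \<open>c\<close> has changed nothing, and the 3 in
        \<open>max 3 (bnd c)\<close> keeps the three arguments inside the block even if
        \<open>c\<close> never touches them.\<close>
      then have "s' (r - 30) = init [s x, s y, s z] (r - 30)"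
        by (intro exec_frame[OF s'(1)]) auto
      with 3 reg s show ?thesis by (auto simp: s3_def s2_def up_def init_def)
    qed (use reg s in \<open>auto simp: s3_def s2_def up_def\<close>)
  qed
  have "runs A (call c x y z out t) s [] ((10 * S + 2) + ((10 * S + 2) + ((10 * S + 2) + (T + (2 +
      ((max 3 (bnd c) * (2 * (Suc S + T) + 1) + 1) + 1)))))) ?f"
    unfolding call_def by (intro runs_seqs_Cons[OF 1] runs_seqs_Cons[OF 2] runs_seqs_Cons[OF 3]
      runs_seqs_Cons[OF 4] runs_seqs_Cons[OF 5] runs_seqs_Cons[OF 6] runs_seqs_Nil)
  then show ?thesis unfolding f by (rule runs_mono) (simp add: call_time_def)
qed

section \<open>Las Vegas computations\<close>

text \<open>State and next coin determine each step, so it is enough that the two coin words have a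
  common extension. In particular no halting word is a proper prefix of another one.\<close>

lemma exec_deterministic:
  "exec A c s bs t s' \<Longrightarrow> exec A c s bs' t' s'' \<Longrightarrow> bs @ r = bs' @ r' \<Longrightarrow> bs = bs' \<and> t = t' \<and> s' = s''"
proof (induction arbitrary: bs' t' s'' r r' rule: exec.induct)
  case (Seq c s bs t s1 d bs2 t2 s2)
  from Seq.prems(1) obtain b1 b2 u1 u2 v where
    *: "exec A c s b1 u1 v" "exec A d v b2 u2 s''" "bs' = b1 @ b2" "t' = u1 + u2"
    by (auto elim: exec.cases)
  have 1: "bs = b1 \<and> t = u1 \<and> s1 = v"
    by (rule Seq.IH(1)[OF *(1), of "bs2 @ r" "b2 @ r'"]) (use Seq.prems(2) * in simp)
  have "bs2 = b2 \<and> t2 = u2 \<and> s2 = s''"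
    by (rule Seq.IH(2)[of _ _ _ r r']) (use 1 * Seq.prems(2) in auto)
  with 1 * show ?case by simp
next
  case (While_Loop s r0 c bs t s1 bs2 t2 s2)
  from While_Loop.prems(1) While_Loop.hyps(1) obtain b1 b2 u1 u2 v where
    *: "exec A c s b1 u1 v" "exec A (While r0 c) v b2 u2 s''" "bs' = b1 @ b2" "t' = Suc (u1 + u2)"
    by (auto elim: exec.cases)
  have 1: "bs = b1 \<and> t = u1 \<and> s1 = v"
    by (rule While_Loop.IH(1)[OF *(1), of "bs2 @ r" "b2 @ r'"]) (use While_Loop.prems(2) * in simp)
  have "bs2 = b2 \<and> t2 = u2 \<and> s2 = s''"
    by (rule While_Loop.IH(2)[of _ _ _ r r']) (use 1 * While_Loop.prems(2) in auto)
  with 1 * show ?case by simp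
next
  case (Branch_Empty s r0 c bs t s1 d e)
  from Branch_Empty.prems(1) Branch_Empty.hyps(1) obtain u where "exec A c s bs' u s''" "t' = Suc u"
    by (auto elim: exec.cases)
  with Branch_Empty show ?case by blast
next
  case (Branch_0 s r0 w d bs t s1 c e)
  from Branch_0.prems(1) Branch_0.hyps(1) obtain u where "exec A d s bs' u s''" "t' = Suc u"
    by (auto elim: exec.cases)
  with Branch_0 show ?case by blast
next
  case (Branch_1 s r0 w e bs t s1 c d)
  from Branch_1.prems(1) Branch_1.hyps(1) obtain u where "exec A e s bs' u s''" "t' = Suc u"
    by (auto elim: exec.cases)
  with Branch_1 show ?case by blast
qed (auto elim: exec.cases)

section \<open>Running time as a random variable on coin sequences\<close>

definition runtime :: "word set \<Rightarrow> com \<Rightarrow> state \<Rightarrow> bool stream \<Rightarrow> ennreal" where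
  "runtime A c s \<omega> = (INF t \<in> {t. \<exists>n s'. exec A c s (stake n \<omega>) t s'}. of_nat t)"

lemma run_time_eq_runtime: "run_time A c x = runtime A c (init [x])"
  by (simp add: run_time_def runtime_def fun_eq_iff)

lemma runtime_le: "exec A c s (stake n \<omega>) t s' \<Longrightarrow> runtime A c s \<omega> \<le> of_nat t"
  unfolding runtime_def by (rule INF_lower) auto

lemma runtime_eq: assumes "exec A c s (stake n \<omega>) t s'" shows "runtime A c s \<omega> = of_nat t"
proof -
  \<comment> \<open>Two prefixes of one sequence get a common extension by appending the missing
    stretch to the shorter one; the other stretch is empty.\<close>
  have "t' = t" if "exec A c s (stake n' \<omega>) t' s''" for n' t' s''
    using exec_deterministic[OF that assms, of "stake (n - n') (sdrop n' \<omega>)" "stake (n' - n) (sdrop n \<omega>)"]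
    by (metis add_diff_inverse_nat append.right_neutral diff_is_0_eq le_add_diff_inverse linear stake.simps(1) stake_add)
  with assms have "{t. \<exists>n s'. exec A c s (stake n \<omega>) t s'} = {t}"
    by blast
  then show ?thesis by (simp add: runtime_def)
qed

lemma runtime_cases:
  obtains "runtime A c s \<omega> = \<infinity>" | n t s' where "exec A c s (stake n \<omega>) t s'" "runtime A c s \<omega> = of_nat t"
proof (cases "\<exists>n t s'. exec A c s (stake n \<omega>) t s'")
  case True
  then show ?thesis using that(2) runtime_eq by blast
next
  case False
  then have "runtime A c s \<omega> = \<infinity>" by (simp add: runtime_def)
  then show ?thesis by (rule that(1))
qed

lemma sets_coins: "sets coins = sets (stream_space (count_space (UNIV :: bool set)))"
  unfolding coins_def by (rule sets_stream_space_cong) simp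

lemma measurable_coins_eq: "measurable coins N = measurable (stream_space (count_space (UNIV :: bool set))) N"
  by (rule measurable_cong_sets[OF sets_coins refl])

lemma stake_coins [measurable]: "stake n \<in> measurable coins (count_space UNIV)"
  unfolding measurable_coins_eq by measurable

lemma sdrop_coins [measurable]: "sdrop n \<in> measurable coins coins"
  unfolding coins_def by measurable

lemma shift_coins [measurable]: "(@-) bs \<in> measurable coins coins"
proof (induction bs)
  case (Cons b bs)
  have "(\<lambda>\<omega>. b ## (bs @- \<omega>)) \<in> measurable coins coins"
    using Cons unfolding coins_def by measurable
  then show ?case by (simp add: comp_def)
qed simp

lemma runtime_measurable [measurable]: "runtime A c s \<in> borel_measurable coins"
proof -
  \<comment> \<open>A countable infimum of functions of finitely many coins, each of which is
    measurable because its domain is discrete.\<close>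
  have eq: "runtime A c s \<omega> = (INF n. (\<lambda>bs. INF t \<in> {t. \<exists>s'. exec A c s bs t s'}. of_nat t) (stake n \<omega>))" for \<omega>
    unfolding runtime_def by (intro antisym) (auto intro!: INF_greatest intro: INF_lower2 INF_lower)
  have "(\<lambda>\<omega>. INF n. (\<lambda>bs. INF t \<in> {t. \<exists>s'. exec A c s bs t s'}. (of_nat t :: ennreal)) (stake n \<omega>))
    \<in> borel_measurable coins"
    by (intro borel_measurable_INF) (auto intro!: measurable_compose[OF stake_coins])
  then show ?thesis unfolding eq[abs_def] .
qed

interpretation coins: prob_space coins
  unfolding coins_def by (rule prob_space.prob_space_stream_space) (rule measure_pmf.prob_space_axioms)

lemma finite_words [simp]: "finite (words n)"
  using finite_lists_length_eq[of "UNIV :: bool set" n] by (simp add: words_def)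

lemma card_words [simp]: "card (words n) = 2 ^ n"
  using card_lists_length_eq[of "UNIV :: bool set" n] by (simp add: words_def)

lemma words_0 [simp]: "words 0 = {[]}"
  by (auto simp: words_def)

lemma sum_words_Suc:
  "(\<Sum>w\<in>words (Suc n). f w) = (\<Sum>w\<in>words n. f (True # w)) + (\<Sum>w\<in>words n. f (False # w) :: 'a :: comm_monoid_add)"
proof -
  have *: "words (Suc n) = (#) True ` words n \<union> (#) False ` words n"
    by (auto simp: words_def length_Suc_conv image_iff)
  show ?thesis unfolding *
    by (subst sum.union_disjoint) (auto simp: sum.reindex)
qed

lemma sum_words_add:
  "(\<Sum>w\<in>words (m + n). f w) = (\<Sum>u\<in>words m. \<Sum>v\<in>words n. f (u @ v) :: 'a :: comm_monoid_add)"
  by (induction m arbitrary: f) (simp_all add: sum_words_Suc)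

text \<open>Fubini, one coin at a time. It turns statements about the infinite product measure into
  averages over the first \<open>n\<close> coins.\<close>

lemma nn_integral_coins:
  fixes F :: "bool stream \<Rightarrow> ennreal"
  assumes "F \<in> borel_measurable coins"
  shows "(\<integral>\<^sup>+\<omega>. F \<omega> \<partial>coins) = (\<Sum>bs\<in>words n. \<integral>\<^sup>+\<omega>. F (bs @- \<omega>) \<partial>coins) / 2 ^ n"
  using assms
proof (induction n arbitrary: F)
  case (Suc n)
  note [measurable] = Suc.prems
  have F: "(\<lambda>\<omega>. F (b ## \<omega>)) \<in> borel_measurable coins" for b
    using measurable_compose[OF shift_coins[of "[b]"] Suc.prems] by simp
  have "(\<integral>\<^sup>+\<omega>. F \<omega> \<partial>coins) = (\<integral>\<^sup>+b. \<integral>\<^sup>+\<omega>. F (b ## \<omega>) \<partial>coins \<partial>measure_pmf (bernoulli_pmf (1 / 2)))"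
    using prob_space.nn_integral_stream_space[OF measure_pmf.prob_space_axioms,
      of F "bernoulli_pmf (1 / 2)"] Suc.prems unfolding coins_def by simp
  also have "\<dots> = ((\<integral>\<^sup>+\<omega>. F (True ## \<omega>) \<partial>coins) + (\<integral>\<^sup>+\<omega>. F (False ## \<omega>) \<partial>coins)) / 2"
    using divide_ennreal[of 1 2] by (simp add: divide_ennreal_def distrib_right)
  also have "\<dots> = (\<Sum>bs\<in>words (Suc n). \<integral>\<^sup>+\<omega>. F (bs @- \<omega>) \<partial>coins) / 2 ^ Suc n"
    unfolding Suc.IH[OF F] sum_words_Suc
    by (simp add: divide_ennreal_def ennreal_inverse_mult power_less_top_ennreal distrib_right distrib_left mult_ac)
  finally show ?case .
qed (simp add: divide_ennreal_def)

text \<open>Not only the answer but the whole final state must be independent of the coins: a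
  continuation then starts from a fixed state, and expected times simply add up.\<close>

definition las_vegas :: "word set \<Rightarrow> com \<Rightarrow> state \<Rightarrow> nat \<Rightarrow> state \<Rightarrow> bool" where
  "las_vegas A c s e s' \<longleftrightarrow> (\<forall>bs t s''. exec A c s bs t s'' \<longrightarrow> s'' = s') \<and>
     (\<integral>\<^sup>+\<omega>. runtime A c s \<omega> \<partial>coins) \<le> of_nat e"

lemma las_vegas_mono: "las_vegas A c s e s' \<Longrightarrow> e \<le> e' \<Longrightarrow> las_vegas A c s e' s'"
  unfolding las_vegas_def by (meson of_nat_mono order_trans)

lemma las_vegas_runs:
  assumes "runs A c s [] T s'"
  shows "las_vegas A c s T s'"
proof -
  from assms obtain t where t: "exec A c s [] t s'" "t \<le> T"
    by (auto simp: runs_def)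
  have "runtime A c s \<omega> \<le> of_nat T" for \<omega>
    using runtime_le[of A c s 0 \<omega> t s'] t by (simp add: order_trans[OF _ of_nat_mono])
  then have "(\<integral>\<^sup>+\<omega>. runtime A c s \<omega> \<partial>coins) \<le> (\<integral>\<^sup>+\<omega>. of_nat T \<partial>coins)"
    by (intro nn_integral_mono)
  moreover have "exec A c s bs u s'' \<Longrightarrow> s'' = s'" for bs u s''
    using exec_deterministic[OF t(1), of bs u s'' bs "[]"] by simp
  ultimately show ?thesis unfolding las_vegas_def by (simp add: coins.emeasure_space_1)
qed

text \<open>By determinism at most one prefix of \<open>\<omega>\<close> is a halting word.
  Integrated over the coins this is Kraft's inequality.\<close>

lemma prefix_free_le_1:
  "(\<Sum>n. if \<exists>t s'. exec A c s (stake n \<omega>) t s' then 1 else 0) \<le> (1 :: ennreal)"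
proof (cases "\<exists>n t s'. exec A c s (stake n \<omega>) t s'")
  case True
  then obtain n t s' where n: "exec A c s (stake n \<omega>) t s'" by blast
  have "n' = n" if "exec A c s (stake n' \<omega>) t' s''" for n' t' s''
  proof -
    have "stake n' \<omega> = stake n \<omega>"
      using exec_deterministic[OF that n, of "stake (n - n') (sdrop n' \<omega>)" "stake (n' - n) (sdrop n \<omega>)"]
      by (metis add_diff_inverse_nat append.right_neutral diff_is_0_eq le_add_diff_inverse linear stake.simps(1) stake_add)
    then show ?thesis by (metis length_stake)
  qed
  then have "(\<lambda>m. if \<exists>t s'. exec A c s (stake m \<omega>) t s' then 1 else (0 :: ennreal)) = (\<lambda>m. if m = n then 1 else 0)"
    using n by (intro ext) metis
  moreover have "(\<Sum>m. if m = n then 1 else 0) = (1 :: ennreal)"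
    using sums_unique[OF sums_single[of n "\<lambda>_. 1 :: ennreal"]] by (rule sym)
  ultimately show ?thesis by (simp only: order_refl)
next
  case False
  then show ?thesis by simp
qed

lemma las_vegas_Seq:
  assumes c: "las_vegas A c s e s'" and d: "las_vegas A d s' e' s''"
  shows "las_vegas A (Seq c d) s (e + e') s''"
proof -
  define H where "H bs \<longleftrightarrow> (\<exists>t s1. exec A c s bs t s1)" for bs
  \<comment> \<open>\<open>c\<close> stops at a random position. For each fixed position
    \<open>n\<close>, having stopped there depends on the first \<open>n\<close> coins only and the
    run of \<open>d\<close> on the remaining ones only.\<close>
  let ?f = "\<lambda>n \<omega>. (if H (stake n \<omega>) then 1 else 0) * runtime A d s' (sdrop n \<omega>)"
  have runtime: "runtime A (Seq c d) s \<omega> \<le> runtime A c s \<omega> + (\<Sum>n. ?f n \<omega>)" for \<omega>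
  proof (rule runtime_cases[of A c s \<omega>])
    fix n t s1 assume 1: "exec A c s (stake n \<omega>) t s1" "runtime A c s \<omega> = of_nat t"
    then have s1: "s1 = s'" using c by (auto simp: las_vegas_def)
    have "(\<Sum>k\<in>{n}. ?f k \<omega>) \<le> (\<Sum>n. ?f n \<omega>)"
      by (intro sum_le_suminf) auto
    moreover have "H (stake n \<omega>)" using 1 by (auto simp: H_def)
    ultimately have le: "runtime A d s' (sdrop n \<omega>) \<le> (\<Sum>n. ?f n \<omega>)"
      by simp
    show ?thesis
    proof (rule runtime_cases[of A d s' "sdrop n \<omega>"])
      fix n' t' s2 assume 2: "exec A d s' (stake n' (sdrop n \<omega>)) t' s2" "runtime A d s' (sdrop n \<omega>) = of_nat t'"
      have "exec A (Seq c d) s (stake (n + n') \<omega>) (t + t') s2"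
        using exec.Seq[OF 1(1)[unfolded s1] 2(1)] by (simp add: stake_add)
      from runtime_le[OF this] show ?thesis using 1(2) 2(2) le by (simp add: add_left_mono order_trans)
    qed (use le in \<open>simp add: top_unique\<close>)
  qed simp
  have [measurable]: "Measurable.pred coins (\<lambda>\<omega>. H (stake n \<omega>))" for n
    by (rule measurable_compose[OF stake_coins]) simp
  have sdrop_meas [measurable]: "(\<lambda>\<omega>. g (sdrop n \<omega>)) \<in> borel_measurable coins"
    if "g \<in> borel_measurable coins" for n and g :: "bool stream \<Rightarrow> ennreal"
    by (rule measurable_compose[OF sdrop_coins that])
  \<comment> \<open>Independence of the first \<open>n\<close> coins from the rest, with an
    arbitrary \<open>g\<close> in place of the time of \<open>d\<close>; the constant 1 for
    \<open>g\<close> gives the bare probability of stopping after \<open>n\<close> coins.\<close>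
  have step: "(\<integral>\<^sup>+\<omega>. (if H (stake n \<omega>) then 1 else 0) * g (sdrop n \<omega>) \<partial>coins) =
     (\<Sum>bs\<in>words n. if H bs then 1 else 0) / 2 ^ n * (\<integral>\<^sup>+\<omega>. g \<omega> \<partial>coins)"
    if [measurable]: "g \<in> borel_measurable coins" for n and g :: "bool stream \<Rightarrow> ennreal"
  proof -
    have "(\<integral>\<^sup>+\<omega>. (if H (stake n \<omega>) then 1 else 0) * g (sdrop n \<omega>) \<partial>coins) =
      (\<Sum>bs\<in>words n. \<integral>\<^sup>+\<omega>. (if H (stake n (bs @- \<omega>)) then 1 else 0) * g (sdrop n (bs @- \<omega>)) \<partial>coins) / 2 ^ n"
      by (rule nn_integral_coins) measurable
    also have "\<dots> = (\<Sum>bs\<in>words n. \<integral>\<^sup>+\<omega>. (if H bs then 1 else 0) * g \<omega> \<partial>coins) / 2 ^ n"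
      by (intro arg_cong[where f = "\<lambda>x. x / 2 ^ n"] sum.cong) (auto simp: words_def stake_shift sdrop_shift)
    also have "\<dots> = (\<Sum>bs\<in>words n. (if H bs then 1 else 0) * (\<integral>\<^sup>+\<omega>. g \<omega> \<partial>coins)) / 2 ^ n"
      by (simp add: nn_integral_cmult)
    finally show ?thesis unfolding sum_distrib_right[symmetric] by (simp add: divide_ennreal_def mult_ac)
  qed
  have "(\<integral>\<^sup>+\<omega>. (\<Sum>n. ?f n \<omega>) \<partial>coins) = (\<Sum>n. \<integral>\<^sup>+\<omega>. ?f n \<omega> \<partial>coins)"
    by (rule nn_integral_suminf) measurable
  also have "\<dots> = (\<Sum>n. (\<Sum>bs\<in>words n. if H bs then 1 else 0) / 2 ^ n * (\<integral>\<^sup>+\<omega>. runtime A d s' \<omega> \<partial>coins))"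
    by (simp add: step)
  also have "\<dots> = (\<Sum>n. \<integral>\<^sup>+\<omega>. (if H (stake n \<omega>) then 1 else 0) \<partial>coins) * (\<integral>\<^sup>+\<omega>. runtime A d s' \<omega> \<partial>coins)"
    using step[of "\<lambda>_. 1"] by (simp add: coins.emeasure_space_1)
  also have "(\<Sum>n. \<integral>\<^sup>+\<omega>. (if H (stake n \<omega>) then 1 else 0) \<partial>coins) =
      (\<integral>\<^sup>+\<omega>. (\<Sum>n. if H (stake n \<omega>) then 1 else 0) \<partial>coins)"
    by (rule nn_integral_suminf[symmetric]) measurable
  \<comment> \<open>The stopping positions are mutually exclusive, so their probabilities add up to
    at most 1.\<close>
  also have "\<dots> \<le> (\<integral>\<^sup>+\<omega>. 1 \<partial>coins)"
    unfolding H_def by (intro nn_integral_mono prefix_free_le_1)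
  finally have "(\<integral>\<^sup>+\<omega>. (\<Sum>n. ?f n \<omega>) \<partial>coins) \<le> of_nat e'"
    using d by (auto simp: las_vegas_def coins.emeasure_space_1 mult_right_mono elim!: order_trans)
  moreover have "(\<integral>\<^sup>+\<omega>. runtime A (Seq c d) s \<omega> \<partial>coins) \<le> (\<integral>\<^sup>+\<omega>. runtime A c s \<omega> + (\<Sum>n. ?f n \<omega>) \<partial>coins)"
    by (intro nn_integral_mono runtime)
  moreover have "\<dots> = (\<integral>\<^sup>+\<omega>. runtime A c s \<omega> \<partial>coins) + (\<integral>\<^sup>+\<omega>. (\<Sum>n. ?f n \<omega>) \<partial>coins)"
    by (rule nn_integral_add) measurable
  moreover have "(\<integral>\<^sup>+\<omega>. runtime A c s \<omega> \<partial>coins) \<le> of_nat e"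
    using c by (simp add: las_vegas_def)
  ultimately have "(\<integral>\<^sup>+\<omega>. runtime A (Seq c d) s \<omega> \<partial>coins) \<le> of_nat e + of_nat e'"
    by (simp add: add_mono order_trans)
  moreover have "s2 = s''" if "exec A (Seq c d) s bs t s2" for bs t s2
    using that c d by (auto elim!: exec.cases[of A "Seq c d"] simp: las_vegas_def)
  ultimately show ?thesis unfolding las_vegas_def by simp
qed

text \<open>Accounts for the one unit charged when a branch is taken or a loop body is
  entered.\<close>

lemma las_vegas_step:
  assumes "las_vegas A c s e s'"
    and "\<And>bs t s''. exec A c s bs t s'' \<Longrightarrow> exec A d s bs (Suc t) s''"
    and "\<And>bs t s''. exec A d s bs t s'' \<Longrightarrow> \<exists>t. exec A c s bs t s''"
  shows "las_vegas A d s (Suc e) s'"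
proof -
  have "runtime A d s \<omega> \<le> 1 + runtime A c s \<omega>" for \<omega>
  proof (rule runtime_cases[of A c s \<omega>])
    fix n t s1 assume 1: "exec A c s (stake n \<omega>) t s1" "runtime A c s \<omega> = of_nat t"
    from runtime_le[OF assms(2)[OF 1(1)]] show ?thesis by (simp add: 1(2))
  qed simp
  then have "(\<integral>\<^sup>+\<omega>. runtime A d s \<omega> \<partial>coins) \<le> (\<integral>\<^sup>+\<omega>. 1 + runtime A c s \<omega> \<partial>coins)"
    by (intro nn_integral_mono)
  also have "\<dots> = 1 + (\<integral>\<^sup>+\<omega>. runtime A c s \<omega> \<partial>coins)"
    by (subst nn_integral_add) (auto simp: coins.emeasure_space_1)
  also have "\<dots> \<le> 1 + of_nat e"
    using assms(1) by (auto simp: las_vegas_def)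
  finally show ?thesis using assms(1,3) unfolding las_vegas_def by (metis of_nat_Suc add.commute)
qed

text \<open>A failing pass restores \<open>s\<close> exactly, so the passes are independent trials
  with success probability at least 1/2. Their expected number is at most 2, each costs
  \<open>B + 1\<close> with the loop test, and the last test costs 1.\<close>

lemma las_vegas_loop:
  assumes body: "\<And>bs. bs \<in> words N \<Longrightarrow> runs A c s bs B (if good bs then s' else s)"
    and good: "2 ^ N \<le> 2 * card {bs \<in> words N. good bs}"
    and r: "s r \<noteq> []" "s' r = []"
  shows "las_vegas A (While r c) s (2 * (B + 1) + 1) s'"
proof -
  \<comment> \<open>\<open>bad k\<close> indicates that the first \<open>k\<close> passes fail.
    Summed over all \<open>k\<close>, from 0 on, it counts the passes up to and including the first
    success.\<close>
  define bad :: "nat \<Rightarrow> bool stream \<Rightarrow> ennreal" where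
    "bad = rec_nat (\<lambda>_. 1) (\<lambda>_ f \<omega>. if good (stake N \<omega>) then 0 else f (sdrop N \<omega>))"
  have bad_0: "bad 0 = (\<lambda>_. 1)"
    by (simp add: bad_def)
  have bad_Suc: "bad (Suc k) = (\<lambda>\<omega>. if good (stake N \<omega>) then 0 else bad k (sdrop N \<omega>))" for k
    unfolding bad_def by simp
  have bad_meas [measurable]: "bad k \<in> borel_measurable coins" for k
  proof (induction k)
    case (Suc k)
    note [measurable] = Suc
    have [measurable]: "(\<lambda>\<omega>. bad k (sdrop N \<omega>)) \<in> borel_measurable coins"
      by (rule measurable_compose[OF sdrop_coins]) measurable
    have [measurable]: "Measurable.pred coins (\<lambda>\<omega>. good (stake N \<omega>))"
      by (rule measurable_compose[OF stake_coins]) measurable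
    show ?case unfolding bad_Suc by measurable
  qed (simp add: bad_0)
  have fail: "2 * card {bs \<in> words N. \<not> good bs} \<le> 2 ^ N"
  proof -
    have "{bs \<in> words N. good bs} \<union> {bs \<in> words N. \<not> good bs} = words N" by auto
    then have "card {bs \<in> words N. good bs} + card {bs \<in> words N. \<not> good bs} = 2 ^ N"
      by (subst card_Un_disjoint[symmetric]) auto
    with good show ?thesis by linarith
  qed
  have int_bad: "(\<integral>\<^sup>+\<omega>. bad k \<omega> \<partial>coins) \<le> ennreal ((1 / 2) ^ k)" for k
  proof (induction k)
    case (Suc k)
    have "(\<integral>\<^sup>+\<omega>. bad (Suc k) \<omega> \<partial>coins) = (\<Sum>bs\<in>words N. \<integral>\<^sup>+\<omega>. bad (Suc k) (bs @- \<omega>) \<partial>coins) / 2 ^ N"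
      by (rule nn_integral_coins) measurable
    also have "\<dots> = (\<Sum>bs\<in>words N. if \<not> good bs then (\<integral>\<^sup>+\<omega>. bad k \<omega> \<partial>coins) else 0) / 2 ^ N"
      by (intro arg_cong[where f = "\<lambda>x. x / 2 ^ N"] sum.cong) (auto simp: words_def stake_shift sdrop_shift bad_Suc)
    also have "\<dots> = of_nat (card {bs \<in> words N. \<not> good bs}) * (\<integral>\<^sup>+\<omega>. bad k \<omega> \<partial>coins) / 2 ^ N"
      by (subst sum.inter_filter[symmetric]) simp_all
    also have "\<dots> \<le> of_nat (card {bs \<in> words N. \<not> good bs}) * ennreal ((1 / 2) ^ k) / 2 ^ N"
      by (intro divide_right_mono_ennreal mult_left_mono Suc) simp
    also have "\<dots> = ennreal (real (card {bs \<in> words N. \<not> good bs}) * (1 / 2) ^ k / 2 ^ N)"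
      by (simp add: ennreal_mult' ennreal_of_nat_eq_real_of_nat divide_ennreal[symmetric] ennreal_power[symmetric])
    also have "\<dots> \<le> ennreal ((1 / 2) ^ Suc k)"
    proof (rule ennreal_leI)
      have "2 * real (card {bs \<in> words N. \<not> good bs}) \<le> 2 ^ N"
        using of_nat_mono[OF fail, where ?'a = real] by simp
      then show "real (card {bs \<in> words N. \<not> good bs}) * (1 / 2) ^ k / 2 ^ N \<le> (1 / 2) ^ Suc k"
        by (simp add: field_simps)
    qed
    finally show ?case .
  qed (simp add: bad_0 coins.emeasure_space_1)
  have runtime_bad: "runtime A (While r c) s \<omega> \<le> of_nat (B + 1) * (\<Sum>k. bad k \<omega>) + 1" for \<omega>
  proof (cases "\<exists>k. bad k \<omega> = 0")
    case False
    \<comment> \<open>If every pass fails, the claimed bound is infinite.\<close>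
    have "bad k \<omega> = 0 \<or> bad k \<omega> = 1" for k \<omega>
      by (induction k arbitrary: \<omega>) (auto simp: bad_0 bad_Suc)
    with False have "bad k \<omega> = 1" for k by blast
    then have "(\<Sum>k. bad k \<omega>) = (\<Sum>k. 1)" by simp
    also have "\<dots> = \<infinity>" 
      using nn_integral_count_space_nat[of "\<lambda>_. 1"] by simp
    finally show ?thesis by (simp add: ennreal_mult_top)
  next
    case True
    then obtain k where "bad k \<omega> = 0" by blast
    then show ?thesis
    proof (induction k arbitrary: \<omega>)
      case 0
      then show ?case by (simp add: bad_0)
    next
      case (Suc k)
      have sum: "(\<Sum>k. bad k \<omega>) = 1 + (\<Sum>k. bad (Suc k) \<omega>)"
        using suminf_offset[of "\<lambda>k. bad k \<omega>" 1] by (simp add: bad_0 add.commute)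
      have body': "runs A c s (stake N \<omega>) B (if good (stake N \<omega>) then s' else s)"
        by (rule body) (simp add: words_def)
      show ?case
      proof (cases "good (stake N \<omega>)")
        case True
        from body' True obtain t where t: "exec A c s (stake N \<omega>) t s'" "t \<le> B"
          by (auto simp: runs_def)
        have "exec A (While r c) s (stake N \<omega> @ []) (Suc (t + 1)) s'"
          by (rule exec.While_Loop[OF r(1) t(1) exec.While_Empty[where s = s' and r = r, OF r(2)]])
        then have "exec A (While r c) s (stake N \<omega>) (Suc (t + 1)) s'"
          by (simp only: append_Nil2)
        from runtime_le[OF this] have "runtime A (While r c) s \<omega> \<le> of_nat (Suc (t + 1))" .
        also have "\<dots> \<le> of_nat (Suc (B + 1))"
          using t by (intro of_nat_mono) simp
        also have "\<dots> = of_nat (B + 1) * 1 + 1" by simp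
        also have "\<dots> \<le> of_nat (B + 1) * (\<Sum>k. bad k \<omega>) + 1"
          unfolding sum by (intro add_mono mult_left_mono) auto
        finally show ?thesis .
      next
        case False
        from body' False obtain t where t: "exec A c s (stake N \<omega>) t s" "t \<le> B"
          by (auto simp: runs_def)
        have bad_shift: "bad (Suc k) \<omega> = bad k (sdrop N \<omega>)" for k
          using False by (simp add: bad_Suc)
        have IH: "runtime A (While r c) s (sdrop N \<omega>) \<le> of_nat (B + 1) * (\<Sum>k. bad (Suc k) \<omega>) + 1"
          unfolding bad_shift by (rule Suc.IH) (use Suc.prems bad_shift in simp)
        have "runtime A (While r c) s \<omega> \<le> of_nat (B + 1) + runtime A (While r c) s (sdrop N \<omega>)"
        proof (rule runtime_cases[of A "While r c" s "sdrop N \<omega>"])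
          fix n' t' s2 assume 2: "exec A (While r c) s (stake n' (sdrop N \<omega>)) t' s2"
            "runtime A (While r c) s (sdrop N \<omega>) = of_nat t'"
          have "exec A (While r c) s (stake (N + n') \<omega>) (Suc (t + t')) s2"
            using exec.While_Loop[OF r(1) t(1) 2(1)] by (simp add: stake_add)
          from runtime_le[OF this] have "runtime A (While r c) s \<omega> \<le> of_nat (Suc (t + t'))" .
          also have "\<dots> \<le> of_nat (B + 1 + t')" using t by (intro of_nat_mono) simp
          finally show ?thesis using 2(2) by (simp add: add_ac)
        qed simp
        also have "\<dots> \<le> of_nat (B + 1) + (of_nat (B + 1) * (\<Sum>k. bad (Suc k) \<omega>) + 1)"
          by (intro add_left_mono IH)
        also have "\<dots> = of_nat (B + 1) * (\<Sum>k. bad k \<omega>) + 1"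
          unfolding sum by (simp add: distrib_left add_ac)
        finally show ?thesis .
      qed
    qed
  qed
  have "(\<integral>\<^sup>+\<omega>. runtime A (While r c) s \<omega> \<partial>coins) \<le> (\<integral>\<^sup>+\<omega>. of_nat (B + 1) * (\<Sum>k. bad k \<omega>) + 1 \<partial>coins)"
    by (intro nn_integral_mono runtime_bad)
  also have "\<dots> = of_nat (B + 1) * (\<Sum>k. \<integral>\<^sup>+\<omega>. bad k \<omega> \<partial>coins) + 1"
    by (simp add: nn_integral_add nn_integral_cmult nn_integral_suminf coins.emeasure_space_1)
  also have "\<dots> \<le> of_nat (B + 1) * (\<Sum>k. ennreal ((1 / 2) ^ k)) + 1"
    by (intro add_mono mult_left_mono suminf_le int_bad) auto
  also have "(\<Sum>k. ennreal ((1 / 2) ^ k)) = 2"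
    using suminf_geometric[of "1 / 2 :: real"] by (subst suminf_ennreal2) (auto intro: summable_geometric)
  finally have "(\<integral>\<^sup>+\<omega>. runtime A (While r c) s \<omega> \<partial>coins) \<le> of_nat (B + 1) * 2 + 1" .
  also have "\<dots> = of_nat (2 * (B + 1) + 1)"
    by (simp only: of_nat_add of_nat_mult of_nat_numeral of_nat_1 mult.commute)
  finally have int: "(\<integral>\<^sup>+\<omega>. runtime A (While r c) s \<omega> \<partial>coins) \<le> of_nat (2 * (B + 1) + 1)" .
  have "exec A (While r c) s bs t s'' \<Longrightarrow> s'' = s'" for bs t s''
  proof (induction t arbitrary: bs rule: less_induct)
    case (less t)
    from less.prems r(1) obtain b1 b2 t1 t2 v where
      *: "exec A c s b1 t1 v" "exec A (While r c) v b2 t2 s''" "t = Suc (t1 + t2)"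
      by (auto elim: exec.cases)
    \<comment> \<open>The hypothesis on the body speaks only of words of length \<open>N\<close>.
      Padding the given coins and cutting yields such a word with a common extension, so determinism
      applies.\<close>
    define w where "w = take N (b1 @ replicate N False)"
    have "w \<in> words N" by (simp add: w_def words_def)
    from body[OF this] obtain t' where "exec A c s w t' (if good w then s' else s)"
      by (auto simp: runs_def)
    moreover have "b1 @ replicate N False = w @ drop N (b1 @ replicate N False)"
      unfolding w_def by (simp only: append_take_drop_id)
    ultimately have v: "v = (if good w then s' else s)"
      using exec_deterministic[OF *(1)] by blast
    show ?case
    proof (cases "good w")
      case True
      with *(2) v r(2) show ?thesis by (auto elim: exec.cases)
    next
      case False
      with less.IH[of t2 b2] * v show ?thesis by simp
    qed
  qed
  with int show ?thesis unfolding las_vegas_def by blast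
qed

section \<open>Isolation by random parities\<close>

text \<open>Probabilities are kept as sums of indicators over \<open>words n\<close>, which can be
  split coin by coin; the simplifier would turn them into cardinalities.\<close>

declare sum_of_bool_eq [simp del] sum_mult_of_bool_eq [simp del] sum_of_bool_mult_eq [simp del]

fun dot :: "word \<Rightarrow> word \<Rightarrow> bool" where
  "dot (a # r) (b # u) = ((a \<and> b) \<noteq> dot r u)"
| "dot _ _ = False"

text \<open>Equal leading bits leave the question to the tails. If they differ, the leading
  coefficient of \<open>r\<close> exchanges agreement and disagreement whatever the rest of
  \<open>r\<close> is, so each occurs exactly half of the time.\<close>

lemma sum_dot_diff:
  "length u = n \<Longrightarrow> length v = n \<Longrightarrow> u \<noteq> v \<Longrightarrow>
   (\<Sum>r\<in>words n. of_bool (dot r u = dot r v)) = (2 ^ n / 2 :: real) \<and>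
   (\<Sum>r\<in>words n. of_bool (dot r u \<noteq> dot r v)) = (2 ^ n / 2 :: real)"
proof (induction n arbitrary: u v)
  case (Suc n)
  then obtain a u' b v' where uv: "u = a # u'" "v = b # v'" "length u' = n" "length v' = n"
    by (auto simp: length_Suc_conv)
  have flip_not: "((\<not> P) = Q) = (P = (\<not> Q))" for P Q by blast
  show ?case
  proof (cases "a = b")
    case True
    with Suc uv have "u' \<noteq> v'" by auto
    from Suc.IH[OF uv(3,4) this] show ?thesis using True uv by (cases b) (simp_all add: sum_words_Suc flip_not)
  next
    case False
    have *: "of_bool (P = Q) + of_bool (P = (\<not> Q)) = (1 :: real)" for P Q by auto
    have **: "of_bool (P = (\<not> Q)) + of_bool (P = Q) = (1 :: real)" for P Q by auto
    show ?thesis using False uv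
      by (cases a; cases b) (simp_all add: sum_words_Suc sum.distrib[symmetric] flip_not * **)
  qed
qed simp

text \<open>The prefixed \<open>True\<close> turns the leading coefficient into a random constant
  term. Thus the zero word, too, passes with probability 1/2.\<close>

lemma sum_dot: 
  assumes "length u = n"
  shows "(\<Sum>r\<in>words (Suc n). of_bool (dot r (True # u))) = (2 ^ n :: real)"
proof -
  have *: "of_bool (\<not> P) + of_bool P = (1 :: real)" for P by simp
  show ?thesis by (simp add: sum_words_Suc sum.distrib[symmetric] * del: of_bool_not_iff)
qed

text \<open>Pairwise independence: two distinct words both pass with probability 1/4.\<close>

lemma sum_dot2: 
  assumes "length u = n" "length v = n" "u \<noteq> v"
  shows "(\<Sum>r\<in>words (Suc n). of_bool (dot r (True # u) \<and> dot r (True # v))) = (2 ^ n / 2 :: real)"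
proof -
  \<comment> \<open>The two choices of the constant term count the cases where both parities are 0
    and where both are 1, together the cases of agreement.\<close>
  have *: "of_bool (\<not> P \<and> \<not> Q) + of_bool (P \<and> Q) = (of_bool (P = Q) :: real)" for P Q by simp
  show ?thesis using sum_dot_diff[OF assms]
    by (simp add: sum_words_Suc sum.distrib[symmetric] * del: of_bool_conj of_bool_not_iff)
qed

text \<open>Each row is reversed because coins are pushed on a stack as they fall.\<close>

fun rows :: "nat \<Rightarrow> nat \<Rightarrow> word \<Rightarrow> word list" where
  "rows 0 n \<rho> = []"
| "rows (Suc k) n \<rho> = rev (take n \<rho>) # rows k n (drop n \<rho>)"

lemma sum_words_rev: "(\<Sum>r\<in>words n. f (rev r)) = (\<Sum>r\<in>words n. f r)"
  by (rule sum.reindex_bij_witness[of _ rev rev]) (auto simp: words_def)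

text \<open>The rows are independent: \<open>j\<close> of them are constrained and the others are
  free. The factor 1 only fixes the type.\<close>

lemma sum_rows:
  "j \<le> k \<Longrightarrow> (\<Sum>\<rho>\<in>words (k * n). of_bool (\<forall>r\<in>set (take j (rows k n \<rho>)). Q r)) =
     (\<Sum>r\<in>words n. of_bool (Q r)) ^ j * (2 ^ n) ^ (k - j :: nat) * (1 :: real)"
proof (induction k arbitrary: j)
  case (Suc k)
  show ?case
  proof (cases j)
    case 0
    then show ?thesis by (simp add: power_mult[symmetric] power_add mult.commute)
  next
    case (Suc i)
    have "(\<Sum>\<rho>\<in>words (Suc k * n). of_bool (\<forall>r\<in>set (take j (rows (Suc k) n \<rho>)). Q r)) =
      (\<Sum>r\<in>words n. \<Sum>\<rho>\<in>words (k * n). of_bool (Q (rev r)) * (of_bool (\<forall>r\<in>set (take i (rows k n \<rho>)). Q r) :: real))"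
      unfolding mult_Suc sum_words_add Suc
      by (intro sum.cong refl) (auto simp: words_def)
    also have "\<dots> = (\<Sum>r\<in>words n. of_bool (Q (rev r))) *
        (\<Sum>\<rho>\<in>words (k * n). of_bool (\<forall>r\<in>set (take i (rows k n \<rho>)). Q r))"
      by (rule sum_product[symmetric])
    also have "(\<Sum>\<rho>\<in>words (k * n). of_bool (\<forall>r\<in>set (take i (rows k n \<rho>)). Q r)) =
       (\<Sum>r\<in>words n. of_bool (Q r)) ^ i * (2 ^ n) ^ (k - i :: nat) * (1 :: real)"
      by (rule Suc.IH) (use Suc.prems Suc in simp)
    finally show ?thesis unfolding sum_words_rev[of "\<lambda>r. of_bool (Q r)"] using Suc by simp
  qed
qed simp

text \<open>A parity that would empty the set is dropped, so no guess at the size of the set is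
  needed: rows beyond the useful number cannot destroy an isolated element.\<close>

fun narrow :: "word list \<Rightarrow> word set \<Rightarrow> word set" where
  "narrow [] S = S"
| "narrow (r # rs) S = narrow rs (if {u \<in> S. dot r (True # u)} = {} then S else {u \<in> S. dot r (True # u)})"

lemma narrow_singleton: "narrow rs {u} = {u}"
proof (induction rs)
  case (Cons r rs)
  have *: "(if {v \<in> {u}. dot r (True # v)} = {} then {u} else {v \<in> {u}. dot r (True # v)}) = {u}"
    by auto
  show ?case unfolding narrow.simps * by (rule Cons)
qed simp

lemma eq_singletonI: "u \<in> S \<Longrightarrow> (\<And>v. v \<in> S \<Longrightarrow> v \<noteq> u \<Longrightarrow> False) \<Longrightarrow> S = {u}"
  by (rule set_eqI) (metis singleton_iff)

text \<open>The element \<open>u\<close> witnesses that none of the first \<open>j\<close> parities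
  is dropped. After them only \<open>u\<close> is left, and a singleton stays as it is.\<close>

lemma narrow_isolated:
  "u \<in> S \<Longrightarrow> \<forall>r\<in>set (take j rs). dot r (True # u) \<Longrightarrow>
   \<forall>v\<in>S. v \<noteq> u \<longrightarrow> \<not> (\<forall>r\<in>set (take j rs). dot r (True # v)) \<Longrightarrow> narrow rs S = {u}"
proof (induction j arbitrary: S rs)
  case 0
  have "S = {u}" by (rule eq_singletonI[OF 0(1)]) (use 0(3) in force)
  then show ?case by (simp add: narrow_singleton)
next
  case (Suc j)
  show ?case
  proof (cases rs)
    case Nil
    have "S = {u}" by (rule eq_singletonI[OF Suc.prems(1)]) (use Suc.prems(3) Nil in force)
    then show ?thesis by (simp add: narrow_singleton)
  next
    case (Cons r rs')
    let ?S = "{u \<in> S. dot r (True # u)}"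
    have "u \<in> ?S" using Suc.prems(1,2) Cons by simp
    then have "?S \<noteq> {}" by blast
    then have "narrow rs S = narrow rs' ?S" unfolding Cons narrow.simps by (simp only: if_False)
    also have "\<dots> = {u}"
      by (rule Suc.IH[OF \<open>u \<in> ?S\<close>]) (use Suc.prems(2,3) Cons in simp_all)
    finally show ?thesis .
  qed
qed

text \<open>
  The bits are asked for independently of each other, so the result is guaranteed to belong to
  \<open>W\<close> only if the parities have isolated one element; a wrong result does no harm.
\<close>

definition pick :: "nat \<Rightarrow> word set \<Rightarrow> word list \<Rightarrow> word" where
  "pick m W rs = map (\<lambda>i. \<exists>u\<in>narrow rs W. u ! i) [0..<m]"

lemma pick_isolated:
  assumes "narrow rs W = {u}" "length u = m"
  shows "pick m W rs = u"
  unfolding pick_def assms(1) using map_nth[of u] assms(2) by simp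

text \<open>The number of rows used for the isolation is the one for which \<open>2 ^ j\<close> is between twice and
  four times the cardinality of \<open>W\<close>.\<close>

lemma pick_probability:
  assumes W: "W \<subseteq> words m" and u: "u \<in> W"
  defines "n \<equiv> Suc m"
  shows "2 ^ (n * n) / (8 * real (card W)) \<le> (\<Sum>\<rho>\<in>words (n * n). of_bool (pick m W (rows n n \<rho>) = u))"
proof -
  have fin: "finite W" by (rule finite_subset[OF W finite_words])
  have card: "0 < card W" using u fin by (auto simp: card_gt_0_iff)
  have card_le: "card W \<le> 2 ^ m" using card_mono[OF finite_words W] by simp
  define j where "j = (LEAST j. 2 * card W \<le> 2 ^ j)"
  \<comment> \<open>As \<open>W\<close> has at most \<open>2 ^ m\<close> elements,
    \<open>Suc m\<close> rows contain a prefix of any length that can be called for.\<close>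
  have ex: "2 * card W \<le> 2 ^ n" using card_le by (simp add: n_def)
  have j1: "2 * card W \<le> 2 ^ j" unfolding j_def by (rule LeastI[of _ n]) (rule ex)
  have j_n: "j \<le> n" unfolding j_def by (rule Least_le) (rule ex)
  have "j \<noteq> 0" using j1 card by (intro notI) simp
  then obtain i where i: "j = Suc i" by (cases j) auto
  have "\<not> 2 * card W \<le> 2 ^ i" unfolding j_def by (rule not_less_Least) (use i j_def in simp)
  then have j2: "2 ^ j \<le> 4 * card W" using i by simp
  define hit where "hit v \<rho> \<longleftrightarrow> (\<forall>r\<in>set (take j (rows n n \<rho>)). dot r (True # v))" for v \<rho>
  have len: "length v = m" if "v \<in> W" for v using that W by (auto simp: words_def)
  have pw: "(2 ^ m :: real) ^ j * (2 ^ n) ^ (n - j) = 2 ^ (n * n) / 2 ^ j"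
    and pw2: "(2 ^ m / 2 :: real) ^ j * (2 ^ n) ^ (n - j) = 2 ^ (n * n) / 4 ^ j"
  proof -
    have e: "(2 ^ n :: real) ^ j * (2 ^ n) ^ (n - j) = 2 ^ (n * n)"
      by (simp only: power_add[symmetric] le_add_diff_inverse[OF j_n] power_mult)
    have m1: "(2 ^ m :: real) = 2 ^ n / 2" by (simp add: n_def)
    show "(2 ^ m :: real) ^ j * (2 ^ n) ^ (n - j) = 2 ^ (n * n) / 2 ^ j"
      unfolding m1 e[symmetric] by (simp add: power_divide)
    have m2: "(2 ^ m / 2 :: real) = 2 ^ n / 4" by (simp add: n_def)
    show "(2 ^ m / 2 :: real) ^ j * (2 ^ n) ^ (n - j) = 2 ^ (n * n) / 4 ^ j"
      unfolding m2 e[symmetric] by (simp add: power_divide)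
  qed
  have h1: "(\<Sum>\<rho>\<in>words (n * n). of_bool (hit u \<rho>)) = (2 ^ (n * n) / 2 ^ j :: real)"
    unfolding hit_def sum_rows[OF j_n] sum_dot[OF len[OF u], folded n_def] using pw by simp
  have h2: "(\<Sum>\<rho>\<in>words (n * n). of_bool (hit u \<rho> \<and> hit v \<rho>)) = (2 ^ (n * n) / 4 ^ j :: real)"
    if "v \<in> W" "v \<noteq> u" for v
    unfolding hit_def ball_conj_distrib[symmetric] sum_rows[OF j_n]
      sum_dot2[OF len[OF u] len[OF that(1)] that(2)[symmetric], folded n_def] using pw2 by simp
  \<comment> \<open>Union bound, pointwise: if \<open>u\<close> passes together with some other
    element, the left side is at most 0.\<close>
  have isolated: "of_bool (hit u \<rho>) - (\<Sum>v\<in>W - {u}. of_bool (hit u \<rho> \<and> hit v \<rho>)) \<le>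
      (of_bool (pick m W (rows n n \<rho>) = u) :: real)" for \<rho>
  proof (cases "hit u \<rho> \<and> (\<forall>v\<in>W. v \<noteq> u \<longrightarrow> \<not> hit v \<rho>)")
    case True
    then have "narrow (rows n n \<rho>) W = {u}"
      unfolding hit_def by (intro narrow_isolated[OF u, of j]) auto
    then have "pick m W (rows n n \<rho>) = u"
      using len[OF u] by (rule pick_isolated)
    then show ?thesis by (simp add: sum_nonneg)
  next
    case False
    show ?thesis
    proof (cases "hit u \<rho>")
      case True
      with False obtain v where v: "v \<in> W - {u}" "hit v \<rho>" by auto
      have "of_bool (hit u \<rho> \<and> hit v \<rho>) \<le> (\<Sum>v\<in>W - {u}. (of_bool (hit u \<rho> \<and> hit v \<rho>) :: real))"
        by (rule member_le_sum) (use v fin in auto)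
      with True v show ?thesis by simp
    qed (simp add: sum_nonneg)
  qed
  have card_j: "2 * real (card W) \<le> 2 ^ j" "2 ^ j \<le> 4 * real (card W)"
    using of_nat_mono[OF j1, where ?'a = real] of_nat_mono[OF j2, where ?'a = real] by simp_all
  \<comment> \<open>With \<open>t = 2 ^ j\<close> the probability is at least
    \<open>1 / t - card W / t ^ 2\<close>, and \<open>2 * card W \<le> t \<le> 4 * card W\<close>
    makes this at least \<open>1 / (2 * t)\<close>, hence at least
    \<open>1 / (8 * card W)\<close>.\<close>
  have "2 ^ (n * n) / (8 * real (card W)) \<le> 2 ^ (n * n) / (2 * 2 ^ j)"
    using card_j card by (intro divide_left_mono) auto
  also have "\<dots> = 2 ^ (n * n) / 2 ^ j - (2 ^ j / 2) * (2 ^ (n * n) / (2 ^ j * 2 ^ j))"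
    by (simp add: field_simps)
  also have "\<dots> \<le> 2 ^ (n * n) / 2 ^ j - card (W - {u}) * (2 ^ (n * n) / 4 ^ j :: real)"
  proof -
    have "real (card (W - {u})) \<le> 2 ^ j / 2"
      using card_j card_mono[OF fin, of "W - {u}"] by (simp add: subset_insertI2)
    then have "real (card (W - {u})) * (2 ^ (n * n) / 4 ^ j) \<le> 2 ^ j / 2 * (2 ^ (n * n) / 4 ^ j)"
      by (rule mult_right_mono) simp
    moreover have "(2 :: real) ^ j * 2 ^ j = 4 ^ j" by (simp flip: power_mult_distrib)
    ultimately show ?thesis by simp
  qed
  also have "\<dots> = (\<Sum>\<rho>\<in>words (n * n). of_bool (hit u \<rho>)) -
     (\<Sum>v\<in>W - {u}. \<Sum>\<rho>\<in>words (n * n). of_bool (hit u \<rho> \<and> hit v \<rho>))"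
    using h1 h2 by simp
  also have "\<dots> = (\<Sum>\<rho>\<in>words (n * n). of_bool (hit u \<rho>) - (\<Sum>v\<in>W - {u}. of_bool (hit u \<rho> \<and> hit v \<rho>)))"
    by (subst sum.swap) (simp add: sum_subtractf)
  also have "\<dots> \<le> (\<Sum>\<rho>\<in>words (n * n). of_bool (pick m W (rows n n \<rho>) = u))"
    by (intro sum_mono isolated)
  finally show ?thesis .
qed


section \<open>Learning both players' moves\<close>

text \<open>\<open>g a b\<close> is to be read as: the first player's move in \<open>a\<close> wins
  against the second player's move in \<open>b\<close>. An element survives if both of its moves
  beat the opposing moves in \<open>u\<close>.\<close>

definition refine :: "(word \<Rightarrow> word \<Rightarrow> bool) \<Rightarrow> word set \<Rightarrow> word \<Rightarrow> word set" where
  "refine g W u = {w \<in> W. g w u \<and> \<not> g u w}"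

text \<open>The relation of surviving is disjoint from its converse and has the same size, so it
  covers at most half of \<open>W \<times> W\<close>.\<close>

lemma sum_refine:
  assumes "finite W"
  shows "2 * (\<Sum>u\<in>W. card (refine g W u)) \<le> card W * card W"
proof -
  define R where "R = (SIGMA u:W. refine g W u)"
  have R: "R \<subseteq> W \<times> W" "R\<inverse> \<subseteq> W \<times> W" "R \<inter> R\<inverse> = {}"
    by (auto simp: R_def refine_def)
  have "(\<Sum>u\<in>W. card (refine g W u)) = card R"
    unfolding R_def using assms by (subst card_SigmaI) (auto simp: refine_def)
  moreover have "card (R\<inverse>) = card R"
    by (rule card_inverse)
  moreover have "finite R" "finite (R\<inverse>)" using R assms by (auto intro: finite_subset)
  then have "card R + card (R\<inverse>) = card (R \<union> R\<inverse>)"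
    using R by (subst card_Un_disjoint) auto
  moreover have "card (R \<union> R\<inverse>) \<le> card (W \<times> W)"
    using R assms by (intro card_mono) auto
  ultimately show ?thesis by (simp add: card_cartesian_product)
qed

text \<open>
  The relation \<open>w \<in> refine g W u\<close> is asymmetric, so on average over \<open>u \<in> W\<close> at least half of \<open>W\<close> is lost;
  and each \<open>u \<in> W\<close> is picked with at least one eighth of its probability under the uniform distribution.
\<close>

lemma refine_decay:
  assumes W: "W \<subseteq> words m"
  defines "n \<equiv> Suc m"
  shows "(\<Sum>\<rho>\<in>words (n * n). real (card (refine g W (pick m W (rows n n \<rho>))))) \<le> 15 / 16 * 2 ^ (n * n) * card W"
proof (cases "W = {}")
  case False
  have fin: "finite W" by (rule finite_subset[OF W finite_words])
  then have card: "0 < card W" using False by (simp add: card_gt_0_iff)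
  \<comment> \<open>The number of elements lost by recording \<open>u\<close>. It is nonnegative
    also for \<open>u\<close> outside \<open>W\<close>, so bad samples can be ignored in a lower
    bound.\<close>
  define kill where "kill u = real (card W) - card (refine g W u)" for u
  have kill_nonneg: "0 \<le> kill u" for u
    unfolding kill_def using card_mono[OF fin, of "refine g W u"] by (auto simp: refine_def)
  let ?p = "\<lambda>\<rho>. pick m W (rows n n \<rho>)"
  have "2 * real (\<Sum>u\<in>W. card (refine g W u)) \<le> real (card W * card W)"
    using of_nat_mono[OF sum_refine[OF fin, of g], where ?'a = real] by simp
  then have kill_sum: "real (card W) * card W / 2 \<le> (\<Sum>u\<in>W. kill u)"
    by (simp add: kill_def sum_subtractf)
  \<comment> \<open>The 16 is 8 from the sampling times 2 from the asymmetry.\<close>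
  have "2 ^ (n * n) * real (card W) / 16 = 2 ^ (n * n) / (8 * real (card W)) * (real (card W) * card W / 2)"
    using card by (simp add: field_simps)
  also have "\<dots> \<le> 2 ^ (n * n) / (8 * real (card W)) * (\<Sum>u\<in>W. kill u)"
    using kill_sum by (intro mult_left_mono) auto
  also have "\<dots> = (\<Sum>u\<in>W. 2 ^ (n * n) / (8 * real (card W)) * kill u)"
    by (rule sum_distrib_left)
  also have "\<dots> \<le> (\<Sum>u\<in>W. (\<Sum>\<rho>\<in>words (n * n). of_bool (?p \<rho> = u)) * kill u)"
    unfolding n_def by (intro sum_mono mult_right_mono pick_probability W kill_nonneg)
  also have "\<dots> = (\<Sum>\<rho>\<in>words (n * n). \<Sum>u\<in>W. of_bool (?p \<rho> = u) * kill u)"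
    by (subst sum.swap) (simp add: sum_distrib_right)
  also have "\<dots> \<le> (\<Sum>\<rho>\<in>words (n * n). kill (?p \<rho>))"
  proof (rule sum_mono)
    fix \<rho>
    have "(\<Sum>u\<in>W. of_bool (?p \<rho> = u) * kill u) = (\<Sum>u\<in>W. if u = ?p \<rho> then kill u else 0)"
      by (intro sum.cong) auto
    also have "\<dots> = (if ?p \<rho> \<in> W then kill (?p \<rho>) else 0)"
      using fin by (rule sum.delta)
    finally show "(\<Sum>u\<in>W. of_bool (?p \<rho> = u) * kill u) \<le> kill (?p \<rho>)"
      using kill_nonneg by simp
  qed
  also have "\<dots> = 2 ^ (n * n) * card W - (\<Sum>\<rho>\<in>words (n * n). real (card (refine g W (?p \<rho>))))"
    by (simp add: kill_def sum_subtractf)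
  finally show ?thesis by (simp add: mult_ac)
qed (simp add: refine_def)

fun survivors :: "(word \<Rightarrow> word \<Rightarrow> bool) \<Rightarrow> nat \<Rightarrow> nat \<Rightarrow> word set \<Rightarrow> word \<Rightarrow> word set" where
  "survivors g m 0 W \<rho> = W"
| "survivors g m (Suc k) W \<rho> = survivors g m k
     (refine g W (pick m W (rows (Suc m) (Suc m) (take (Suc m * Suc m) \<rho>)))) (drop (Suc m * Suc m) \<rho>)"

lemma survivors_decay:
  "W \<subseteq> words m \<Longrightarrow> (\<Sum>\<rho>\<in>words (k * (Suc m * Suc m)). real (card (survivors g m k W \<rho>)))
    \<le> (15 / 16) ^ k * 2 ^ (k * (Suc m * Suc m)) * card W"
proof (induction k arbitrary: W)
  case (Suc k)
  define N where "N = Suc m * Suc m"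
  let ?r = "\<lambda>\<rho>. refine g W (pick m W (rows (Suc m) (Suc m) \<rho>))"
  have "(\<Sum>\<rho>\<in>words (Suc k * N). real (card (survivors g m (Suc k) W \<rho>))) =
    (\<Sum>\<rho>\<in>words N. \<Sum>\<rho>'\<in>words (k * N). real (card (survivors g m k (?r \<rho>) \<rho>')))"
    unfolding mult_Suc sum_words_add
    by (intro sum.cong refl) (auto simp: words_def N_def)
  also have "\<dots> \<le> (\<Sum>\<rho>\<in>words N. (15 / 16) ^ k * 2 ^ (k * N) * card (?r \<rho>))"
    unfolding N_def by (intro sum_mono Suc.IH) (use Suc.prems in \<open>auto simp: refine_def\<close>)
  also have "\<dots> = (15 / 16) ^ k * 2 ^ (k * N) * (\<Sum>\<rho>\<in>words N. real (card (?r \<rho>)))"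
    by (simp add: sum_distrib_left)
  also have "\<dots> \<le> (15 / 16) ^ k * 2 ^ (k * N) * (15 / 16 * 2 ^ N * card W)"
    unfolding N_def by (intro mult_left_mono refine_decay Suc.prems) simp
  finally show ?case by (simp add: N_def power_add mult_ac)
qed simp

text \<open>The factor 11 comes from \<open>(15 / 16) ^ 11 \<le> 1 / 2\<close>.\<close>

lemma survivors_empty:
  fixes m :: nat
  defines "k \<equiv> 11 * Suc m"
  defines "N \<equiv> k * (Suc m * Suc m)"
  shows "2 ^ N \<le> 2 * card {\<rho> \<in> words N. survivors g m k (words m) \<rho> = {}}"
proof -
  have fin: "finite W \<Longrightarrow> finite (survivors g m i W \<rho>)" for i W \<rho>
    by (induction i arbitrary: W \<rho>) (simp_all add: refine_def del: rows.simps mult_Suc mult_Suc_right)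
  have "(15 / 16 :: real) ^ k = ((15 / 16) ^ 11) ^ Suc m"
    by (simp only: k_def power_mult)
  also have "\<dots> \<le> (1 / 2) ^ Suc m"
    by (intro power_mono) (simp_all add: power_divide)
  finally have k: "(15 / 16 :: real) ^ k * 2 ^ m \<le> 1 / 2"
    by (simp add: power_divide field_simps)
  \<comment> \<open>Markov's inequality for integers: a nonempty set has at least one element. The
    start set has \<open>2 ^ m\<close> elements, and one factor 1/2 is left over.\<close>
  have "real (card {\<rho> \<in> words N. survivors g m k (words m) \<rho> \<noteq> {}}) =
      (\<Sum>\<rho>\<in>words N. of_bool (survivors g m k (words m) \<rho> \<noteq> {}))"
    by (subst sum_of_bool_eq) (auto intro!: arg_cong[where f = card])
  also have "\<dots> \<le> (\<Sum>\<rho>\<in>words N. real (card (survivors g m k (words m) \<rho>)))"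
    using fin[OF finite_words] by (intro sum_mono) (auto simp: Suc_le_eq card_gt_0_iff)
  also have "\<dots> \<le> (15 / 16) ^ k * 2 ^ N * card (words m)"
    unfolding N_def by (rule survivors_decay) simp
  also have "\<dots> = 2 ^ N * ((15 / 16) ^ k * 2 ^ m)" by simp
  also have "\<dots> \<le> 2 ^ N * (1 / 2)" using k by (intro mult_left_mono) auto
  finally have "real (2 * card {\<rho> \<in> words N. survivors g m k (words m) \<rho> \<noteq> {}}) \<le> real (2 ^ N)"
    by simp
  then have "2 * card {\<rho> \<in> words N. survivors g m k (words m) \<rho> \<noteq> {}} \<le> 2 ^ N"
    by (simp only: of_nat_le_iff)
  moreover have "card {\<rho> \<in> words N. survivors g m k (words m) \<rho> \<noteq> {}} +
      card {\<rho> \<in> words N. survivors g m k (words m) \<rho> = {}} = card (words N)"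
    by (subst card_Un_disjoint[symmetric]) (auto simp del: card_words intro!: arg_cong[where f = card])
  ultimately show ?thesis by simp
qed

section \<open>Constraints\<close>

text \<open>Alternating the bits splits a word into halves in one pass, without a counter or a
  separator. The halves come out reversed, which is harmless since only surjectivity is
  used.\<close>

fun deal :: "word \<Rightarrow> word \<Rightarrow> word \<Rightarrow> word \<times> word" where
  "deal [] y z = (y, z)"
| "deal [a] y z = (a # y, z)"
| "deal (a # b # u) y z = deal u (a # y) (b # z)"

definition ev :: "word \<Rightarrow> word" where "ev u = fst (deal u [] [])"
definition od :: "word \<Rightarrow> word" where "od u = snd (deal u [] [])"

lemma deal_even: "length u = 2 * l \<Longrightarrow>
  length (fst (deal u y z)) = l + length y \<and> length (snd (deal u y z)) = l + length z"
proof (induction u y z arbitrary: l rule: deal.induct)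
  case (3 a b u y z)
  then have "length u = 2 * (l - 1)" "0 < l" by simp_all
  then show ?case using 3(1)[of "l - 1"] by auto
qed auto

lemma length_ev_od: "u \<in> words (2 * l) \<Longrightarrow> ev u \<in> words l \<and> od u \<in> words l"
  using deal_even[of u l "[]" "[]"] by (simp add: ev_def od_def words_def)

lemma deal_surj: "length y = l \<Longrightarrow> length z = l \<Longrightarrow> \<exists>u. length u = 2 * l \<and> deal u y' z' = (y @ y', z @ z')"
proof (induction l arbitrary: y z y' z')
  case (Suc l)
  from Suc.prems obtain y1 a z1 b where yz: "y = y1 @ [a]" "z = z1 @ [b]" "length y1 = l" "length z1 = l"
    by (metis length_Suc_conv_rev)
  from Suc.IH[OF yz(3,4), of "a # y'" "b # z'"] obtain u where
    "length u = 2 * l" "deal u (a # y') (b # z') = (y1 @ a # y', z1 @ b # z')" by blast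
  then show ?case using yz by (intro exI[of _ "a # b # u"]) simp
qed simp

text \<open>Any two moves form a candidate, so the candidates are a full product of the players'
  moves.\<close>

lemma ev_od_surj: "y \<in> words l \<Longrightarrow> z \<in> words l \<Longrightarrow> \<exists>u\<in>words (2 * l). ev u = y \<and> od u = z"
  using deal_surj[of y l z "[]" "[]"] by (auto simp: words_def ev_def od_def)

lemma length_deal: "length (fst (deal u y z)) + length (snd (deal u y z)) = length u + length y + length z"
  by (induction u y z rule: deal.induct) auto

definition dealc :: "reg \<Rightarrow> reg \<Rightarrow> reg \<Rightarrow> com" where
  "dealc a b c = While a (Seq (mv a b) (mv a c))"

lemma runs_dealc:
  assumes "distinct [a, b, c]"
  shows "runs A (dealc a b c) s [] (7 * length (s a) + 1)
    (s(a := [], b := fst (deal (s a) (s b) (s c)), c := snd (deal (s a) (s b) (s c))))"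
proof -
  have "s a = u \<Longrightarrow> s b = y \<Longrightarrow> s c = z \<Longrightarrow> runs A (While a (Seq (mv a b) (mv a c))) s [] (7 * length u + 1)
    (s(a := [], b := fst (deal u y z), c := snd (deal u y z)))" for u y z
  proof (induction u y z arbitrary: s rule: deal.induct)
    case (1 y z)
    then show ?case by (intro runs_eq[OF runs_While_empty]) (auto simp: fun_eq_iff)
  next
    case (2 x y z)
    have "runs A (Seq (mv a b) (mv a c)) s [] 6 (s(a := [], b := x # y))"
      by (rule runs_Seq0_eq[OF runs_mv runs_mv]) (use 2 assms in \<open>auto simp: fun_eq_iff\<close>)
    from runs_While_step0[OF _ this runs_While_empty] show ?case
      by (rule runs_eq) (use 2 assms in \<open>auto simp: fun_eq_iff\<close>)
  next
    case (3 x x' u y z)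
    have 1: "runs A (Seq (mv a b) (mv a c)) s [] 6 (s(a := u, b := x # y, c := x' # z))"
      by (rule runs_Seq0_eq[OF runs_mv runs_mv]) (use 3 assms in \<open>auto simp: fun_eq_iff\<close>)
    have 2: "runs A (While a (Seq (mv a b) (mv a c))) (s(a := u, b := x # y, c := x' # z)) [] (7 * length u + 1)
      ((s(a := u, b := x # y, c := x' # z))(a := [], b := fst (deal u (x # y) (x' # z)), c := snd (deal u (x # y) (x' # z))))"
      by (rule "3.IH") (use assms in auto)
    from runs_While_step0[OF _ 1 2] 3 show ?case
      by (intro runs_eq[OF runs_While_step0[OF _ 1 2]]) (use assms in \<open>auto simp: fun_eq_iff\<close>)
  qed
  then show ?thesis unfolding dealc_def by blast
qed

text \<open>
  A candidate \<open>u\<close> encodes a pair of moves, \<open>ev u\<close> of the first and \<open>od u\<close> of the second player. The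
  leading bits of a constraint tell its kind: a parity of the bits of \<open>u\<close> together with a constant
  term, a single bit of \<open>u\<close> with its position in unary, or a move of the opponent to be beaten.
\<close>

fun sat :: "(word \<Rightarrow> word \<Rightarrow> word \<Rightarrow> bool) \<Rightarrow> word \<Rightarrow> word \<Rightarrow> word \<Rightarrow> bool" where
  "sat G x u (True # r) = dot r (True # u)"
| "sat G x u (False # True # i) = (length i < length u \<and> u ! length i)"
| "sat G x u (False # False # True # z) = G x (ev u) z"
| "sat G x u (False # False # False # y) = (\<not> G x y (od u))"
| "sat G x u _ = True"

section \<open>Programs that evaluate a constraint\<close>

definition setbit :: "bool \<Rightarrow> com" where
  "setbit b = seqs [clear 0, Push 0 b]"

lemma runs_setbit: "runs A (setbit b) s [] (2 * length (s 0) + 3) (s(0 := [b]))"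
  unfolding setbit_def
  by (rule runs_eq[OF runs_seqs_Cons[OF runs_clear runs_seqs_Cons[OF runs_Push runs_seqs_Nil]]])
    (auto simp: fun_eq_iff)

definition negate :: com where
  "negate = Branch 0 Skip (setbit True) (setbit False)"

lemma runs_negate: "s 0 = [b] \<Longrightarrow> runs A negate s [] 6 (s(0 := [\<not> b]))"
proof -
  assume s: "s 0 = [b]"
  have e: "(6 :: nat) = Suc 5" by simp
  show ?thesis unfolding negate_def e
    by (rule runs_Branch) (use runs_setbit[of A True s] runs_setbit[of A False s] s in simp)
qed

definition parity :: com where
  "parity = While 2 (Branch 2 Skip (Seq (Pop 2) (Pop 1))
     (Seq (Pop 2) (Branch 1 Skip (Pop 1) (Seq (Pop 1) negate))))"

lemma runs_parity:
  "s 2 = r \<Longrightarrow> s 0 = [b] \<Longrightarrow> \<exists>s'. runs A parity s [] (11 * length r + 1) s' \<and> s' 0 = [b \<noteq> dot r (s 1)]"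
proof (induction r arbitrary: s b)
  case Nil
  have "runs A parity s [] 1 s" unfolding parity_def by (rule runs_While_empty) (rule Nil)
  then show ?case using Nil by (intro exI[of _ s]) auto
next
  case (Cons a r)
  define c where "c = Branch 2 Skip (Seq (Pop 2) (Pop 1))
     (Seq (Pop 2) (Branch 1 Skip (Pop 1) (Seq (Pop 1) negate)))"
  define b' where "b' = (b \<noteq> (a \<and> (case s 1 of [] \<Rightarrow> False | d # _ \<Rightarrow> d)))"
  define s1 where "s1 = s(2 := r)"
  define s2 where "s2 = s(2 := r, 1 := tl (s 1), 0 := [b'])"
  have p: "runs A (Pop 2) s [] 1 s1"
    by (rule runs_eq[OF runs_Pop]) (use Cons.prems(1) in \<open>auto simp: s1_def\<close>)
  have "runs A (Branch 1 Skip (Pop 1) (Seq (Pop 1) negate)) s1 [] 8 s2" if a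
  proof -
    have "runs A (case s1 1 of [] \<Rightarrow> Skip | d # _ \<Rightarrow> if d then Seq (Pop 1) negate else Pop 1) s1 [] 7 s2"
    proof (cases "s 1")
      case Nil
      have "runs A Skip s1 [] 7 s2"
        by (rule runs_eq[OF runs_Skip]) (use Nil Cons.prems in \<open>auto simp: s1_def s2_def b'_def fun_eq_iff\<close>)
      then show ?thesis using Nil by (simp add: s1_def)
    next
      case s1: (Cons d u)
      have "runs A (Seq (Pop 1) negate) s1 [] 7 s2" if d
        by (rule runs_Seq0_eq[OF runs_Pop runs_negate[where b = b]])
          (use \<open>a\<close> s1 that Cons.prems in \<open>auto simp: s1_def s2_def b'_def fun_eq_iff\<close>)
      moreover have "runs A (Pop 1) s1 [] 7 s2" if "\<not> d"
        by (rule runs_eq[OF runs_Pop])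
          (use \<open>a\<close> s1 that Cons.prems in \<open>auto simp: s1_def s2_def b'_def fun_eq_iff\<close>)
      ultimately show ?thesis using s1 by (simp add: s1_def)
    qed
    from runs_Branch[OF this] show ?thesis by simp
  qed
  then have "runs A (Seq (Pop 2) (Branch 1 Skip (Pop 1) (Seq (Pop 1) negate))) s [] 9 s2" if a
    using runs_Seq0[OF p] that by fastforce
  moreover have "runs A (Seq (Pop 2) (Pop 1)) s [] 9 s2" if "\<not> a"
    by (rule runs_Seq0_eq[OF p runs_Pop]) 
      (use that Cons.prems in \<open>auto simp: s1_def s2_def b'_def fun_eq_iff\<close>)
  ultimately have "runs A c s [] (Suc 9) s2"
    unfolding c_def by (intro runs_Branch) (use Cons.prems(1) in simp)
  moreover have s2: "s2 2 = r" "s2 0 = [b']" "s2 1 = tl (s 1)" by (simp_all add: s2_def)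
  from Cons.IH[OF s2(1,2)] obtain s' where
    s': "runs A parity s2 [] (11 * length r + 1) s'" "s' 0 = [b' \<noteq> dot r (tl (s 1))]"
    unfolding s2(3) by blast
  ultimately have "runs A (While 2 c) s [] (Suc (Suc 9 + (11 * length r + 1))) s'"
    using Cons.prems(1) by (intro runs_While_step0[where s = s]) (auto simp: parity_def c_def)
  moreover have "(b' \<noteq> dot r (tl (s 1))) = (b \<noteq> dot (a # r) (s 1))"
    by (cases "s 1"; cases r) (auto simp: b'_def)
  ultimately show ?case using s'(2) Cons.prems(1) unfolding parity_def c_def
    by (intro exI[of _ s']) (auto elim: runs_mono)
qed


definition linc :: com where
  "linc = seqs [Pop 2, Push 1 True, setbit False, parity]"

definition bitc :: com where
  "bitc = seqs [Pop 2, While 2 (Seq (Pop 2) (Pop 1)), Branch 1 (setbit False) (setbit False) (setbit True)]"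

text \<open>Nothing is known about \<open>c\<close> except from initial states. Hence its arguments
  are put on stacks 1 and 2 and all helper stacks are emptied before it starts.\<close>

definition evenc :: "com \<Rightarrow> com" where
  "evenc c = seqs [Pop 2, dealc 1 3 4, copy 3 1 5, clear 3, clear 4, c]"

definition oddc :: "com \<Rightarrow> com" where
  "oddc c = seqs [Pop 2, dealc 1 3 4, copy 2 1 5, clear 2, copy 4 2 5, clear 3, clear 4, c, negate]"

definition satc :: "com \<Rightarrow> com" where
  "satc c = Branch 2 (setbit True)
     (Seq (Pop 2) (Branch 2 (setbit True) (Seq (Pop 2) (Branch 2 (setbit True) (oddc c) (evenc c))) bitc))
     linc"

lemma init1: "init [a] = (\<lambda>_. [])(0 := a)"
  and init2: "init [a, b] = (\<lambda>_. [])(0 := a, 1 := b)"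
  and init3: "init [a, b, c] = (\<lambda>_. [])(0 := a, 1 := b, 2 := c)"
  by (auto simp: init_def fun_eq_iff nth_Cons split: nat.splits)

lemma init3_sel [simp]: "init [a, b, c] 0 = a" "init [a, b, c] (Suc 0) = b" "init [a, b, c] 2 = c"
  "init [a, b, c] 3 = []" "init [a, b, c] 4 = []" "init [a, b, c] 5 = []"
  by (simp_all add: init3)

lemma init3_Pop: "(init [x, u, b # v])(2 := v) = init [x, u, v]"
  by (auto simp: init3)

definition outputs :: "word set \<Rightarrow> com \<Rightarrow> state \<Rightarrow> nat \<Rightarrow> bool \<Rightarrow> bool" where
  "outputs A c s n b \<longleftrightarrow> (\<exists>s'. runs A c s [] n s' \<and> s' 0 = [b])"

lemma outputs_mono: "outputs A c s n b \<Longrightarrow> n \<le> n' \<Longrightarrow> outputs A c s n' b"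
  unfolding outputs_def using runs_mono by blast

lemma computes_outputs: "computes_within A c ws n [b] \<longleftrightarrow> outputs A c (init ws) n b"
  unfolding computes_within_def outputs_def runs_def by blast

lemma outputs_seqs_single: "outputs A c s n b \<Longrightarrow> outputs A (seqs [c]) s (n + 1) b"
  unfolding outputs_def seqs.simps using runs_Seq0[OF _ runs_Skip] by blast

lemma outputs_seqs_Cons:
  "runs A c s [] T s' \<Longrightarrow> outputs A (seqs cs) s' n b \<Longrightarrow> outputs A (seqs (c # cs)) s (T + n) b"
  unfolding outputs_def seqs.simps using runs_Seq0 by blast

lemma outputs_Seq:
  "runs A c s [] T s' \<Longrightarrow> outputs A d s' n b \<Longrightarrow> outputs A (Seq c d) s (T + n) b"
  unfolding outputs_def using runs_Seq0 by blast

lemma outputs_Branch: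
  assumes "outputs A (case s r of [] \<Rightarrow> c | b # _ \<Rightarrow> if b then e else d) s n b"
  shows "outputs A (Branch r c d e) s (Suc n) b"
  using assms runs_Branch unfolding outputs_def by blast

lemma outputs_setbit: "outputs A (setbit b) s (2 * length (s 0) + 3) b"
  unfolding outputs_def using runs_setbit by fastforce

lemma outputs_negate: "outputs A c s n b \<Longrightarrow> outputs A (seqs [c, negate]) s (n + 7) (\<not> b)"
  unfolding outputs_def
  using runs_seqs_Cons[OF _ runs_seqs_Cons[OF runs_negate runs_seqs_Nil]]
  by (metis (no_types, opaque_lifting) add.assoc fun_upd_same numeral_plus_one semiring_norm(5) semiring_norm(8))

lemma length_ev_le: "length (ev u) \<le> length u" and length_od_le: "length (od u) \<le> length u"
  and length_ev_od_sum: "length (ev u) + length (od u) = length u"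
  using length_deal[of u "[]" "[]"] by (simp_all add: ev_def od_def)

lemma outputs_linc:
  "outputs A linc (init [x, u, b # r]) (2 * length x + 11 * length r + 8) (dot r (True # u))"
proof -
  have 1: "runs A (Pop 2) (init [x, u, b # r]) [] 1 (init [x, u, r])"
    by (rule runs_eq[OF runs_Pop]) (simp_all add: init3_Pop)
  have 2: "runs A (Push 1 True) (init [x, u, r]) [] 1 (init [x, True # u, r])"
    by (rule runs_eq[OF runs_Push]) (auto simp: init3)
  have 3: "runs A (setbit False) (init [x, True # u, r]) [] (2 * length x + 3) (init [[False], True # u, r])"
    by (rule runs_eq[OF runs_setbit]) (auto simp: init3)
  have 4: "outputs A parity (init [[False], True # u, r]) (11 * length r + 1) (dot r (True # u))"
    using runs_parity[of "init [[False], True # u, r]" r False A] by (auto simp: outputs_def)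
  show ?thesis unfolding linc_def
    by (rule outputs_mono[OF outputs_seqs_Cons[OF 1 outputs_seqs_Cons[OF 2 outputs_seqs_Cons[OF 3
      outputs_seqs_single[OF 4]]]]]) simp
qed

lemma outputs_bitc:
  "outputs A bitc (init [x, u, b # i]) (2 * length x + 3 * length i + 8) (length i < length u \<and> u ! length i)"
proof -
  have 1: "runs A (Pop 2) (init [x, u, b # i]) [] 1 (init [x, u, i])"
    by (rule runs_eq[OF runs_Pop]) (simp_all add: init3_Pop)
  have 2: "runs A (While 2 (Seq (Pop 2) (Pop 1))) (init [x, u, i]) [] (3 * length i + 1)
    (init [x, drop (length i) u, []])"
  proof (induction i arbitrary: u)
    case Nil
    then show ?case using runs_While_empty[of "init [x, u, []]" 2] by simp
  next
    case (Cons a i)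
    have "runs A (Seq (Pop 2) (Pop 1)) (init [x, u, a # i]) [] 2 (init [x, tl u, i])"
      by (rule runs_Seq0_eq[OF runs_Pop runs_Pop]) (auto simp: init3 fun_eq_iff)
    from runs_While_step0[OF _ this Cons.IH] show ?case
      by (auto elim!: runs_eq simp: drop_Suc)
  qed
  have 3: "outputs A (Branch 1 (setbit False) (setbit False) (setbit True)) (init [x, drop (length i) u, []])
     (Suc (2 * length x + 3)) (length i < length u \<and> u ! length i)"
  proof (rule outputs_Branch)
    let ?s = "init [x, drop (length i) u, []]"
    have "outputs A (setbit b) ?s (2 * length x + 3) b" for b
      using outputs_setbit[of A b ?s] by simp
    then show "outputs A (case ?s 1 of [] \<Rightarrow> setbit False | b # _ \<Rightarrow> if b then setbit True else setbit False)
      ?s (2 * length x + 3) (length i < length u \<and> u ! length i)"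
      by (cases "length i < length u"; cases "drop (length i) u")
        (auto simp: nth_via_drop)
  qed
  show ?thesis unfolding bitc_def
    by (rule outputs_mono[OF outputs_seqs_Cons[OF 1 outputs_seqs_Cons[OF 2 outputs_seqs_single[OF 3]]]]) simp
qed

lemma outputs_evenc:
  assumes "outputs A c (init [x, ev u, z]) n b"
  shows "outputs A (evenc c) (init [x, u, b' # z]) (n + 21 * length u + 10) b"
proof -
  have 1: "runs A (Pop 2) (init [x, u, b' # z]) [] 1 (init [x, u, z])"
    by (rule runs_eq[OF runs_Pop]) (simp_all add: init3_Pop)
  define s1 :: state where "s1 = (\<lambda>_. [])(0 := x, 2 := z, 3 := ev u, 4 := od u)"
  have 2: "runs A (dealc 1 3 4) (init [x, u, z]) [] (7 * length u + 1) s1"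
    by (rule runs_eq[OF runs_dealc]) (auto simp: s1_def init3 ev_def od_def fun_eq_iff)
  have 3: "runs A (copy 3 1 5) s1 [] (10 * length (ev u) + 2) (s1(1 := ev u))"
    by (rule runs_eq[OF runs_copy]) (auto simp: s1_def)
  have 4: "runs A (clear 3) (s1(1 := ev u)) [] (2 * length (ev u) + 1) (s1(1 := ev u, 3 := []))"
    by (rule runs_eq[OF runs_clear]) (auto simp: s1_def)
  have 5: "runs A (clear 4) (s1(1 := ev u, 3 := [])) [] (2 * length (od u) + 1) (init [x, ev u, z])"
    by (rule runs_eq[OF runs_clear]) (auto simp: s1_def init3 fun_eq_iff)
  show ?thesis unfolding evenc_def
    by (rule outputs_mono[OF outputs_seqs_Cons[OF 1 outputs_seqs_Cons[OF 2 outputs_seqs_Cons[OF 3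
       outputs_seqs_Cons[OF 4 outputs_seqs_Cons[OF 5 outputs_seqs_single[OF assms]]]]]]])
     (use length_ev_od_sum[of u] in simp)
qed

lemma outputs_oddc:
  assumes "outputs A c (init [x, y, od u]) n b"
  shows "outputs A (oddc c) (init [x, u, b' # y]) (n + 21 * length u + 12 * length y + 30) (\<not> b)"
proof -
  have 1: "runs A (Pop 2) (init [x, u, b' # y]) [] 1 (init [x, u, y])"
    by (rule runs_eq[OF runs_Pop]) (simp_all add: init3_Pop)
  define s1 :: state where "s1 = (\<lambda>_. [])(0 := x, 2 := y, 3 := ev u, 4 := od u)"
  have 2: "runs A (dealc 1 3 4) (init [x, u, y]) [] (7 * length u + 1) s1"
    by (rule runs_eq[OF runs_dealc]) (auto simp: s1_def init3 ev_def od_def fun_eq_iff)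
  have 3: "runs A (copy 2 1 5) s1 [] (10 * length y + 2) (s1(1 := y))"
    by (rule runs_eq[OF runs_copy]) (auto simp: s1_def)
  have 4: "runs A (clear 2) (s1(1 := y)) [] (2 * length y + 1) (s1(1 := y, 2 := []))"
    by (rule runs_eq[OF runs_clear]) (auto simp: s1_def)
  have 5: "runs A (copy 4 2 5) (s1(1 := y, 2 := [])) [] (10 * length (od u) + 2) (s1(1 := y, 2 := od u))"
    by (rule runs_eq[OF runs_copy]) (auto simp: s1_def)
  have 6: "runs A (clear 3) (s1(1 := y, 2 := od u)) [] (2 * length (ev u) + 1) (s1(1 := y, 2 := od u, 3 := []))"
    by (rule runs_eq[OF runs_clear]) (auto simp: s1_def)
  have 7: "runs A (clear 4) (s1(1 := y, 2 := od u, 3 := [])) [] (2 * length (od u) + 1) (init [x, y, od u])"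
    by (rule runs_eq[OF runs_clear]) (auto simp: s1_def init3 fun_eq_iff)
  show ?thesis unfolding oddc_def
    by (rule outputs_mono[OF outputs_seqs_Cons[OF 1 outputs_seqs_Cons[OF 2 outputs_seqs_Cons[OF 3
       outputs_seqs_Cons[OF 4 outputs_seqs_Cons[OF 5 outputs_seqs_Cons[OF 6 outputs_seqs_Cons[OF 7
       outputs_negate[OF assms]]]]]]]]])
     (use length_ev_od_sum[of u] in simp)
qed

lemma polytime3_sat:
  assumes "polytime3 G"
  shows "polytime3 (sat G)"
proof -
  from assms obtain c p where c:
    "\<And>x y z. outputs {} c (init [x, y, z]) (poly p (length x + length y + length z)) (G x y z)"
    unfolding polytime3_def computes_outputs by blast
  \<comment> \<open>The linear part covers splitting the candidate and reading the tags. Each level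
    of nested tests costs a branch and a pop, so the constants in the bounds below fall by 2: 49,
    47, 45.\<close>
  define q where "q = p + [:50, 40:]"
  have "outputs {} (satc c) (init [x, u, v]) (poly q (length x + length u + length v)) (sat G x u v)" for x u v
  proof -
    define n where "n = length x + length u + length v"
    have dflt: "outputs {} (setbit True) (init [x, u, v']) (2 * n + 3) True" for v'
      by (rule outputs_mono[OF outputs_setbit]) (simp add: n_def)
    have pop: "runs {} (Pop 2) (init [x, u, b # v']) [] 1 (init [x, u, v'])" for b v'
      by (rule runs_eq[OF runs_Pop]) (simp_all add: init3_Pop)
    have "outputs {} (case v of [] \<Rightarrow> setbit True | b # _ \<Rightarrow> if b then linc else 
      (Seq (Pop 2) (Branch 2 (setbit True) (Seq (Pop 2) (Branch 2 (setbit True) (oddc c) (evenc c))) bitc)))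
      (init [x, u, v]) (poly p n + 40 * n + 49) (sat G x u v)"
    proof (cases v)
      case Nil
      then show ?thesis using outputs_mono[OF dflt[of "[]"]] by simp
    next
      case v: (Cons b1 v1)
      show ?thesis
      proof (cases b1)
        case True
        then show ?thesis using v n_def by (auto intro!: outputs_mono[OF outputs_linc])
      next
        case b1: False
        have "outputs {} (case v1 of [] \<Rightarrow> setbit True | b # _ \<Rightarrow> if b then bitc else
            Seq (Pop 2) (Branch 2 (setbit True) (oddc c) (evenc c)))
          (init [x, u, v1]) (poly p n + 40 * n + 47) (sat G x u v)"
        proof (cases v1)
          case Nil
          then show ?thesis using v b1 outputs_mono[OF dflt[of "[]"]] by simp
        next
          case v1: (Cons b2 v2)
          show ?thesis
          proof (cases b2)
            case True
            then show ?thesis using v v1 b1 n_def by (auto intro!: outputs_mono[OF outputs_bitc])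
          next
            case b2: False
            have "outputs {} (case v2 of [] \<Rightarrow> setbit True | b # _ \<Rightarrow> if b then evenc c else oddc c)
              (init [x, u, v2]) (poly p n + 40 * n + 45) (sat G x u v)"
            proof (cases v2)
              case Nil
              then show ?thesis using v v1 b1 b2 outputs_mono[OF dflt[of "[]"]] by simp
            next
              case v2: (Cons b3 v3)
              have n: "n = length x + length u + length v3 + 3" by (simp add: n_def v v1 v2)
              show ?thesis
              proof (cases b3)
                case True
                have "outputs {} (evenc c) (init [x, u, True # v3])
                  (poly p (length x + length (ev u) + length v3) + 21 * length u + 10) (G x (ev u) v3)"
                  by (rule outputs_evenc[OF c])
                moreover have "poly p (length x + length (ev u) + length v3) \<le> poly p n"
                  by (rule poly_nat_mono) (use length_ev_le[of u] n in simp)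
                ultimately have "outputs {} (evenc c) (init [x, u, True # v3])
                  (poly p n + 40 * n + 45) (G x (ev u) v3)"
                  by (elim outputs_mono) (use n in simp)
                then show ?thesis using True v v1 v2 b1 b2 by simp
              next
                case False
                have "outputs {} (oddc c) (init [x, u, False # v3])
                  (poly p (length x + length v3 + length (od u)) + 21 * length u + 12 * length v3 + 30) (\<not> G x v3 (od u))"
                  by (rule outputs_oddc[OF c])
                moreover have "poly p (length x + length v3 + length (od u)) \<le> poly p n"
                  by (rule poly_nat_mono) (use length_od_le[of u] n in simp)
                ultimately have "outputs {} (oddc c) (init [x, u, False # v3])
                  (poly p n + 40 * n + 45) (\<not> G x v3 (od u))"
                  by (elim outputs_mono) (use n in simp)
                then show ?thesis using False v v1 v2 b1 b2 by simp
              qed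
            qed
            then have "outputs {} (Branch 2 (setbit True) (oddc c) (evenc c))
              (init [x, u, v2]) (Suc (poly p n + 40 * n + 45)) (sat G x u v)"
              by (intro outputs_Branch) simp
            from outputs_Seq[OF pop this, of b2] show ?thesis using b2 v1
              by (auto elim: outputs_mono)
          qed
        qed
        then have "outputs {} (Branch 2 (setbit True) (Seq (Pop 2) (Branch 2 (setbit True) (oddc c) (evenc c))) bitc)
          (init [x, u, v1]) (Suc (poly p n + 40 * n + 47)) (sat G x u v)"
          by (intro outputs_Branch) simp
        from outputs_Seq[OF pop this, of b1] show ?thesis using b1 v
          by (auto elim: outputs_mono)
      qed
    qed
    then have "outputs {} (satc c) (init [x, u, v]) (Suc (poly p n + 40 * n + 49)) (sat G x u v)"
      unfolding satc_def by (intro outputs_Branch) simp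
    then show ?thesis by (rule outputs_mono) (simp add: q_def n_def)
  qed
  then show ?thesis unfolding polytime3_def computes_outputs by blast
qed

section \<open>The NP query language\<close>

function decs :: "word \<Rightarrow> word list" where
  "decs D = (if D = [] then [] else fst (dec [] D) # decs (snd (dec [] D)))"
  by auto
termination by (relation "Wellfounded.measure length") (auto intro: dec_length_snd)

declare decs.simps [simp del]

lemma decs_Nil [simp]: "decs [] = []"
  by (simp add: decs.simps)

lemma decs_enc: "decs (enc v @ D) = v # decs D"
  by (subst decs.simps) (simp add: dec_enc, simp add: enc_def)

definition encs :: "word list \<Rightarrow> word" where
  "encs vs = concat (map enc vs)"

lemma encs_simps [simp]: "encs [] = []" "encs (v # vs) = enc v @ encs vs"
  "encs (vs @ vs') = encs vs @ encs vs'"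
  by (simp_all add: encs_def)

lemma decs_encs: "decs (encs vs) = vs"
  by (induction vs) (simp_all add: decs_enc)

lemma length_decs: "length (decs D) \<le> length D"
proof (induction D rule: decs.induct)
  case (1 D)
  show ?case
  proof (cases "D = []")
    case False
    with 1 dec_length_snd[OF False, of "[]"] show ?thesis by (subst decs.simps) simp
  qed simp
qed

text \<open>\<open>M\<close> is a length in unary. In \<open>NP\<close> the witness length is a
  function of the query length, so the witness is taken as long as the query and cut down to
  \<open>length M\<close> bits.\<close>

definition accepts :: "(word \<Rightarrow> word \<Rightarrow> word \<Rightarrow> bool) \<Rightarrow> word \<Rightarrow> word \<Rightarrow> bool" where
  "accepts C D w \<longleftrightarrow> (let (M, D1) = dec [] D; (x, D2) = dec [] D1 in
     \<forall>v\<in>set (decs D2). C x (take (length M) w) v)"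

definition query_language :: "(word \<Rightarrow> word \<Rightarrow> word \<Rightarrow> bool) \<Rightarrow> word set" where
  "query_language C = {D. \<exists>w\<in>words (length D). accepts C D w}"

definition query :: "word \<Rightarrow> word \<Rightarrow> word list \<Rightarrow> word" where
  "query M x vs = enc M @ enc x @ encs vs"

lemma query_in_query_language:
  "query M x vs \<in> query_language C \<longleftrightarrow> (\<exists>u\<in>words (length M). \<forall>v\<in>set vs. C x u v)"
proof -
  have acc: "accepts C (query M x vs) w \<longleftrightarrow> (\<forall>v\<in>set vs. C x (take (length M) w) v)" for w
    by (simp add: accepts_def query_def dec_enc decs_encs)
  have len: "length M \<le> length (query M x vs)"
    by (simp add: query_def length_enc)
  show ?thesis
  proof
    assume "query M x vs \<in> query_language C"
    then obtain w where "w \<in> words (length (query M x vs))" "\<forall>v\<in>set vs. C x (take (length M) w) v"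
      by (auto simp: query_language_def acc)
    then show "\<exists>u\<in>words (length M). \<forall>v\<in>set vs. C x u v"
      using len by (intro bexI[of _ "take (length M) w"]) (auto simp: words_def)
  next
    assume "\<exists>u\<in>words (length M). \<forall>v\<in>set vs. C x u v"
    then obtain u where u: "u \<in> words (length M)" "\<forall>v\<in>set vs. C x u v" by blast
    define w where "w = u @ replicate (length (query M x vs) - length M) False"
    have "w \<in> words (length (query M x vs))" "take (length M) w = u"
      using u len by (auto simp: w_def words_def)
    then show "query M x vs \<in> query_language C" using u(2) acc by (auto simp: query_language_def)
  qed
qed

section \<open>A polynomial-time verifier for the query language\<close>

definition checkc :: "com \<Rightarrow> com" where
  "checkc c = While 0 (seqs [decode 0 7 6, call c 3 5 7 8 9, clear 7])"

text \<open>Stack 8 collects one bit for each violated constraint. It is the only one that grows, so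
  its bound also counts the constraints still to be read.\<close>

lemma runs_checkc:
  assumes c: "\<And>v. length v \<le> S \<Longrightarrow> computes_within {} c [x, u, v] T [C x u v]"
  shows "s 0 = D \<Longrightarrow> s 3 = x \<Longrightarrow> s 5 = u \<Longrightarrow> s 6 = [] \<Longrightarrow> s 7 = [] \<Longrightarrow> s 9 = [] \<Longrightarrow>
    (\<And>r. 30 \<le> r \<Longrightarrow> s r = []) \<Longrightarrow> (\<And>r. r \<noteq> 8 \<Longrightarrow> length (s r) \<le> S) \<Longrightarrow> length (s 8) + length (decs D) \<le> S \<Longrightarrow>
    runs {} (checkc c) s [] ((6 * S + 6 + call_time c S T + 2 * S + 3) * length (decs D) + 1)
      (s(0 := [], 8 := replicate (length (filter (\<lambda>v. \<not> C x u v) (decs D))) True @ s 8))"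
proof (induction D arbitrary: s rule: decs.induct)
  case (1 D)
  note reg = "1.prems"
  show ?case
  proof (cases "D = []")
    case True
    then have "runs {} (checkc c) s [] 1 s" unfolding checkc_def using reg(1) by (intro runs_While_empty) simp
    then show ?thesis by (rule runs_eq) (use True reg(1) in \<open>auto simp: fun_eq_iff\<close>)
  next
    case False
    define v where "v = fst (dec [] D)"
    define D' where "D' = snd (dec [] D)"
    have decs: "decs D = v # decs D'"
      using False by (subst decs.simps) (simp add: v_def D'_def)
    have len_v: "length v \<le> S" "length D' \<le> S"
      using dec_length[of "[]" D] reg(8)[of 0] reg(1) by (auto simp: v_def D'_def)
    define s1 where "s1 = s(0 := D', 7 := v)"
    define s2 where "s2 = s1(8 := (if C x u v then [] else [True]) @ s 8)"
    define s3 where "s3 = s2(7 := [])"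
    have 1: "runs {} (decode 0 7 6) s [] (6 * S + 6) s1"
      by (rule runs_eq[OF runs_decode]) (use reg reg(8)[of 0] in \<open>auto simp: s1_def v_def D'_def\<close>)
    have "length (s1 r) \<le> S" for r
      using reg(8)[of r] reg(9) len_v by (cases "r = 8") (auto simp: s1_def)
    then have 2: "runs {} (call c 3 5 7 8 9) s1 [] (call_time c S T) s2"
      by (intro runs_eq[OF runs_call[where b = "C x u v" and S = S]])
        (use c[OF len_v(1)] reg in \<open>auto simp: s1_def s2_def\<close>)
    have 3: "runs {} (clear 7) s2 [] (2 * S + 1) s3"
      by (rule runs_eq[OF runs_clear]) (use len_v in \<open>auto simp: s3_def s2_def s1_def\<close>)
    have body: "runs {} (seqs [decode 0 7 6, call c 3 5 7 8 9, clear 7]) s []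
      ((6 * S + 6) + (call_time c S T + ((2 * S + 1) + 1))) s3"
      by (rule runs_seqs_Cons[OF 1 runs_seqs_Cons[OF 2 runs_seqs_Cons[OF 3 runs_seqs_Nil]]])
    have rest: "runs {} (checkc c) s3 [] ((6 * S + 6 + call_time c S T + 2 * S + 3) * length (decs D') + 1)
      (s3(0 := [], 8 := replicate (length (filter (\<lambda>v. \<not> C x u v) (decs D'))) True @ s3 8))"
      unfolding D'_def by (rule "1.IH"[OF False])
        (use reg len_v decs in \<open>auto simp: s3_def s2_def s1_def D'_def\<close>)
    have "runs {} (checkc c) s [] (Suc (((6 * S + 6) + (call_time c S T + ((2 * S + 1) + 1))) +
       ((6 * S + 6 + call_time c S T + 2 * S + 3) * length (decs D') + 1)))
       (s3(0 := [], 8 := replicate (length (filter (\<lambda>v. \<not> C x u v) (decs D'))) True @ s3 8))"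
      using rest unfolding checkc_def
      by (intro runs_While_step0[OF _ body]) (use reg False in auto)
    then show ?thesis
      by (rule runs_eq) (use reg in \<open>auto simp: decs s3_def s2_def s1_def fun_eq_iff replicate_app_Cons_same algebra_simps\<close>)
  qed
qed

definition verifyc :: "com \<Rightarrow> com" where
  "verifyc c = seqs [decode 0 2 6, decode 0 3 6, While 2 (Seq (Pop 2) (mv 1 4)), moves 4 5,
     checkc c, Branch 8 (setbit True) (setbit False) (setbit False)]"

lemma runs_take:
  assumes "distinct [k, a, b]"
  shows "s k = M \<Longrightarrow> runs A (While k (Seq (Pop k) (mv a b))) s [] (5 * length M + 1)
     (s(k := [], a := drop (length M) (s a), b := rev (take (length M) (s a)) @ s b))"
proof (induction M arbitrary: s)
  case Nil
  then show ?case by (intro runs_eq[OF runs_While_empty]) (auto simp: fun_eq_iff)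
next
  case (Cons c M)
  let ?s = "s(k := M, a := tl (s a), b := take 1 (s a) @ s b)"
  have 1: "runs A (Seq (Pop k) (mv a b)) s [] 4 ?s"
    by (rule runs_Seq0_eq[OF runs_Pop runs_mv]) (use Cons.prems assms in \<open>auto simp: fun_eq_iff\<close>)
  have 2: "runs A (While k (Seq (Pop k) (mv a b))) ?s [] (5 * length M + 1)
     (?s(k := [], a := drop (length M) (?s a), b := rev (take (length M) (?s a)) @ ?s b))"
    by (rule Cons.IH) (use assms in simp)
  show ?case
    by (rule runs_eq[OF runs_While_step0[OF _ 1 2]])
      (use Cons.prems assms in \<open>cases "s a"; auto simp: fun_eq_iff drop_Suc\<close>)+
qed

lemma query_language_NP:
  assumes "polytime3 C"
  shows "query_language C \<in> NP"
proof -
  from assms obtain c p where c: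
    "\<And>x y z. computes_within {} c [x, y, z] (poly p (length x + length y + length z)) [C x y z]"
    unfolding polytime3_def by blast
  \<comment> \<open>\<open>S\<close> stands for the length of query and witness together. Each
    argument of \<open>c\<close> is a part of them, which gives \<open>3 * S\<close>.\<close>
  define T where "T S = (6 * S + 6) + ((6 * S + 6) + ((5 * S + 1) + ((4 * S + 1) +
    (((6 * S + 6 + call_time c S (poly p (3 * S)) + 2 * S + 3) * S + 1) + (Suc (2 * S + 3) + 1)))))" for S
  have main: "computes_within {} (verifyc c) [D, w] (T (length D + length w)) [accepts C D w]" for D w
  proof -
    define S where "S = length D + length w"
    define M where "M = fst (dec [] D)"
    define D1 where "D1 = snd (dec [] D)"
    define x where "x = fst (dec [] D1)"
    define D2 where "D2 = snd (dec [] D1)"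
    define u where "u = take (length M) w"
    have acc: "accepts C D w \<longleftrightarrow> (\<forall>v\<in>set (decs D2). C x u v)"
      by (simp add: accepts_def M_def D1_def x_def D2_def u_def case_prod_beta Let_def)
    have len: "length M \<le> S" "length D1 \<le> S" "length x \<le> S" "length D2 \<le> S" "length u \<le> S"
      "length D \<le> S" "length w \<le> S"
      using dec_length[of "[]" D] dec_length[of "[]" D1]
      by (auto simp: M_def[symmetric] D1_def[symmetric] x_def[symmetric] D2_def[symmetric] S_def u_def)
    define s0 where "s0 = init [D, w]"
    define s1 where "s1 = s0(0 := D1, 2 := M)"
    define s2 where "s2 = s1(0 := D2, 3 := x)"
    define s3 where "s3 = s2(2 := [], 1 := drop (length M) w, 4 := rev u)"
    define s4 where "s4 = s3(4 := [], 5 := u)"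
    define s5 where "s5 = s4(0 := [], 8 := replicate (length (filter (\<lambda>v. \<not> C x u v) (decs D2))) True)"
    note sdefs = s0_def s1_def s2_def s3_def s4_def s5_def init2
    have 1: "runs {} (decode 0 2 6) s0 [] (6 * S + 6) s1"
      by (rule runs_eq[OF runs_decode]) (use len in \<open>auto simp: sdefs M_def D1_def\<close>)
    have 2: "runs {} (decode 0 3 6) s1 [] (6 * S + 6) s2"
      by (rule runs_eq[OF runs_decode]) (use len in \<open>auto simp: sdefs x_def D2_def\<close>)
    have 3: "runs {} (While 2 (Seq (Pop 2) (mv 1 4))) s2 [] (5 * S + 1) s3"
      by (rule runs_eq[OF runs_take[where M = M]]) (use len in \<open>auto simp: sdefs u_def\<close>)
    have 4: "runs {} (moves 4 5) s3 [] (4 * S + 1) s4"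
      by (rule runs_eq[OF runs_moves]) (use len in \<open>auto simp: sdefs\<close>)
    have 5: "runs {} (checkc c) s4 [] ((6 * S + 6 + call_time c S (poly p (3 * S)) + 2 * S + 3) * S + 1) s5"
    proof (rule runs_eq[OF runs_checkc[where C = C and x = x and u = u and D = D2 and S = S and T = "poly p (3 * S)"]])
      show "computes_within {} c [x, u, v] (poly p (3 * S)) [C x u v]" if "length v \<le> S" for v
      proof -
        have "poly p (length x + length u + length v) \<le> poly p (3 * S)"
          by (rule poly_nat_mono) (use len that in simp)
        then show ?thesis using c[of x u v] unfolding computes_within_def by (meson order_trans)
      qed
      have "length (decs D2) \<le> S" using length_decs[of D2] len by simp
      then show "length (s4 8) + length (decs D2) \<le> S" 
        "(6 * S + 6 + call_time c S (poly p (3 * S)) + 2 * S + 3) * length (decs D2) + 1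
        \<le> (6 * S + 6 + call_time c S (poly p (3 * S)) + 2 * S + 3) * S + 1"
        by (simp_all add: sdefs mult_le_mono)
    qed (use len in \<open>auto simp: sdefs\<close>)
    have "outputs {} (Branch 8 (setbit True) (setbit False) (setbit False)) s5 (Suc (2 * S + 3)) (accepts C D w)"
    proof (rule outputs_Branch)
      have "outputs {} (setbit b) s5 (2 * S + 3) b" for b
        by (rule outputs_mono[OF outputs_setbit]) (simp add: sdefs)
      moreover define k where "k = length (filter (\<lambda>v. \<not> C x u v) (decs D2))"
      have "accepts C D w \<longleftrightarrow> k = 0" by (auto simp: acc k_def filter_empty_conv)
      moreover have "s5 8 = replicate k True" by (simp add: s5_def k_def)
      ultimately show "outputs {} (case s5 8 of [] \<Rightarrow> setbit True | b # _ \<Rightarrow> if b then setbit False else setbit False)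
        s5 (2 * S + 3) (accepts C D w)"
        by (cases k) simp_all
    qed
    then show ?thesis unfolding computes_outputs verifyc_def T_def S_def[symmetric] s0_def[symmetric]
      by (intro outputs_seqs_Cons[OF 1] outputs_seqs_Cons[OF 2] outputs_seqs_Cons[OF 3] outputs_seqs_Cons[OF 4]
        outputs_seqs_Cons[OF 5] outputs_seqs_single)
  qed
  have "poly_bounded T" unfolding T_def call_time_def by (intro poly_bounded_add poly_bounded_mult poly_bounded_comp poly_bounded_Suc poly_bounded_const poly_bounded_id)
  then obtain q where q: "\<And>n. T n \<le> poly q n" unfolding poly_bounded_def by blast
  have "computes_within {} (verifyc c) [D, w] (poly q (length D + length w)) [accepts C D w]" for D w
    using main[of D w] q[of "length D + length w"] unfolding computes_within_def by (meson order_trans)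
  then have "polytime2 (accepts C)" unfolding polytime2_def by blast
  moreover have "\<forall>D. D \<in> query_language C \<longleftrightarrow> (\<exists>w\<in>words (poly [:0, 1:] (length D)). accepts C D w)"
    by (simp add: query_language_def)
  ultimately show ?thesis unfolding NP_def by blast
qed

section \<open>The randomized subroutine\<close>

text \<open>
  The input word is on stack \<open>r \<ge> 30\<close>. Scratch stacks: 2 the length of the candidates in unary,
  3 the flag of the restart loop, 4 and 5 the codes of the constraints on the even and on the odd
  positions, 6 the parity constraints of the current round, 7 the constraint being tried, 8 the query
  and its answer, 9 coins, 10 to 13 loop counters, 14 to 16 the extracted candidate and its two
  halves, 17 and 18 copying, 19 the answer.
\<close>

definition ask :: "reg \<Rightarrow> reg list \<Rightarrow> com" where
  "ask r ls = seqs (map (\<lambda>l. copy l 8 17) ls @ [copy r 18 17, encode 18 8, copy 2 18 17, encode 18 8, Query 8])"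

definition ask_time :: "nat \<Rightarrow> nat \<Rightarrow> nat" where
  "ask_time k S = k * (10 * S + 2) + (30 * S + 20)"

text \<open>\<open>Suc m\<close> coins give the coefficients and the constant term. They are flipped
  whether or not the row is kept, so the number of coins is fixed.\<close>

definition rowc :: "reg \<Rightarrow> com" where
  "rowc r = Seq (seqs [copy 2 11 17, Push 11 True]) (Seq (While 11 (Seq (Pop 11) (Flip 9)))
     (seqs [Push 9 True, encode 9 7, ask r [4, 5, 6, 7], Branch 8 Skip Skip (copy 7 6 17), clear 7, clear 8]))"

definition row_time :: "nat \<Rightarrow> nat" where
  "row_time S = 100 * S + 100 + ask_time 4 S"

text \<open>After the pop the counter itself is the position of the bit in unary. Going from the
  last position down to 0 piles up the candidate in its proper order.\<close>

definition bitsc :: "reg \<Rightarrow> com" where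
  "bitsc r = seqs [Pop 13, copy 13 9 17, Push 9 True, Push 9 False, encode 9 7, ask r [4, 5, 6, 7], mv 8 14, clear 7]"

definition bits_time :: "nat \<Rightarrow> nat" where
  "bits_time S = 100 * S + 100 + ask_time 4 S"

text \<open>The halves cross over: the second player's half goes to stack 4 as a test for first
  moves, the other one to stack 5 as a test for second moves. The parities are forgotten after the
  round.\<close>

definition roundc :: "reg \<Rightarrow> com" where
  "roundc r = Seq (seqs [copy 2 10 17, Push 10 True]) (Seq (While 10 (Seq (Pop 10) (rowc r)))
     (seqs [copy 2 13 17, While 13 (bitsc r), dealc 14 15 16, Push 16 True, Push 16 False, Push 16 False, encode 16 4,
        Push 15 False, Push 15 False, Push 15 False, encode 15 5, clear 6]))"

definition round_time :: "nat \<Rightarrow> nat" where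
  "round_time S = 100 * S + 100 + (row_time S + 2) * S + (bits_time S + 1) * S"

text \<open>One question per list suffices: the lists restrict different halves of the candidate, so
  some candidate meets both iff each can be met by itself. A negative answer names the loser and
  clears the flag.\<close>

definition attempt :: "reg \<Rightarrow> com" where
  "attempt r = Seq (seqs (replicate 11 (seqs [copy 2 12 17, Push 12 True])))
     (Seq (While 12 (Seq (Pop 12) (roundc r)))
       (seqs [ask r [4], Branch 8 Skip (seqs [Push 19 False, clear 3]) Skip, clear 8,
              ask r [5], Branch 8 Skip (seqs [Push 19 True, clear 3]) Skip, clear 8, clear 4, clear 5]))"

definition attempt_time :: "nat \<Rightarrow> nat" where
  "attempt_time S = 200 * S + 200 + (round_time S + 2) * S + 2 * ask_time 1 S"

section \<open>Correctness of the randomized subroutine\<close>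

lemma runs_seqs_append:
  "runs A (seqs cs) s [] T s' \<Longrightarrow> runs A (seqs ds) s' [] T' s'' \<Longrightarrow> runs A (seqs (cs @ ds)) s [] (T + T') s''"
proof (induction cs arbitrary: s T)
  case Nil
  from Nil(1) have "s' = s" by (auto simp: runs_def elim: exec.cases)
  with Nil(2) show ?case by (auto elim: runs_mono)
next
  case (Cons c cs)
  from Cons.prems(1) obtain t where t: "exec A (Seq c (seqs cs)) s [] t s'" "t \<le> T"
    by (auto simp: runs_def)
  then obtain t1 t2 s1 where 1: "exec A c s [] t1 s1" "exec A (seqs cs) s1 [] t2 s'" "t = t1 + t2"
    by (auto elim: exec.cases)
  have "runs A (seqs (cs @ ds)) s1 [] (t2 + T') s''"
    by (rule Cons.IH[OF runsI[OF 1(2)] Cons.prems(2)])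
  from runs_seqs_Cons[OF runsI[OF 1(1)] this] show ?case
    using 1(3) t(2) by (auto elim: runs_mono)
qed

text \<open>Only the answers to well-formed queries about the fixed \<open>x\<close> matter.
  \<open>2 * length M + 10\<close> leaves room for the code of one constraint.\<close>

locale game =
  fixes A :: "word set" and x M :: word and G :: "word \<Rightarrow> word \<Rightarrow> word \<Rightarrow> bool" and r :: reg and S :: nat
  assumes query_A: "query M x vs \<in> A \<longleftrightarrow> (\<exists>u\<in>words (length M). \<forall>v\<in>set vs. sat G x u v)"
    and r: "30 \<le> r"
    and S: "length x \<le> S" "2 * length M + 10 \<le> S"
begin

abbreviation m where "m \<equiv> length M"

definition W :: "word list \<Rightarrow> word set" where
  "W vs = {u \<in> words m. \<forall>v\<in>set vs. sat G x u v}"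

lemma query_W: "query M x vs \<in> A \<longleftrightarrow> W vs \<noteq> {}"
  unfolding query_A W_def by auto

text \<open>Stacks are written at the front, so the text is assembled from its end: the lists of
  \<open>ls\<close> appear in reverse order, and the field \<open>M\<close>, which is read first, is
  written last.\<close>

lemma runs_ask:
  assumes s: "s r = x" "s 2 = M" "s 8 = []" "s 17 = []" "s 18 = []"
    and ls: "\<And>l. l \<in> set ls \<Longrightarrow> l < 30 \<and> l \<noteq> 8 \<and> l \<noteq> 17 \<and> l \<noteq> 18 \<and> s l = encs (vs l) \<and> length (s l) \<le> S"
    and k: "length ls = k"
  shows "runs A (ask r ls) s [] (ask_time k S) (s(8 := [W (concat (map vs (rev ls))) \<noteq> {}]))"
proof -
  have "\<forall>l\<in>set ls. l < 30 \<and> l \<noteq> 8 \<and> l \<noteq> 17 \<and> l \<noteq> 18 \<and> s l = encs (vs l) \<and> length (s l) \<le> S \<Longrightarrow> s 17 = [] \<Longrightarrow>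
    runs A (seqs (map (\<lambda>l. copy l 8 17) ls)) s [] (length ls * (10 * S + 2) + 1)
      (s(8 := encs (concat (map vs (rev ls))) @ s 8))" for s
  proof (induction ls arbitrary: s)
    case Nil
    show ?case unfolding list.map by (rule runs_eq[OF runs_seqs_Nil]) (auto simp: fun_eq_iff)
  next
    case (Cons l ls)
    let ?s = "s(8 := encs (vs l) @ s 8)"
    have 1: "runs A (copy l 8 17) s [] (10 * S + 2) ?s"
      by (rule runs_eq[OF runs_copy]) (use Cons.prems in auto)
    have 2: "runs A (seqs (map (\<lambda>l. copy l 8 17) ls)) ?s [] (length ls * (10 * S + 2) + 1)
      (?s(8 := encs (concat (map vs (rev ls))) @ ?s 8))"
      by (rule Cons.IH) (use Cons.prems in auto)
    show ?case unfolding list.map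
      by (rule runs_eq[OF runs_seqs_Cons[OF 1 2]]) (auto simp: fun_eq_iff)
  qed
  note 1 = this[of s]
  let ?vs = "concat (map vs (rev ls))"
  let ?D = "encs ?vs"
  have 2: "runs A (copy r 18 17) (s(8 := ?D)) [] (10 * S + 2) (s(8 := ?D, 18 := x))"
    by (rule runs_eq[OF runs_copy]) (use r s S in auto)
  have 3: "runs A (encode 18 8) (s(8 := ?D, 18 := x)) [] (5 * S + 2) (s(8 := enc x @ ?D))"
    by (rule runs_eq[OF runs_encode]) (use r s S in \<open>auto simp: fun_eq_iff\<close>)
  have 4: "runs A (copy 2 18 17) (s(8 := enc x @ ?D)) [] (10 * S + 2) (s(8 := enc x @ ?D, 18 := M))"
    by (rule runs_eq[OF runs_copy]) (use r s S in auto)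
  have 5: "runs A (encode 18 8) (s(8 := enc x @ ?D, 18 := M)) [] (5 * S + 2) (s(8 := query M x ?vs))"
    by (rule runs_eq[OF runs_encode]) (use r s S in \<open>auto simp: fun_eq_iff query_def\<close>)
  have 6: "runs A (Query 8) (s(8 := query M x ?vs)) [] 1 (s(8 := [W ?vs \<noteq> {}]))"
    by (rule runs_eq[OF runs_Query]) (auto simp: query_W)
  have "runs A (seqs (map (\<lambda>l. copy l 8 17) ls)) s [] (length ls * (10 * S + 2) + 1) (s(8 := ?D))"
    by (rule runs_eq[OF 1]) (use ls s in \<open>blast | simp\<close>)+
  from runs_seqs_append[OF this runs_seqs_Cons[OF 2 runs_seqs_Cons[OF 3 runs_seqs_Cons[OF 4 
      runs_seqs_Cons[OF 5 runs_seqs_Cons[OF 6 runs_seqs_Nil]]]]]]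
  show ?thesis unfolding ask_def by (rule runs_eq) (auto simp: ask_time_def k)
qed

lemma runs_flips:
  "s 11 = w \<Longrightarrow> length bs = length w \<Longrightarrow>
   runs A (While 11 (Seq (Pop 11) (Flip 9))) s bs (3 * length w + 1) (s(11 := [], 9 := rev bs @ s 9))"
proof (induction w arbitrary: s bs)
  case Nil
  then have "bs = []" by simp
  then show ?case using Nil by (auto intro!: runs_eq[OF runs_While_empty])
next
  case (Cons a w)
  then obtain b bs' where bs: "bs = b # bs'" by (cases bs) auto
  have 1: "runs A (Seq (Pop 11) (Flip 9)) s [b] 2 (s(11 := w, 9 := b # s 9))"
    by (rule runs_Seq_eq[OF runs_Pop runs_Flip]) (use Cons.prems in auto)
  have 2: "runs A (While 11 (Seq (Pop 11) (Flip 9))) (s(11 := w, 9 := b # s 9)) bs' (3 * length w + 1)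
    ((s(11 := w, 9 := b # s 9))(11 := [], 9 := rev bs' @ (s(11 := w, 9 := b # s 9)) 9))"
    by (rule Cons.IH) (use Cons.prems bs in auto)
  have "runs A (While 11 (Seq (Pop 11) (Flip 9))) s ([b] @ bs') (Suc (2 + (3 * length w + 1)))
     ((s(11 := w, 9 := b # s 9))(11 := [], 9 := rev bs' @ (s(11 := w, 9 := b # s 9)) 9))"
    by (rule runs_While_step[OF _ 1 2]) (use Cons.prems in simp)
  then show ?case unfolding bs append_Cons append_Nil
    by (rule runs_eq) (auto simp: fun_eq_iff)
qed

lemma W_Cons: "W (v # vs) = {u \<in> W vs. sat G x u v}"
  by (auto simp: W_def)

lemma runs_rowc:
  assumes s: "s r = x" "s 2 = M" "s 4 = encs ly" "s 5 = encs lz" "s 6 = encs g"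
      "s 7 = []" "s 8 = []" "s 9 = []" "s 11 = []" "s 17 = []" "s 18 = []"
    and len: "length (encs ly) \<le> S" "length (encs lz) \<le> S" "length (encs g) \<le> S"
    and bs: "length bs = Suc m"
  defines "v \<equiv> True # rev bs"
  shows "runs A (rowc r) s bs (row_time S)
    (s(6 := encs (if W (v # g @ lz @ ly) \<noteq> {} then v # g else g)))"
proof -
  have 1: "runs A (seqs [copy 2 11 17, Push 11 True]) s [] (10 * S + 4) (s(11 := True # M))"
    by (rule runs_eq[OF runs_seqs_Cons[OF runs_copy runs_seqs_Cons[OF runs_Push runs_seqs_Nil]]])
      (use s S r in auto)
  have 2: "runs A (While 11 (Seq (Pop 11) (Flip 9))) (s(11 := True # M)) bs (3 * S + 1) (s(9 := rev bs))"
    by (rule runs_eq[OF runs_flips[where w = "True # M"]]) (use s S bs in \<open>auto simp: fun_eq_iff\<close>)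
  let ?s1 = "s(9 := v)"
  let ?s2 = "s(7 := enc v)"
  let ?b = "W (v # g @ lz @ ly) \<noteq> {}"
  let ?s3 = "?s2(8 := [?b])"
  let ?s4 = "?s3(6 := encs (if ?b then v # g else g))"
  have len_v: "length (enc v) \<le> S" "length v \<le> S" using bs S by (auto simp: length_enc v_def)
  have 3: "runs A (Push 9 True) (s(9 := rev bs)) [] 1 ?s1"
    by (rule runs_eq[OF runs_Push]) (auto simp: v_def)
  have 4: "runs A (encode 9 7) ?s1 [] (5 * S + 2) ?s2"
    by (rule runs_eq[OF runs_encode]) (use s len_v in \<open>auto simp: fun_eq_iff\<close>)
  define vs where "vs l = (if l = 4 then ly else if l = 5 then lz else if l = 6 then g else [v])" for l :: reg
  have 5: "runs A (ask r [4, 5, 6, 7]) ?s2 [] (ask_time 4 S) ?s3"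
    by (rule runs_eq[OF runs_ask[where vs = vs and k = 4]]) (use s r len len_v in \<open>auto simp: vs_def fun_eq_iff\<close>)
  have 6: "runs A (Branch 8 Skip Skip (copy 7 6 17)) ?s3 [] (Suc (10 * S + 2)) ?s4"
  proof (rule runs_Branch)
    have "runs A (copy 7 6 17) ?s3 [] (10 * S + 2) ?s4" if ?b
      by (rule runs_eq[OF runs_copy]) (use that s len_v in \<open>auto simp: fun_eq_iff\<close>)
    moreover have "runs A Skip ?s3 [] (10 * S + 2) ?s4" if "\<not> ?b"
      by (rule runs_eq[OF runs_Skip]) (use that s in \<open>auto simp: fun_eq_iff\<close>)
    ultimately show "runs A (case ?s3 8 of [] \<Rightarrow> Skip | b # _ \<Rightarrow> if b then copy 7 6 17 else Skip) ?s3 []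
      (10 * S + 2) ?s4" by simp
  qed
  have 7: "runs A (clear 7) ?s4 [] (2 * S + 1) (?s4(7 := []))"
    by (rule runs_eq[OF runs_clear]) (use len_v in auto)
  have 8: "runs A (clear 8) (?s4(7 := [])) [] 3 (s(6 := encs (if ?b then v # g else g)))"
    by (rule runs_eq[OF runs_clear]) (use s in \<open>auto simp: fun_eq_iff\<close>)
  have 9: "runs A (seqs [Push 9 True, encode 9 7, ask r [4, 5, 6, 7], Branch 8 Skip Skip (copy 7 6 17), clear 7, clear 8])
    (s(9 := rev bs)) [] (1 + ((5 * S + 2) + (ask_time 4 S + (Suc (10 * S + 2) + ((2 * S + 1) + (3 + 1))))))
    (s(6 := encs (if ?b then v # g else g)))"
    by (intro runs_seqs_Cons[OF 3] runs_seqs_Cons[OF 4] runs_seqs_Cons[OF 5] runs_seqs_Cons[OF 6]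
      runs_seqs_Cons[OF 7] runs_seqs_Cons[OF 8] runs_seqs_Nil)
  from runs_Seq[OF 1 runs_Seq[OF 2 9]] show ?thesis
    unfolding rowc_def append_Nil append_Nil2 by (rule runs_eq) (auto simp: row_time_def)
qed

text \<open>The program's greedy choice of parities realizes \<open>narrow\<close>. The space bound
  reserves \<open>2 * m + 5\<close> bits for each row to come, the code length of a tag bit with
  \<open>Suc m\<close> coins.\<close>

lemma runs_rowsc:
  assumes "s r = x" "s 2 = M" "s 4 = encs ly" "s 5 = encs lz" "s 6 = encs g" "s 10 = w"
      "s 7 = []" "s 8 = []" "s 9 = []" "s 11 = []" "s 17 = []" "s 18 = []"
    and "length (encs ly) \<le> S" "length (encs lz) \<le> S" "length (encs g) + length w * (2 * m + 5) \<le> S"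
    and "length \<rho> = length w * Suc m"
  shows "\<exists>g'. runs A (While 10 (Seq (Pop 10) (rowc r))) s \<rho> ((row_time S + 2) * length w + 1) (s(6 := encs g', 10 := []))
    \<and> W (g' @ lz @ ly) = narrow (rows (length w) (Suc m) \<rho>) (W (g @ lz @ ly))
    \<and> length (encs g') \<le> S"
  using assms
proof (induction w arbitrary: s g \<rho>)
  case Nil
  have \<rho>: "\<rho> = []" using Nil.prems(16) by simp
  show ?case
  proof (intro exI[of _ g] conjI)
    show "runs A (While 10 (Seq (Pop 10) (rowc r))) s \<rho> ((row_time S + 2) * length [] + 1) (s(6 := encs g, 10 := []))"
      unfolding \<rho> by (rule runs_eq[OF runs_While_empty]) (use Nil.prems in \<open>auto simp: fun_eq_iff\<close>)
  qed (use Nil.prems(15) in auto)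
next
  case (Cons a w)
  define bs where "bs = take (Suc m) \<rho>"
  define \<rho>' where "\<rho>' = drop (Suc m) \<rho>"
  have \<rho>: "\<rho> = bs @ \<rho>'" "length bs = Suc m" "length \<rho>' = length w * Suc m"
    using Cons.prems(16) by (auto simp: bs_def \<rho>'_def)
  let ?v = "True # rev bs"
  define g1 where "g1 = (if W (?v # g @ lz @ ly) \<noteq> {} then ?v # g else g)"
  let ?s = "s(10 := w, 6 := encs g1)"
  have g1: "length (encs g1) + length w * (2 * m + 5) \<le> S"
    using Cons.prems(15) \<rho>(2) by (auto simp: g1_def length_enc)
  have "runs A (rowc r) (s(10 := w)) bs (row_time S) ?s"
    by (rule runs_eq[OF runs_rowc[where g = g and ly = ly and lz = lz]]) (use Cons.prems \<rho> r in \<open>auto simp: g1_def\<close>)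
  then have 1: "runs A (Seq (Pop 10) (rowc r)) s bs (1 + (row_time S)) ?s"
    by (intro runs_Seq_eq[OF runs_Pop, where bs' = bs]) (use Cons.prems in auto)
  have "\<exists>g'. runs A (While 10 (Seq (Pop 10) (rowc r))) ?s \<rho>' ((row_time S + 2) * length w + 1) (?s(6 := encs g', 10 := []))
    \<and> W (g' @ lz @ ly) = narrow (rows (length w) (Suc m) \<rho>') (W (g1 @ lz @ ly))
    \<and> length (encs g') \<le> S"
    by (rule Cons.IH) (use Cons.prems g1 \<rho> r in auto)
  then obtain g' where g': "runs A (While 10 (Seq (Pop 10) (rowc r))) ?s \<rho>' ((row_time S + 2) * length w + 1) (?s(6 := encs g', 10 := []))"
    "W (g' @ lz @ ly) = narrow (rows (length w) (Suc m) \<rho>') (W (g1 @ lz @ ly))" "length (encs g') \<le> S"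
    by blast
  define W' where "W' = {u \<in> W (g @ lz @ ly). dot (rev bs) (True # u)}"
  have W': "W (?v # g @ lz @ ly) = W'"
    by (simp add: W_Cons W'_def)
  have "W (g1 @ lz @ ly) = (if W' = {} then W (g @ lz @ ly) else W')"
    using W' by (cases "W' = {}") (simp_all add: g1_def)
  with g'(2) have "W (g' @ lz @ ly) = narrow (rows (length (a # w)) (Suc m) \<rho>) (W (g @ lz @ ly))"
    unfolding list.size add_Suc_right add_0_right rows.simps narrow.simps bs_def[symmetric] \<rho>'_def[symmetric]
      W'_def[symmetric] by (simp only:)
  moreover have "runs A (While 10 (Seq (Pop 10) (rowc r))) s \<rho> ((row_time S + 2) * length (a # w) + 1) (s(6 := encs g', 10 := []))"
    unfolding \<rho>(1) by (rule runs_eq[OF runs_While_step[OF _ 1 g'(1)]])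
      (use Cons.prems in \<open>auto simp: fun_eq_iff\<close>)
  ultimately show ?case using g'(3) by blast
qed

lemma runs_bits:
  assumes "s r = x" "s 2 = M" "s 4 = encs ly" "s 5 = encs lz" "s 6 = encs g" "s 13 = w"
      "s 7 = []" "s 8 = []" "s 9 = []" "s 17 = []" "s 18 = []"
    and "length (encs ly) \<le> S" "length (encs lz) \<le> S" "length (encs g) \<le> S" "length w \<le> m"
  shows "runs A (While 13 (bitsc r)) s [] ((bits_time S + 1) * length w + 1)
    (s(13 := [], 14 := map (\<lambda>i. \<exists>u\<in>W (g @ lz @ ly). u ! i) [0..<length w] @ s 14))"
  using assms
proof (induction w arbitrary: s)
  case Nil
  then show ?case by (intro runs_eq[OF runs_While_empty]) (auto simp: fun_eq_iff)
next
  case (Cons a w)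
  let ?v = "False # True # w"
  let ?b = "\<exists>u\<in>W (g @ lz @ ly). u ! length w"
  have len_v: "length ?v \<le> S" "length (enc ?v) \<le> S" "length w \<le> S"
    using Cons.prems(15) S by (auto simp: length_enc)
  have b: "W (?v # g @ lz @ ly) \<noteq> {} \<longleftrightarrow> ?b"
  proof -
    have "W (?v # g @ lz @ ly) = {u \<in> W (g @ lz @ ly). u ! length w}"
      using Cons.prems(15) by (auto simp: W_Cons W_def words_def)
    then show ?thesis by auto
  qed
  let ?s1 = "s(13 := w)"
  let ?s2 = "?s1(9 := w)"
  let ?s3 = "?s1(9 := True # w)"
  let ?s4 = "?s1(9 := ?v)"
  let ?s5 = "?s1(7 := enc ?v)"
  let ?s6 = "?s5(8 := [?b])"
  let ?s7 = "?s5(14 := ?b # s 14)"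
  let ?s8 = "?s1(14 := ?b # s 14)"
  have 1: "runs A (Pop 13) s [] 1 ?s1"
    by (rule runs_eq[OF runs_Pop]) (use Cons.prems in auto)
  have 2: "runs A (copy 13 9 17) ?s1 [] (10 * S + 2) ?s2"
    by (rule runs_eq[OF runs_copy]) (use Cons.prems len_v in auto)
  have 3: "runs A (Push 9 True) ?s2 [] 1 ?s3"
    by (rule runs_eq[OF runs_Push]) auto
  have 4: "runs A (Push 9 False) ?s3 [] 1 ?s4"
    by (rule runs_eq[OF runs_Push]) auto
  have 5: "runs A (encode 9 7) ?s4 [] (5 * S + 2) ?s5"
    by (rule runs_eq[OF runs_encode]) (use Cons.prems len_v in \<open>auto simp: fun_eq_iff\<close>)
  define vs where "vs l = (if l = 4 then ly else if l = 5 then lz else if l = 6 then g else [?v])" for l :: reg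
  have 6: "runs A (ask r [4, 5, 6, 7]) ?s5 [] (ask_time 4 S) ?s6"
    by (rule runs_eq[OF runs_ask[where vs = vs and k = 4]]) (use Cons.prems r len_v b in \<open>auto simp: vs_def fun_eq_iff\<close>)
  have 7: "runs A (mv 8 14) ?s6 [] 3 ?s7"
    by (rule runs_eq[OF runs_mv]) (use Cons.prems in \<open>auto simp: fun_eq_iff\<close>)
  have 8: "runs A (clear 7) ?s7 [] (2 * S + 1) ?s8"
    by (rule runs_eq[OF runs_clear]) (use Cons.prems len_v in \<open>auto simp: fun_eq_iff\<close>)
  have body: "runs A (bitsc r) s []
    (1 + ((10 * S + 2) + (1 + (1 + ((5 * S + 2) + (ask_time 4 S + (3 + ((2 * S + 1) + 1)))))))) ?s8"
    unfolding bitsc_def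
    by (intro runs_seqs_Cons[OF 1] runs_seqs_Cons[OF 2] runs_seqs_Cons[OF 3] runs_seqs_Cons[OF 4]
      runs_seqs_Cons[OF 5] runs_seqs_Cons[OF 6] runs_seqs_Cons[OF 7] runs_seqs_Cons[OF 8] runs_seqs_Nil)
  have rest: "runs A (While 13 (bitsc r)) ?s8 [] ((bits_time S + 1) * length w + 1)
    (?s8(13 := [], 14 := map (\<lambda>i. \<exists>u\<in>W (g @ lz @ ly). u ! i) [0..<length w] @ ?s8 14))"
    by (rule Cons.IH) (use Cons.prems r in auto)
  show ?case
    by (rule runs_eq[OF runs_While_step0[OF _ body rest]])
      (use Cons.prems in \<open>auto simp: fun_eq_iff bits_time_def\<close>)
qed

end

context game
begin

lemma runs_roundc:
  assumes s: "s r = x" "s 2 = M" "s 4 = encs ly" "s 5 = encs lz" "\<And>i. i \<in> {6..11} \<union> {13..18} \<Longrightarrow> s i = []"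
    and len: "length (encs ly) \<le> S" "length (encs lz) \<le> S" "Suc m * (2 * m + 5) \<le> S"
    and \<rho>: "length \<rho> = Suc m * Suc m"
  defines "u \<equiv> pick m (W (lz @ ly)) (rows (Suc m) (Suc m) \<rho>)"
  shows "runs A (roundc r) s \<rho> (round_time S)
    (s(4 := encs ((False # False # True # od u) # ly), 5 := encs ((False # False # False # ev u) # lz)))"
proof -
  have t [simp]: "s 6 = []" "s 7 = []" "s 8 = []" "s 9 = []" "s 10 = []" "s 11 = []" "s 13 = []"
    "s 14 = []" "s 15 = []" "s 16 = []" "s 17 = []" "s 18 = []"
    by (rule s; simp)+
  have 1: "runs A (seqs [copy 2 10 17, Push 10 True]) s [] (10 * S + 4) (s(10 := True # M))"
    by (rule runs_eq[OF runs_seqs_Cons[OF runs_copy runs_seqs_Cons[OF runs_Push runs_seqs_Nil]]])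
      (use s S r in auto)
  have "\<exists>g. runs A (While 10 (Seq (Pop 10) (rowc r))) (s(10 := True # M)) \<rho> ((row_time S + 2) * length (True # M) + 1)
      ((s(10 := True # M))(6 := encs g, 10 := []))
    \<and> W (g @ lz @ ly) = narrow (rows (length (True # M)) (Suc m) \<rho>) (W ([] @ lz @ ly))
    \<and> length (encs g) \<le> S"
    by (rule runs_rowsc) (use s len \<rho> r in \<open>simp_all add: algebra_simps\<close>)
  then obtain g where g: "runs A (While 10 (Seq (Pop 10) (rowc r))) (s(10 := True # M)) \<rho> ((row_time S + 2) * length (True # M) + 1)
      ((s(10 := True # M))(6 := encs g, 10 := []))"
    "W (g @ lz @ ly) = narrow (rows (Suc m) (Suc m) \<rho>) (W (lz @ ly))" "length (encs g) \<le> S"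
    by auto
  have u: "u = map (\<lambda>i. \<exists>u\<in>W (g @ lz @ ly). u ! i) [0..<m]"
    unfolding u_def pick_def g(2) ..
  then have lu: "length u = m" by simp
  let ?s = "s(6 := encs g)"
  have 2: "runs A (While 10 (Seq (Pop 10) (rowc r))) (s(10 := True # M)) \<rho> ((row_time S + 2) * S + 1) ?s"
  proof (rule runs_eq[OF g(1)])
    show "(row_time S + 2) * length (True # M) + 1 \<le> (row_time S + 2) * S + 1"
      by (intro add_le_mono1 mult_le_mono2) (use S in simp)
  qed (auto simp: fun_eq_iff)
  have 3: "runs A (copy 2 13 17) ?s [] (10 * S + 2) (?s(13 := M))"
    by (rule runs_eq[OF runs_copy]) (use s S r in auto)
  have "(bits_time S + 1) * m + 1 \<le> (bits_time S + 1) * S + 1"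
    by (intro add_le_mono1 mult_le_mono2) (use S in simp)
  then have 4: "runs A (While 13 (bitsc r)) (?s(13 := M)) [] ((bits_time S + 1) * S + 1) (?s(14 := u))"
    by (intro runs_eq[OF runs_bits[where g = g and ly = ly and lz = lz and w = M]])
      (use s len S r g(3) in \<open>auto simp: u fun_eq_iff\<close>)
  have 5: "runs A (dealc 14 15 16) (?s(14 := u)) [] (7 * S + 1) (?s(15 := ev u, 16 := od u))"
    by (rule runs_eq[OF runs_dealc]) (use S lu in \<open>auto simp: fun_eq_iff ev_def od_def\<close>)
  have 6: "runs A (Push 16 True) (?s(15 := ev u, 16 := od u)) [] 1 (?s(15 := ev u, 16 := True # od u))"
    by (rule runs_eq[OF runs_Push]) auto
  have 7: "runs A (Push 16 False) (?s(15 := ev u, 16 := True # od u)) [] 1 (?s(15 := ev u, 16 := False # True # od u))"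
    by (rule runs_eq[OF runs_Push]) auto
  have 8: "runs A (Push 16 False) (?s(15 := ev u, 16 := False # True # od u)) [] 1
      (?s(15 := ev u, 16 := False # False # True # od u))"
    by (rule runs_eq[OF runs_Push]) auto
  let ?s1 = "?s(4 := encs ((False # False # True # od u) # ly))"
  have 9: "runs A (encode 16 4) (?s(15 := ev u, 16 := False # False # True # od u)) [] (5 * S + 20) (?s1(15 := ev u))"
    by (rule runs_eq[OF runs_encode])
      (use s S lu length_od_le[of u] in \<open>auto simp: fun_eq_iff\<close>)
  have 10: "runs A (Push 15 False) (?s1(15 := ev u)) [] 1 (?s1(15 := False # ev u))"
    by (rule runs_eq[OF runs_Push]) auto
  have 11: "runs A (Push 15 False) (?s1(15 := False # ev u)) [] 1 (?s1(15 := False # False # ev u))"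
    by (rule runs_eq[OF runs_Push]) auto
  have 12: "runs A (Push 15 False) (?s1(15 := False # False # ev u)) [] 1 (?s1(15 := False # False # False # ev u))"
    by (rule runs_eq[OF runs_Push]) auto
  let ?s2 = "?s1(5 := encs ((False # False # False # ev u) # lz))"
  have 13: "runs A (encode 15 5) (?s1(15 := False # False # False # ev u)) [] (5 * S + 20) ?s2"
    by (rule runs_eq[OF runs_encode])
      (use s S lu length_ev_le[of u] in \<open>auto simp: fun_eq_iff\<close>)
  let ?s3 = "s(4 := encs ((False # False # True # od u) # ly), 5 := encs ((False # False # False # ev u) # lz))"
  have 14: "runs A (clear 6) ?s2 [] (2 * S + 1) ?s3"
    by (rule runs_eq[OF runs_clear]) (use g(3) in \<open>auto simp: fun_eq_iff\<close>)
  have 15: "runs A (seqs [copy 2 13 17, While 13 (bitsc r), dealc 14 15 16, Push 16 True, Push 16 False, Push 16 False, encode 16 4,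
        Push 15 False, Push 15 False, Push 15 False, encode 15 5, clear 6]) ?s []
      ((10 * S + 2) + (((bits_time S + 1) * S + 1) + ((7 * S + 1) + (1 + (1 + (1 + ((5 * S + 20) +
      (1 + (1 + (1 + ((5 * S + 20) + ((2 * S + 1) + 1)))))))))))) ?s3"
    by (intro runs_seqs_Cons[OF 3] runs_seqs_Cons[OF 4] runs_seqs_Cons[OF 5] runs_seqs_Cons[OF 6]
      runs_seqs_Cons[OF 7] runs_seqs_Cons[OF 8] runs_seqs_Cons[OF 9] runs_seqs_Cons[OF 10]
      runs_seqs_Cons[OF 11] runs_seqs_Cons[OF 12] runs_seqs_Cons[OF 13] runs_seqs_Cons[OF 14] runs_seqs_Nil)
  from runs_Seq[OF 1 runs_Seq[OF 2 15]] show ?thesis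
    unfolding roundc_def append_Nil append_Nil2 by (rule runs_eq) (auto simp: round_time_def)
qed

lemma W_refine:
  "W (((False # False # False # ev u) # lz) @ ((False # False # True # od u) # ly)) =
   refine (\<lambda>a b. G x (ev a) (od b)) (W (lz @ ly)) u"
  by (auto simp: W_def refine_def)

text \<open>A recorded move has \<open>l\<close> bits and three tag bits, so its code has
  \<open>2 * (l + 3) + 1 = m + 7\<close> bits. It is a legal move of length \<open>l\<close> even if
  the isolation failed, and the final certificate rests on nothing else.\<close>

lemma runs_rounds:
  assumes m: "m = 2 * l"
  shows "s r = x \<Longrightarrow> s 2 = M \<Longrightarrow> s 4 = encs ly \<Longrightarrow> s 5 = encs lz \<Longrightarrow> s 12 = w \<Longrightarrow>
    (\<And>i. i \<in> {6..11} \<union> {13..18} \<Longrightarrow> s i = []) \<Longrightarrow>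
    length (encs ly) + length w * (m + 7) \<le> S \<Longrightarrow> length (encs lz) + length w * (m + 7) \<le> S \<Longrightarrow>
    Suc m * (2 * m + 5) \<le> S \<Longrightarrow> length \<rho> = length w * (Suc m * Suc m) \<Longrightarrow>
    set ly \<subseteq> (\<lambda>z. False # False # True # z) ` words l \<Longrightarrow>
    set lz \<subseteq> (\<lambda>y. False # False # False # y) ` words l \<Longrightarrow>
    \<exists>ly' lz'. runs A (While 12 (Seq (Pop 12) (roundc r))) s \<rho> ((round_time S + 2) * length w + 1)
      (s(4 := encs ly', 5 := encs lz', 12 := []))
    \<and> W (lz' @ ly') = survivors (\<lambda>a b. G x (ev a) (od b)) m (length w) (W (lz @ ly)) \<rho>
    \<and> set ly' \<subseteq> (\<lambda>z. False # False # True # z) ` words l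
    \<and> set lz' \<subseteq> (\<lambda>y. False # False # False # y) ` words l
    \<and> length (encs ly') \<le> S \<and> length (encs lz') \<le> S"
proof (induction w arbitrary: s ly lz \<rho>)
  case Nil
  have \<rho>: "\<rho> = []" using Nil.prems(10) by simp
  show ?case
  proof (rule exI[of _ ly], rule exI[of _ lz], intro conjI)
    show "runs A (While 12 (Seq (Pop 12) (roundc r))) s \<rho> ((round_time S + 2) * length [] + 1)
      (s(4 := encs ly, 5 := encs lz, 12 := []))"
      unfolding \<rho> by (rule runs_eq[OF runs_While_empty]) (use Nil.prems(3-5) in \<open>auto simp: fun_eq_iff\<close>)
  qed (use Nil.prems in auto)
next
  case (Cons a w)
  define N where "N = Suc m * Suc m"
  define bs where "bs = take N \<rho>"
  define \<rho>' where "\<rho>' = drop N \<rho>"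
  have \<rho>: "\<rho> = bs @ \<rho>'" "length bs = Suc m * Suc m" "length \<rho>' = length w * (Suc m * Suc m)"
    using Cons.prems(10) by (auto simp: bs_def \<rho>'_def N_def)
  define u where "u = pick m (W (lz @ ly)) (rows (Suc m) (Suc m) bs)"
  have "u \<in> words (2 * l)" by (simp add: u_def pick_def words_def m)
  then have evod: "ev u \<in> words l" "od u \<in> words l" using length_ev_od by blast+
  define ly1 where "ly1 = (False # False # True # od u) # ly"
  define lz1 where "lz1 = (False # False # False # ev u) # lz"
  have len1: "length (encs ly1) + length w * (m + 7) \<le> S" "length (encs lz1) + length w * (m + 7) \<le> S"
    using Cons.prems(7,8) evod by (simp_all add: ly1_def lz1_def length_enc words_def m)
  let ?s = "s(12 := w, 4 := encs ly1, 5 := encs lz1)"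
  have "runs A (roundc r) (s(12 := w)) bs (round_time S) ?s"
    unfolding ly1_def lz1_def u_def
    by (rule runs_roundc) (use Cons.prems \<rho> r in auto)
  then have 1: "runs A (Seq (Pop 12) (roundc r)) s bs (1 + (round_time S)) ?s"
    by (intro runs_Seq_eq[OF runs_Pop, where bs' = bs]) (use Cons.prems in auto)
  have IH: "\<exists>ly' lz'. runs A (While 12 (Seq (Pop 12) (roundc r))) ?s \<rho>' ((round_time S + 2) * length w + 1)
      (?s(4 := encs ly', 5 := encs lz', 12 := []))
    \<and> W (lz' @ ly') = survivors (\<lambda>a b. G x (ev a) (od b)) m (length w) (W (lz1 @ ly1)) \<rho>'
    \<and> set ly' \<subseteq> (\<lambda>z. False # False # True # z) ` words l
    \<and> set lz' \<subseteq> (\<lambda>y. False # False # False # y) ` words l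
    \<and> length (encs ly') \<le> S \<and> length (encs lz') \<le> S"
  proof (rule Cons.IH)
    show "set ly1 \<subseteq> (\<lambda>z. False # False # True # z) ` words l"
      "set lz1 \<subseteq> (\<lambda>y. False # False # False # y) ` words l"
      using Cons.prems(11,12) evod by (auto simp: ly1_def lz1_def)
  qed (use Cons.prems(1,2,6,9) len1 \<rho>(3) r in auto)
  then obtain ly' lz' where *: "runs A (While 12 (Seq (Pop 12) (roundc r))) ?s \<rho>' ((round_time S + 2) * length w + 1)
      (?s(4 := encs ly', 5 := encs lz', 12 := []))"
    "W (lz' @ ly') = survivors (\<lambda>a b. G x (ev a) (od b)) m (length w) (W (lz1 @ ly1)) \<rho>'"
    "set ly' \<subseteq> (\<lambda>z. False # False # True # z) ` words l"
    "set lz' \<subseteq> (\<lambda>y. False # False # False # y) ` words l"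
    "length (encs ly') \<le> S" "length (encs lz') \<le> S" by blast
  have "W (lz1 @ ly1) = refine (\<lambda>a b. G x (ev a) (od b)) (W (lz @ ly)) u"
    unfolding ly1_def lz1_def by (rule W_refine)
  with *(2) have "W (lz' @ ly') = survivors (\<lambda>a b. G x (ev a) (od b)) m (length (a # w)) (W (lz @ ly)) \<rho>"
    by (simp only: list.size add_Suc_right add_0_right survivors.simps u_def bs_def \<rho>'_def N_def)
  moreover have "runs A (While 12 (Seq (Pop 12) (roundc r))) s \<rho> ((round_time S + 2) * length (a # w) + 1)
      (s(4 := encs ly', 5 := encs lz', 12 := []))"
    unfolding \<rho>(1) by (rule runs_eq[OF runs_While_step[OF _ 1 *(1)]])
      (use Cons.prems(5) in \<open>auto simp: fun_eq_iff\<close>)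
  ultimately show ?case using *(3-6) by blast
qed

lemma runs_count:
  "s 2 = M \<Longrightarrow> s 17 = [] \<Longrightarrow> \<exists>w. length w = k * Suc m + length (s 12) \<and>
    runs A (seqs (replicate k (seqs [copy 2 12 17, Push 12 True]))) s [] (k * (10 * S + 4) + 1) (s(12 := w))"
proof (induction k arbitrary: s)
  case 0
  have "runs A (seqs (replicate 0 (seqs [copy 2 12 17, Push 12 True]))) s [] (0 * (10 * S + 4) + 1) (s(12 := s 12))"
    unfolding replicate.simps by (rule runs_eq[OF runs_seqs_Nil]) auto
  then show ?case by (intro exI[of _ "s 12"] conjI) simp_all
next
  case (Suc k)
  let ?s = "s(12 := True # M @ s 12)"
  have 1: "runs A (seqs [copy 2 12 17, Push 12 True]) s [] (10 * S + 4) ?s"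
    by (rule runs_eq[OF runs_seqs_Cons[OF runs_copy runs_seqs_Cons[OF runs_Push runs_seqs_Nil]]])
      (use Suc.prems S in auto)
  have "\<exists>w. length w = k * Suc m + length (?s 12) \<and>
    runs A (seqs (replicate k (seqs [copy 2 12 17, Push 12 True]))) ?s [] (k * (10 * S + 4) + 1) (?s(12 := w))"
    by (rule Suc.IH) (use Suc.prems in auto)
  then obtain w where w: "length w = k * Suc m + length (?s 12)"
    "runs A (seqs (replicate k (seqs [copy 2 12 17, Push 12 True]))) ?s [] (k * (10 * S + 4) + 1) (?s(12 := w))"
    by blast
  have "runs A (seqs (replicate (Suc k) (seqs [copy 2 12 17, Push 12 True]))) s [] (Suc k * (10 * S + 4) + 1) (s(12 := w))"
    unfolding replicate.simps by (rule runs_eq[OF runs_seqs_Cons[OF 1 w(2)]]) auto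
  moreover have "length w = Suc k * Suc m + length (s 12)" using w(1) by simp
  ultimately show ?case by blast
qed

text \<open>A winning move beats every recorded move, so the winner's list always stays satisfiable
  and a negative answer can only name the loser, whatever the coins. Without a negative answer all
  stacks are restored for the next attempt.\<close>

lemma runs_attempt:
  assumes m: "m = 2 * l"
    and win1: "b \<Longrightarrow> \<exists>y\<in>words l. \<forall>z\<in>words l. G x y z"
    and win2: "\<not> b \<Longrightarrow> \<exists>z\<in>words l. \<forall>y\<in>words l. \<not> G x y z"
    and s: "s r = x" "s 2 = M" "s 3 = [True]" "\<And>i. i \<in> {4..19} \<Longrightarrow> s i = []"
    and len: "11 * Suc m * (2 * m + 7) \<le> S"
    and \<rho>: "length \<rho> = 11 * Suc m * (Suc m * Suc m)"
  shows "runs A (attempt r) s \<rho> (attempt_time S) (s(3 := [], 19 := [b])) \<or>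
    runs A (attempt r) s \<rho> (attempt_time S) s \<and> survivors (\<lambda>a b. G x (ev a) (od b)) m (11 * Suc m) (words m) \<rho> \<noteq> {}"
proof -
  have t [simp]: "s 4 = []" "s 5 = []" "s 6 = []" "s 7 = []" "s 8 = []" "s 9 = []" "s 10 = []" "s 11 = []"
    "s 12 = []" "s 13 = []" "s 14 = []" "s 15 = []" "s 16 = []" "s 17 = []" "s 18 = []" "s 19 = []"
    by (rule s; simp)+
  from runs_count[of s 11] s(2) obtain w where w: "length w = 11 * Suc m"
    "runs A (seqs (replicate 11 (seqs [copy 2 12 17, Push 12 True]))) s [] (11 * (10 * S + 4) + 1) (s(12 := w))"
    by auto
  have len2: "length w * (m + 7) \<le> S" "Suc m * (2 * m + 5) \<le> S" "length w \<le> S"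
    using len order_trans[OF mult_le_mono2[of "m + 7" "2 * m + 7" "11 * Suc m"] len]
      order_trans[OF mult_le_mono[of "Suc m" "11 * Suc m" "2 * m + 5" "2 * m + 7"] len]
      order_trans[OF mult_le_mono2[of 1 "2 * m + 7" "11 * Suc m"] len]
    by (simp_all add: w(1))
  have "\<exists>ly lz. runs A (While 12 (Seq (Pop 12) (roundc r))) (s(12 := w)) \<rho> ((round_time S + 2) * length w + 1)
      ((s(12 := w))(4 := encs ly, 5 := encs lz, 12 := []))
    \<and> W (lz @ ly) = survivors (\<lambda>a b. G x (ev a) (od b)) m (length w) (W ([] @ [])) \<rho>
    \<and> set ly \<subseteq> (\<lambda>z. False # False # True # z) ` words l
    \<and> set lz \<subseteq> (\<lambda>y. False # False # False # y) ` words l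
    \<and> length (encs ly) \<le> S \<and> length (encs lz) \<le> S"
    by (rule runs_rounds[OF m]) (use s r len2 \<rho> w(1) in auto)
  then obtain ly lz where *: "runs A (While 12 (Seq (Pop 12) (roundc r))) (s(12 := w)) \<rho> ((round_time S + 2) * length w + 1)
      ((s(12 := w))(4 := encs ly, 5 := encs lz, 12 := []))"
    "W (lz @ ly) = survivors (\<lambda>a b. G x (ev a) (od b)) m (length w) (W ([] @ [])) \<rho>"
    "set ly \<subseteq> (\<lambda>z. False # False # True # z) ` words l"
    "set lz \<subseteq> (\<lambda>y. False # False # False # y) ` words l"
    "length (encs ly) \<le> S" "length (encs lz) \<le> S" by blast
  have ly: "W ly = {u \<in> words m. \<forall>z. False # False # True # z \<in> set ly \<longrightarrow> G x (ev u) z}"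
    using *(3) by (auto simp: W_def)
  have lz: "W lz = {u \<in> words m. \<forall>y. False # False # False # y \<in> set lz \<longrightarrow> \<not> G x y (od u)}"
    using *(4) by (auto simp: W_def)
  have "W ly \<noteq> {}" if b
  proof -
    from win1[OF that] obtain y where y: "y \<in> words l" "\<forall>z\<in>words l. G x y z" by blast
    obtain u where "u \<in> words m" "ev u = y" using ev_od_surj[OF y(1) y(1)] by (auto simp: m)
    then have "u \<in> W ly" using y(2) *(3) by (auto simp: ly)
    then show ?thesis by blast
  qed
  moreover have "W lz \<noteq> {}" if "\<not> b"
  proof -
    from win2[OF that] obtain z where z: "z \<in> words l" "\<forall>y\<in>words l. \<not> G x y z" by blast
    obtain u where "u \<in> words m" "od u = z" using ev_od_surj[OF z(1) z(1)] by (auto simp: m)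
    then have "u \<in> W lz" using z(2) *(4) by (auto simp: lz)
    then show ?thesis by blast
  qed
  \<comment> \<open>The constraints in \<open>ly\<close> look only at \<open>ev\<close> and those in
    \<open>lz\<close> only at \<open>od\<close>, so halves of two different candidates can be
    combined.\<close>
  moreover have surv: "W (lz @ ly) \<noteq> {}" if "W ly \<noteq> {}" "W lz \<noteq> {}"
  proof -
    from that obtain u1 u2 where u: "u1 \<in> W ly" "u2 \<in> W lz" by blast
    then have "ev u1 \<in> words l" "od u2 \<in> words l"
      using length_ev_od[of _ l] by (auto simp: W_def m)
    from ev_od_surj[OF this] obtain u where "u \<in> words m" "ev u = ev u1" "od u = od u2"
      by (auto simp: m)
    then have "u \<in> W ly" "u \<in> W lz" using u by (auto simp: ly lz)
    then have "u \<in> W (lz @ ly)" by (auto simp: W_def)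
    then show ?thesis by blast
  qed
  ultimately have b: "W ly = {} \<Longrightarrow> \<not> b \<and> W lz \<noteq> {}" "W lz = {} \<Longrightarrow> b \<and> W ly \<noteq> {}" by auto
  define s1 where "s1 = s(4 := encs ly, 5 := encs lz)"
  have s1: "s1 r = x" "s1 2 = M" "s1 3 = [True]" "s1 8 = []" "s1 17 = []" "s1 18 = []" "s1 19 = []"
    "s1 4 = encs ly" "s1 5 = encs lz"
    using s r by (auto simp: s1_def)
  have 2: "runs A (While 12 (Seq (Pop 12) (roundc r))) (s(12 := w)) \<rho> ((round_time S + 2) * S + 1) s1"
  proof (rule runs_eq[OF *(1)])
    show "(round_time S + 2) * length w + 1 \<le> (round_time S + 2) * S + 1"
      by (intro add_le_mono1 mult_le_mono2 len2)
  qed (auto simp: fun_eq_iff s1_def)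
  have sb: "(u(8 := [p])) 8 = [p]" for u :: state and p by simp
  define s2 where "s2 = (if W ly = {} then s1(3 := [], 19 := [False]) else s1)"
  define s3 where "s3 = (if W lz = {} then s2(3 := [], 19 := [True]) else s2)"
  have s2: "s2 r = x" "s2 2 = M" "s2 8 = []" "s2 17 = []" "s2 18 = []"
    "s2 4 = encs ly" "s2 5 = encs lz" "W lz = {} \<Longrightarrow> s2 = s1"
    using s1 r b by (auto simp: s2_def)
  have s3: "s3 8 = []" "s3 4 = encs ly" "s3 5 = encs lz"
    using s2 by (auto simp: s3_def)
  have 3: "runs A (ask r [4]) s1 [] (ask_time 1 S) (s1(8 := [W ly \<noteq> {}]))"
    by (rule runs_eq[OF runs_ask[where k = 1 and vs = "\<lambda>_. ly"]]) (use s1 * in \<open>auto simp: fun_eq_iff\<close>)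
  have dec: "runs A (seqs [Push 19 p, clear 3]) u [] 5 (u(3 := [], 19 := [p]))"
    if "u 3 = [True]" "u 19 = []" for u p
    by (rule runs_eq[OF runs_seqs_Cons[OF runs_Push runs_seqs_Cons[OF runs_clear runs_seqs_Nil]]])
      (use that in \<open>auto simp: fun_eq_iff\<close>)
  have 4: "runs A (Branch 8 Skip (seqs [Push 19 False, clear 3]) Skip) (s1(8 := [W ly \<noteq> {}])) [] (Suc 5)
    (s2(8 := [W ly \<noteq> {}]))"
  proof (rule runs_Branch)
    have "runs A (seqs [Push 19 False, clear 3]) (s1(8 := [W ly \<noteq> {}])) [] 5 (s2(8 := [W ly \<noteq> {}]))" if "W ly = {}"
      by (rule runs_eq[OF dec]) (use that s1 in \<open>auto simp: s2_def fun_eq_iff\<close>)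
    moreover have "runs A Skip (s1(8 := [W ly \<noteq> {}])) [] 5 (s2(8 := [W ly \<noteq> {}]))" if "W ly \<noteq> {}"
      by (rule runs_eq[OF runs_Skip]) (use that s1 in \<open>auto simp: s2_def fun_eq_iff\<close>)
    ultimately show "runs A (case (s1(8 := [W ly \<noteq> {}])) 8 of [] \<Rightarrow> Skip |
        b # _ \<Rightarrow> if b then Skip else seqs [Push 19 False, clear 3]) (s1(8 := [W ly \<noteq> {}])) [] 5 (s2(8 := [W ly \<noteq> {}]))"
      unfolding sb by (cases "W ly = {}") (simp_all only: list.case if_True if_False simp_thms)
  qed
  have 5: "runs A (clear 8) (s2(8 := [W ly \<noteq> {}])) [] 3 s2"
    by (rule runs_eq[OF runs_clear]) (use s2 in \<open>auto simp: fun_eq_iff\<close>)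
  have 6: "runs A (ask r [5]) s2 [] (ask_time 1 S) (s2(8 := [W lz \<noteq> {}]))"
    by (rule runs_eq[OF runs_ask[where k = 1 and vs = "\<lambda>_. lz"]]) (use s2 * in \<open>auto simp: fun_eq_iff\<close>)
  have 7: "runs A (Branch 8 Skip (seqs [Push 19 True, clear 3]) Skip) (s2(8 := [W lz \<noteq> {}])) [] (Suc 5)
    (s3(8 := [W lz \<noteq> {}]))"
  proof (rule runs_Branch)
    have "runs A (seqs [Push 19 True, clear 3]) (s2(8 := [W lz \<noteq> {}])) [] 5 (s3(8 := [W lz \<noteq> {}]))" if "W lz = {}"
      by (rule runs_eq[OF dec]) (use that s1 s2(8) in \<open>auto simp: s3_def fun_eq_iff\<close>)
    moreover have "runs A Skip (s2(8 := [W lz \<noteq> {}])) [] 5 (s3(8 := [W lz \<noteq> {}]))" if "W lz \<noteq> {}"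
      by (rule runs_eq[OF runs_Skip]) (use that in \<open>auto simp: s3_def fun_eq_iff\<close>)
    ultimately show "runs A (case (s2(8 := [W lz \<noteq> {}])) 8 of [] \<Rightarrow> Skip |
        b # _ \<Rightarrow> if b then Skip else seqs [Push 19 True, clear 3]) (s2(8 := [W lz \<noteq> {}])) [] 5 (s3(8 := [W lz \<noteq> {}]))"
      unfolding sb by (cases "W lz = {}") (simp_all only: list.case if_True if_False simp_thms)
  qed
  have 8: "runs A (clear 8) (s3(8 := [W lz \<noteq> {}])) [] 3 s3"
    by (rule runs_eq[OF runs_clear]) (use s3 in \<open>auto simp: fun_eq_iff\<close>)
  have 9: "runs A (clear 4) s3 [] (2 * S + 1) (s3(4 := []))"
    by (rule runs_eq[OF runs_clear]) (use s3 * in auto)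
  have 10: "runs A (clear 5) (s3(4 := [])) [] (2 * S + 1) (s3(4 := [], 5 := []))"
    by (rule runs_eq[OF runs_clear]) (use s3 * in auto)
  have 11: "runs A (seqs [ask r [4], Branch 8 Skip (seqs [Push 19 False, clear 3]) Skip, clear 8,
              ask r [5], Branch 8 Skip (seqs [Push 19 True, clear 3]) Skip, clear 8, clear 4, clear 5]) s1 []
    (ask_time 1 S + (Suc 5 + (3 + (ask_time 1 S + (Suc 5 + (3 + ((2 * S + 1) + ((2 * S + 1) + 1)))))))) (s3(4 := [], 5 := []))"
    by (intro runs_seqs_Cons[OF 3] runs_seqs_Cons[OF 4] runs_seqs_Cons[OF 5] runs_seqs_Cons[OF 6]
      runs_seqs_Cons[OF 7] runs_seqs_Cons[OF 8] runs_seqs_Cons[OF 9] runs_seqs_Cons[OF 10] runs_seqs_Nil)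
  from runs_Seq[OF w(2) runs_Seq[OF 2 11]] have att: "runs A (attempt r) s \<rho> (attempt_time S) (s3(4 := [], 5 := []))"
    unfolding attempt_def append_Nil append_Nil2 by (rule runs_eq) (auto simp: attempt_time_def)
  show ?thesis
  proof (cases "W ly = {} \<or> W lz = {}")
    case True
    then have "s3(4 := [], 5 := []) = s(3 := [], 19 := [b])"
      using b by (auto simp: s3_def s2_def s1_def fun_eq_iff)
    with att show ?thesis by (simp only: simp_thms)
  next
    case False
    then have "s3(4 := [], 5 := []) = s"
      by (auto simp: s3_def s2_def s1_def fun_eq_iff)
    moreover have "W ([] @ []) = words m" by (auto simp: W_def)
    then have "survivors (\<lambda>a b. G x (ev a) (od b)) m (11 * Suc m) (words m) \<rho> \<noteq> {}"
      using surv False *(2) w(1) by metis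
    ultimately show ?thesis using att by (simp only: simp_thms)
  qed
qed

end

section \<open>Cai's theorem in the form of a subroutine\<close>

definition cai :: "nat poly \<Rightarrow> reg \<Rightarrow> com" where
  "cai q r = Seq (seqs [polyc r 2 20 21 (coeffs (q + q)), Push 3 True])
     (Seq (While 3 (attempt r)) (seqs [clear 2, clear r, mv 19 r]))"

text \<open>The net effect is that of \<open>Query r\<close> with oracle \<open>L\<close>: the stack
  is replaced by the answer and all scratch stacks are left empty. Candidates hold two moves, whence
  \<open>q + q\<close>.\<close>

lemma las_vegas_cai:
  assumes L: "S2P_defines G q L"
  shows "\<exists>e. \<forall>r s. 30 \<le> r \<longrightarrow> (\<forall>i<30. s i = []) \<longrightarrow>
    las_vegas (query_language (sat G)) (cai q r) s (poly e (length (s r))) (s(r := [s r \<in> L]))"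
proof -
  let ?A = "query_language (sat G)"
  obtain p where p: "\<And>r A s. distinct [r, 2, 20, 21] \<Longrightarrow> s 2 = [] \<Longrightarrow> s 20 = [] \<Longrightarrow> s 21 = [] \<Longrightarrow>
    runs A (polyc r 2 20 21 (coeffs (q + q))) s [] (poly p (length (s r))) (s(2 := poly_word (coeffs (q + q)) (s r)))"
    using runs_polyc[of 2 20 21 "coeffs (q + q)"] by blast
  define mm where "mm n = poly (q + q) n" for n
  \<comment> \<open>The product pays for \<open>11 * Suc m\<close> rounds, with
    \<open>2 * m + 7\<close> bounding both the \<open>m + 7\<close> bits of a recorded move and the
    \<open>2 * m + 5\<close> bits of a parity.\<close>
  define SS where "SS n = n + 11 * Suc (mm n) * (2 * mm n + 7) + 2 * mm n + 10" for n
  define E where "E n = (poly p n + (1 + 1)) + ((2 * (attempt_time (SS n) + 1) + 1) +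
    ((2 * mm n + 1) + ((2 * n + 1) + (3 + 1))))" for n
  have "poly_bounded E"
    unfolding E_def SS_def mm_def attempt_time_def round_time_def row_time_def bits_time_def ask_time_def
    by (intro poly_bounded_add poly_bounded_mult poly_bounded_comp poly_bounded_Suc poly_bounded_const poly_bounded_id)
  then obtain e where e: "\<And>n. E n \<le> poly e n" unfolding poly_bounded_def by blast
  have main: "las_vegas ?A (cai q r) s (E (length (s r))) (s(r := [s r \<in> L]))"
    if r: "30 \<le> r" and s: "\<forall>i<30. s i = []" for r s
  proof -
    define x where "x = s r"
    define n where "n = length x"
    define l where "l = poly q n"
    define M where "M = poly_word (coeffs (q + q)) x"
    define S where "S = SS n"
    define b where "b \<longleftrightarrow> x \<in> L"
    have M: "length M = mm n" "length M = 2 * l"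
      by (simp_all only: M_def length_poly_word mm_def n_def l_def poly_add mult_2)
    interpret game ?A x M G r S
      by unfold_locales (auto simp: query_in_query_language r S_def SS_def n_def M)
    define s1 where "s1 = s(2 := M, 3 := [True])"
    define s2 where "s2 = s1(3 := [], 19 := [b])"
    have 1: "runs ?A (polyc r 2 20 21 (coeffs (q + q))) s [] (poly p n) (s(2 := M))"
      unfolding n_def x_def M_def by (rule p) (use r s in auto)
    have 2: "runs ?A (Push 3 True) (s(2 := M)) [] 1 s1"
      by (rule runs_eq[OF runs_Push]) (use s in \<open>auto simp: s1_def\<close>)
    have pre: "las_vegas ?A (seqs [polyc r 2 20 21 (coeffs (q + q)), Push 3 True]) s (poly p n + (1 + 1)) s1"
      by (rule las_vegas_runs, intro runs_seqs_Cons[OF 1] runs_seqs_Cons[OF 2] runs_seqs_Nil)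
    define N where "N = 11 * Suc m * (Suc m * Suc m)"
    \<comment> \<open>Goodness is defined by the outcome, as the loop rule wants it; the survivors
      enter only when good coin words are counted.\<close>
    define good where "good \<rho> \<longleftrightarrow> runs ?A (attempt r) s1 \<rho> (attempt_time S) s2" for \<rho>
    have att: "good \<rho> \<or> runs ?A (attempt r) s1 \<rho> (attempt_time S) s1 \<and>
        survivors (\<lambda>a b. G x (ev a) (od b)) m (11 * Suc m) (words m) \<rho> \<noteq> {}" if "\<rho> \<in> words N" for \<rho>
      unfolding good_def s2_def
    proof (rule runs_attempt[OF M(2)])
      show "\<exists>y\<in>words l. \<forall>z\<in>words l. G x y z" if b
        using L that by (auto simp: S2P_defines_def b_def l_def n_def)
      show "\<exists>z\<in>words l. \<forall>y\<in>words l. \<not> G x y z" if "\<not> b"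
        using L that by (auto simp: S2P_defines_def b_def l_def n_def)
      show "11 * Suc m * (2 * m + 7) \<le> S" unfolding S_def SS_def M(1) by simp
      show "length \<rho> = 11 * Suc m * (Suc m * Suc m)" using that by (simp add: N_def words_def)
    qed (use r s in \<open>auto simp: s1_def x_def\<close>)
    have loop: "las_vegas ?A (While 3 (attempt r)) s1 (2 * (attempt_time S + 1) + 1) s2"
    proof (rule las_vegas_loop[where N = N and good = good])
      show "runs ?A (attempt r) s1 bs (attempt_time S) (if good bs then s2 else s1)" if "bs \<in> words N" for bs
        using att[OF that] by (auto simp: good_def)
      have "{\<rho> \<in> words N. survivors (\<lambda>a b. G x (ev a) (od b)) m (11 * Suc m) (words m) \<rho> = {}} \<subseteq> {\<rho> \<in> words N. good \<rho>}"
        using att by blast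
      then have "card {\<rho> \<in> words N. survivors (\<lambda>a b. G x (ev a) (od b)) m (11 * Suc m) (words m) \<rho> = {}}
          \<le> card {\<rho> \<in> words N. good \<rho>}"
        by (intro card_mono) simp_all
      with survivors_empty[of m "\<lambda>a b. G x (ev a) (od b)"] show "2 ^ N \<le> 2 * card {bs \<in> words N. good bs}"
        unfolding N_def by linarith
      show "s1 3 \<noteq> []" "s2 3 = []" by (simp_all add: s1_def s2_def)
    qed
    define s3 where "s3 = s2(2 := [])"
    define s4 where "s4 = s3(r := [])"
    have 3: "runs ?A (clear 2) s2 [] (2 * mm n + 1) s3"
      by (rule runs_eq[OF runs_clear]) (simp_all add: s3_def s2_def s1_def M)
    have 4: "runs ?A (clear r) s3 [] (2 * n + 1) s4"
      by (rule runs_eq[OF runs_clear]) (use r in \<open>simp_all add: s4_def s3_def s2_def s1_def n_def x_def\<close>)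
    have 5: "runs ?A (mv 19 r) s4 [] 3 (s(r := [b]))"
      by (rule runs_eq[OF runs_mv])
        (use r s in \<open>auto simp: s4_def s3_def s2_def s1_def fun_eq_iff\<close>)
    have post: "las_vegas ?A (seqs [clear 2, clear r, mv 19 r]) s2
       ((2 * mm n + 1) + ((2 * n + 1) + (3 + 1))) (s(r := [b]))"
      by (rule las_vegas_runs, intro runs_seqs_Cons[OF 3] runs_seqs_Cons[OF 4] runs_seqs_Cons[OF 5] runs_seqs_Nil)
    from las_vegas_Seq[OF pre las_vegas_Seq[OF loop post]] show ?thesis
      by (simp only: cai_def E_def S_def n_def x_def b_def)
  qed
  then have "las_vegas ?A (cai q r) s (poly e (length (s r))) (s(r := [s r \<in> L]))"
    if "30 \<le> r" "\<forall>i<30. s i = []" for r s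
    using las_vegas_mono e that by blast
  then show ?thesis by blast
qed

section \<open>Simulating oracle computations\<close>

text \<open>\<open>K\<close> bounds stack length plus remaining time, a quantity that no step
  increases, and hence the length of every query. So each step costs at most
  \<open>poly e K + 1\<close> in expectation. The simulated machine flips no coins, hence
  \<open>bs = []\<close>.\<close>

lemma las_vegas_embed:
  assumes e: "\<And>r s. 30 \<le> r \<Longrightarrow> \<forall>i<30. s i = [] \<Longrightarrow> las_vegas A (sub r) s (poly e (length (s r))) (s(r := [s r \<in> L]))"
  shows "exec L c s bs t s' \<Longrightarrow> bs = [] \<Longrightarrow> (\<And>r. length (s r) + t \<le> K) \<Longrightarrow>
    las_vegas A (embed sub c) (up (\<lambda>_. []) s) (t * (poly e K + 1)) (up (\<lambda>_. []) s')"
proof (induction rule: exec.induct)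
  case (Skip s)
  show ?case unfolding embed.simps by (rule las_vegas_mono[OF las_vegas_runs[OF runs_Skip]]) simp
next
  case (Push r b s)
  show ?case unfolding embed.simps up_upd
    by (rule las_vegas_mono[OF las_vegas_runs[OF runs_eq[OF runs_Push _ order_refl]]]) (auto simp: fun_eq_iff)
next
  case (Pop r s)
  show ?case unfolding embed.simps up_upd
    by (rule las_vegas_mono[OF las_vegas_runs[OF runs_eq[OF runs_Pop _ order_refl]]]) (auto simp: fun_eq_iff)
next
  case (Query r s)
  have "poly e (length (s r)) \<le> poly e K"
    using Query.prems(2)[of r] by (intro poly_nat_mono) simp
  moreover have "las_vegas A (sub (r + 30)) (up (\<lambda>_. []) s) (poly e (length (s r)))
    ((up (\<lambda>_. []) s)(r + 30 := [s r \<in> L]))"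
    using e[of "r + 30" "up (\<lambda>_. []) s"] by (simp add: up_def)
  ultimately show ?case unfolding embed.simps up_upd by (elim las_vegas_mono) simp
next
  case (Seq c s bs t s' d bs' t' s'')
  have "length (s' r) + t' \<le> K" for r
    using exec_length[OF Seq.hyps(1), of r] Seq.prems(2)[of r] by simp
  moreover have "length (s r) + t \<le> K" for r using Seq.prems(2)[of r] by simp
  ultimately show ?case using Seq.IH Seq.prems(1) unfolding embed.simps distrib_right
    by (intro las_vegas_Seq) auto
next
  case (Branch_Empty s r c bs t s' d e')
  have "length (s r) + t \<le> K" for r using Branch_Empty.prems(2)[of r] by simp
  with Branch_Empty have "las_vegas A (embed sub c) (up (\<lambda>_. []) s) (t * (poly e K + 1)) (up (\<lambda>_. []) s')" by blast
  then have "las_vegas A (embed sub (Branch r c d e')) (up (\<lambda>_. []) s) (Suc (t * (poly e K + 1))) (up (\<lambda>_. []) s')"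
    unfolding embed.simps
    by (rule las_vegas_step) (use Branch_Empty.hyps(1) in \<open>auto intro: exec.Branch_Empty elim: exec.cases\<close>)
  then show ?case by (rule las_vegas_mono) simp
next
  case (Branch_0 s r w d bs t s' c e')
  have "length (s r) + t \<le> K" for r using Branch_0.prems(2)[of r] by simp
  with Branch_0 have "las_vegas A (embed sub d) (up (\<lambda>_. []) s) (t * (poly e K + 1)) (up (\<lambda>_. []) s')" by blast
  then have "las_vegas A (embed sub (Branch r c d e')) (up (\<lambda>_. []) s) (Suc (t * (poly e K + 1))) (up (\<lambda>_. []) s')"
    unfolding embed.simps
    by (rule las_vegas_step) (use Branch_0.hyps(1) in \<open>auto intro: exec.Branch_0 elim: exec.cases\<close>)
  then show ?case by (rule las_vegas_mono) simp
next
  case (Branch_1 s r w e' bs t s' c d)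
  have "length (s r) + t \<le> K" for r using Branch_1.prems(2)[of r] by simp
  with Branch_1 have "las_vegas A (embed sub e') (up (\<lambda>_. []) s) (t * (poly e K + 1)) (up (\<lambda>_. []) s')" by blast
  then have "las_vegas A (embed sub (Branch r c d e')) (up (\<lambda>_. []) s) (Suc (t * (poly e K + 1))) (up (\<lambda>_. []) s')"
    unfolding embed.simps
    by (rule las_vegas_step) (use Branch_1.hyps(1) in \<open>auto intro: exec.Branch_1 elim: exec.cases\<close>)
  then show ?case by (rule las_vegas_mono) simp
next
  case (While_Empty s r c)
  show ?case unfolding embed.simps
    by (rule las_vegas_mono[OF las_vegas_runs[OF runs_While_empty]]) (simp_all add: While_Empty.hyps)
next
  case (While_Loop s r c bs t s' bs' t' s'')
  have "length (s' r) + t' \<le> K" for r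
    using exec_length[OF While_Loop.hyps(2), of r] While_Loop.prems(2)[of r] by simp
  then have 2: "las_vegas A (embed sub (While r c)) (up (\<lambda>_. []) s') (t' * (poly e K + 1)) (up (\<lambda>_. []) s'')"
    by (intro While_Loop.IH(2)) (use While_Loop.prems(1) in simp_all)
  have "length (s r) + t \<le> K" for r using While_Loop.prems(2)[of r] by simp
  then have 1: "las_vegas A (embed sub c) (up (\<lambda>_. []) s) (t * (poly e K + 1)) (up (\<lambda>_. []) s')"
    by (intro While_Loop.IH(1)) (use While_Loop.prems(1) in simp_all)
  from las_vegas_Seq[OF 1 2] have "las_vegas A (Seq (embed sub c) (embed sub (While r c))) (up (\<lambda>_. []) s)
    (t * (poly e K + 1) + t' * (poly e K + 1)) (up (\<lambda>_. []) s'')" .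
  then have "las_vegas A (embed sub (While r c)) (up (\<lambda>_. []) s)
    (Suc (t * (poly e K + 1) + t' * (poly e K + 1))) (up (\<lambda>_. []) s'')"
    unfolding embed.simps
  proof (rule las_vegas_step)
    fix b u s2
    show "exec A (While (r + 30) (embed sub c)) (up (\<lambda>_. []) s) b (Suc u) s2"
      if "exec A (Seq (embed sub c) (While (r + 30) (embed sub c))) (up (\<lambda>_. []) s) b u s2"
      using that While_Loop.hyps(1) by (cases rule: exec.cases) (auto intro: exec.While_Loop)
    show "\<exists>u. exec A (Seq (embed sub c) (While (r + 30) (embed sub c))) (up (\<lambda>_. []) s) b u s2"
      if "exec A (While (r + 30) (embed sub c)) (up (\<lambda>_. []) s) b u s2"
      using that While_Loop.hyps(1) by (cases rule: exec.cases) (auto intro: exec.Seq)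
  qed
  then show ?case by (rule las_vegas_mono) (simp add: algebra_simps)
qed simp

text \<open>The first output bit marks the player; the second one, which is the first bit of the
  move, is the answer for \<open>L\<close>. Two moves carry the input upwards without reversing
  it.\<close>

lemma search_oracle_ZPP:
  assumes L': "S2P_defines G q L'"
    and c: "\<And>x. \<exists>w. computes_within L' c [x] (poly p (length x)) w \<and> take 1 (tl w) = [x \<in> L]"
  shows "L \<in> ZPP (query_language (sat G))"
proof -
  let ?A = "query_language (sat G)"
  from las_vegas_cai[OF L'] obtain e where e: "\<And>r s. 30 \<le> r \<Longrightarrow> \<forall>i<30. s i = [] \<Longrightarrow>
    las_vegas ?A (cai q r) s (poly e (length (s r))) (s(r := [s r \<in> L']))" by blast
  define d where "d = Seq (seqs [moves 0 1, moves 1 30]) (Seq (embed (cai q) c) (seqs [Pop 30, mv 30 0]))"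
  define E where "E n = ((4 * n + 1) + ((4 * n + 1) + 1)) + (poly p n * (poly e (n + poly p n) + 1) + (1 + (3 + 1)))" for n
  have main: "\<exists>s'. las_vegas ?A d (init [x]) (E (length x)) s' \<and> s' 0 = [x \<in> L]" for x
  proof -
    from c[of x] obtain w t s where s: "t \<le> poly p (length x)" "exec L' c (init [x]) [] t s" "s 0 = w"
      "take 1 (tl w) = [x \<in> L]" by (auto simp: computes_within_def)
    have 1: "runs ?A (moves 0 1) (init [x]) [] (4 * length x + 1) ((\<lambda>_. [])(1 := rev x))"
      by (rule runs_eq[OF runs_moves]) (auto simp: init1 fun_eq_iff)
    have 2: "runs ?A (moves 1 30) ((\<lambda>_. [])(1 := rev x)) [] (4 * length x + 1) (up (\<lambda>_. []) (init [x]))"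
      by (rule runs_eq[OF runs_moves]) (auto simp: init1 up_def fun_eq_iff)
    have pre: "las_vegas ?A (seqs [moves 0 1, moves 1 30]) (init [x])
      ((4 * length x + 1) + ((4 * length x + 1) + 1)) (up (\<lambda>_. []) (init [x]))"
      by (rule las_vegas_runs, intro runs_seqs_Cons[OF 1] runs_seqs_Cons[OF 2] runs_seqs_Nil)
    have "las_vegas ?A (embed (cai q) c) (up (\<lambda>_. []) (init [x])) (t * (poly e (length x + poly p (length x)) + 1)) (up (\<lambda>_. []) s)"
      by (rule las_vegas_embed[OF e s(2) refl]) (use s(1) in \<open>auto simp: init1\<close>)
    then have run: "las_vegas ?A (embed (cai q) c) (up (\<lambda>_. []) (init [x]))
      (poly p (length x) * (poly e (length x + poly p (length x)) + 1)) (up (\<lambda>_. []) s)"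
      by (rule las_vegas_mono) (intro mult_le_mono1 s(1))
    let ?s = "(up (\<lambda>_. []) s)(30 := tl w)"
    let ?s' = "?s(30 := tl (tl w), 0 := [x \<in> L])"
    have 3: "runs ?A (Pop 30) (up (\<lambda>_. []) s) [] 1 ?s"
      by (rule runs_eq[OF runs_Pop]) (use s in \<open>auto simp: up_def\<close>)
    have 4: "runs ?A (mv 30 0) ?s [] 3 ?s'"
      by (rule runs_eq[OF runs_mv]) (use s in \<open>auto simp: up_def fun_eq_iff\<close>)
    have post: "las_vegas ?A (seqs [Pop 30, mv 30 0]) (up (\<lambda>_. []) s) (1 + (3 + 1)) ?s'"
      by (rule las_vegas_runs, intro runs_seqs_Cons[OF 3] runs_seqs_Cons[OF 4] runs_seqs_Nil)
    from las_vegas_Seq[OF pre las_vegas_Seq[OF run post]] have "las_vegas ?A d (init [x]) (E (length x)) ?s'"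
      by (simp only: d_def E_def)
    moreover have "?s' 0 = [x \<in> L]" by (rule fun_upd_same)
    ultimately show ?thesis by blast
  qed
  have "poly_bounded E" unfolding E_def
    by (intro poly_bounded_add poly_bounded_mult poly_bounded_comp poly_bounded_Suc poly_bounded_const poly_bounded_id)
  then obtain p' where p': "\<And>n. E n \<le> poly p' n" unfolding poly_bounded_def by blast
  have "(\<integral>\<^sup>+ \<omega>. run_time ?A d x \<omega> \<partial>coins) \<le> of_nat (poly p' (length x)) \<and>
     (\<forall>bs t s. exec ?A d (init [x]) bs t s \<longrightarrow> s 0 = [x \<in> L])" for x
  proof -
    from main[of x] obtain s' where s': "las_vegas ?A d (init [x]) (E (length x)) s'" "s' 0 = [x \<in> L]" by blast
    from las_vegas_mono[OF s'(1) p'] s'(2) show ?thesis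
      unfolding las_vegas_def run_time_eq_runtime by blast
  qed
  then show ?thesis unfolding ZPP_def by blast
qed


section \<open>The game for a language in the intersection\<close>

lemma outputs_take:
  assumes "outputs A c (init [x, take (length N) y, take (length N) z]) T b"
  shows "outputs A (seqs [copy 3 4 5, While 4 (Seq (Pop 4) (mv 1 6)), clear 1, moves 6 1,
      While 3 (Seq (Pop 3) (mv 2 6)), clear 2, moves 6 2, c]) ((init [x, y, z])(3 := N))
    (T + 20 * length N + 6 * length y + 6 * length z + 20) b"
proof -
  define s0 where "s0 = (init [x, y, z])(3 := N)"
  define s1 where "s1 = s0(4 := N)"
  define s2 where "s2 = s0(1 := drop (length N) y, 6 := rev (take (length N) y))"
  define s3 where "s3 = s0(1 := [], 6 := rev (take (length N) y))"
  define s4 where "s4 = s0(1 := take (length N) y)"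
  define s5 where "s5 = s4(3 := [], 2 := drop (length N) z, 6 := rev (take (length N) z))"
  define s6 where "s6 = s4(3 := [], 2 := [], 6 := rev (take (length N) z))"
  note sd = s0_def s1_def s2_def s3_def s4_def s5_def s6_def init3
  have 1: "runs A (copy 3 4 5) s0 [] (10 * length N + 2) s1"
    by (rule runs_eq[OF runs_copy]) (auto simp: sd)
  have 2: "runs A (While 4 (Seq (Pop 4) (mv 1 6))) s1 [] (5 * length N + 1) s2"
    by (rule runs_eq[OF runs_take[where M = N]]) (auto simp: sd fun_eq_iff)
  have 3: "runs A (clear 1) s2 [] (2 * length y + 1) s3"
    by (rule runs_eq[OF runs_clear]) (auto simp: sd fun_eq_iff)
  have 4: "runs A (moves 6 1) s3 [] (4 * length y + 1) s4"
    by (rule runs_eq[OF runs_moves]) (auto simp: sd fun_eq_iff)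
  have 5: "runs A (While 3 (Seq (Pop 3) (mv 2 6))) s4 [] (5 * length N + 1) s5"
    by (rule runs_eq[OF runs_take[where M = N]]) (auto simp: sd fun_eq_iff)
  have 6: "runs A (clear 2) s5 [] (2 * length z + 1) s6"
    by (rule runs_eq[OF runs_clear]) (auto simp: sd fun_eq_iff)
  have 7: "runs A (moves 6 2) s6 [] (4 * length z + 1) (init [x, take (length N) y, take (length N) z])"
    by (rule runs_eq[OF runs_moves]) (auto simp: sd fun_eq_iff)
  show ?thesis unfolding s0_def[symmetric]
    by (rule outputs_mono[OF outputs_seqs_Cons[OF 1 outputs_seqs_Cons[OF 2 outputs_seqs_Cons[OF 3
      outputs_seqs_Cons[OF 4 outputs_seqs_Cons[OF 5 outputs_seqs_Cons[OF 6 outputs_seqs_Cons[OF 7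
      outputs_seqs_single[OF assms]]]]]]]]]) simp
qed

text \<open>Allows moves longer than the original witnesses, so that predicates with different
  witness lengths can share one game.\<close>

lemma polytime3_take:
  assumes "polytime3 P"
  shows "polytime3 (\<lambda>x y z. P x (take (poly q (length x)) y) (take (poly q (length x)) z))"
proof -
  from assms obtain c p where c:
    "\<And>x y z. outputs {} c (init [x, y, z]) (poly p (length x + length y + length z)) (P x y z)"
    unfolding polytime3_def computes_outputs by blast
  obtain p' where p': "\<And>s. s 3 = [] \<Longrightarrow> s 4 = [] \<Longrightarrow> s 5 = [] \<Longrightarrow>
    runs {} (polyc 0 3 4 5 (coeffs q)) s [] (poly p' (length (s 0))) (s(3 := poly_word (coeffs q) (s 0)))"
    using runs_polyc[of 3 4 5 "coeffs q"] by (metis distinct_length_2_or_more distinct_singleton numeral_eq_iff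
      semiring_norm(83-90) zero_neq_numeral)
  define d where "d = seqs [polyc 0 3 4 5 (coeffs q), copy 3 4 5, While 4 (Seq (Pop 4) (mv 1 6)), clear 1, moves 6 1,
      While 3 (Seq (Pop 3) (mv 2 6)), clear 2, moves 6 2, c]"
  define E where "E n = poly p' n + (poly p n + 20 * poly q n + 6 * n + 6 * n + 20)" for n
  have main: "outputs {} d (init [x, y, z]) (E (length x + length y + length z))
    (P x (take (poly q (length x)) y) (take (poly q (length x)) z))" for x y z
  proof -
    define n where "n = length x + length y + length z"
    define N where "N = poly_word (coeffs q) x"
    have N: "length N = poly q (length x)" unfolding N_def by (rule length_poly_word)
    have mono: "poly p' (length x) \<le> poly p' n" "poly q (length x) \<le> poly q n"
      "poly p (length x + length (take (length N) y) + length (take (length N) z)) \<le> poly p n"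
      by (rule poly_nat_mono; simp add: n_def)+
    have 1: "runs {} (polyc 0 3 4 5 (coeffs q)) (init [x, y, z]) [] (poly p' n) ((init [x, y, z])(3 := N))"
      by (rule runs_eq[OF p']) (use mono in \<open>simp_all add: N_def\<close>)
    have 2: "outputs {} c (init [x, take (length N) y, take (length N) z]) (poly p n)
      (P x (take (length N) y) (take (length N) z))"
      by (rule outputs_mono[OF c mono(3)])
    show ?thesis unfolding d_def n_def[symmetric] E_def N[symmetric]
      by (rule outputs_mono[OF outputs_seqs_Cons[OF 1 outputs_take[OF 2]]])
        (use mono N in \<open>simp add: n_def\<close>)
  qed
  have "poly_bounded E" unfolding E_def
    by (intro poly_bounded_add poly_bounded_mult poly_bounded_comp poly_bounded_Suc poly_bounded_const poly_bounded_id)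
  then obtain e where e: "\<And>n. E n \<le> poly e n" unfolding poly_bounded_def by blast
  from outputs_mono[OF main e] show ?thesis unfolding polytime3_def computes_outputs by blast
qed

text \<open>The empty move is only a default: the game will be played with moves of positive
  length.\<close>

fun choose_game :: "(word \<Rightarrow> word \<Rightarrow> word \<Rightarrow> bool) \<Rightarrow> (word \<Rightarrow> word \<Rightarrow> word \<Rightarrow> bool) \<Rightarrow>
    word \<Rightarrow> word \<Rightarrow> word \<Rightarrow> bool" where
  "choose_game P Q x [] z = False"
| "choose_game P Q x (b # y) z = (if b then P x y z else Q x y z)"

lemma polytime3_choose_game:
  assumes "polytime3 P" "polytime3 Q"
  shows "polytime3 (choose_game P Q)"
proof -
  from assms obtain c p c' p' where c:
    "\<And>x y z. outputs {} c (init [x, y, z]) (poly p (length x + length y + length z)) (P x y z)"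
    "\<And>x y z. outputs {} c' (init [x, y, z]) (poly p' (length x + length y + length z)) (Q x y z)"
    unfolding polytime3_def computes_outputs by blast
  have "outputs {} (Branch 1 (setbit False) (Seq (Pop 1) c') (Seq (Pop 1) c)) (init [x, y, z])
    (poly (p + p' + [:5, 2:]) (length x + length y + length z)) (choose_game P Q x y z)" for x y z
  proof -
    define n where "n = length x + length y + length z"
    have "outputs {} (case init [x, y, z] 1 of [] \<Rightarrow> setbit False | b # _ \<Rightarrow> if b then Seq (Pop 1) c else Seq (Pop 1) c')
      (init [x, y, z]) (poly p n + poly p' n + 2 * n + 4) (choose_game P Q x y z)"
    proof (cases y)
      case Nil
      then show ?thesis using outputs_mono[OF outputs_setbit[of "{}" False "init [x, [], z]"]] n_def by simp
    next
      case (Cons b y')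
      have pop: "runs {} (Pop 1) (init [x, y, z]) [] 1 (init [x, y', z])"
        by (rule runs_eq[OF runs_Pop]) (auto simp: Cons init3 fun_eq_iff)
      have mono: "poly p (length x + length y' + length z) \<le> poly p n"
        "poly p' (length x + length y' + length z) \<le> poly p' n"
        by (rule poly_nat_mono; simp add: n_def Cons)+
      have "outputs {} (Seq (Pop 1) c) (init [x, y, z]) (poly p n + poly p' n + 2 * n + 4) (P x y' z)"
        by (rule outputs_mono[OF outputs_Seq[OF pop c(1)]]) (use mono in simp)
      moreover have "outputs {} (Seq (Pop 1) c') (init [x, y, z]) (poly p n + poly p' n + 2 * n + 4) (Q x y' z)"
        by (rule outputs_mono[OF outputs_Seq[OF pop c(2)]]) (use mono in simp)
      ultimately show ?thesis using Cons by (cases b) simp_all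
    qed
    from outputs_Branch[OF this] show ?thesis by (rule outputs_mono) (simp add: n_def)
  qed
  then show ?thesis unfolding polytime3_def computes_outputs by blast
qed

lemma take_words:
  assumes "m \<le> n"
  shows "words m = take m ` words n"
proof (intro equalityI subsetI)
  fix z assume "z \<in> words m"
  then have "z @ replicate (n - m) False \<in> words n" "take m (z @ replicate (n - m) False) = z"
    using assms by (auto simp: words_def)
  then show "z \<in> take m ` words n" by (metis image_eqI)
qed (use assms in \<open>auto simp: words_def\<close>)

lemma ball_words_take: "m \<le> n \<Longrightarrow> (\<forall>z\<in>words n. R (take m z)) \<longleftrightarrow> (\<forall>z\<in>words m. R z)"
  and bex_words_take: "m \<le> n \<Longrightarrow> (\<exists>z\<in>words n. R (take m z)) \<longleftrightarrow> (\<exists>z\<in>words m. R z)"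
  by (simp_all add: take_words)

theorem corollary5:
  assumes "search_reduces_to_decision_S2P"
  shows "Sigma2P \<inter> Pi2P \<subseteq> ZPP_NP"
proof
  fix L assume "L \<in> Sigma2P \<inter> Pi2P"
  then obtain P q P' q' where
    P: "polytime3 P" "\<And>x. x \<in> L \<longleftrightarrow> (\<exists>y\<in>words (poly q (length x)). \<forall>z\<in>words (poly q (length x)). P x y z)" and
    P': "polytime3 P'" "\<And>x. x \<notin> L \<longleftrightarrow> (\<exists>y\<in>words (poly q' (length x)). \<forall>z\<in>words (poly q' (length x)). P' x y z)"
    unfolding Sigma2P_def Pi2P_def by auto
  define T where "T = (\<lambda>x y z. P x (take (poly q (length x)) y) (take (poly q (length x)) z))"
  define T' where "T' = (\<lambda>x y z. P' x (take (poly q' (length x)) y) (take (poly q' (length x)) z))"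
  define C where "C = choose_game T T'"
  \<comment> \<open>One bit for the announcement, and the sum \<open>q + q'\<close> as a polynomial
    that is at least as large as both witness lengths.\<close>
  define k where "k = q + q' + [:1:]"
  have k: "poly k n = Suc (poly q n + poly q' n)" for n by (simp add: k_def)
  have T: "x \<in> L \<longleftrightarrow> (\<exists>y\<in>words (poly q (length x) + poly q' (length x)). \<forall>z\<in>words (poly k (length x)). T x y z)" for x
    unfolding P(2) T_def k
    by (subst ball_words_take, simp, subst bex_words_take[where R = "\<lambda>y. \<forall>z\<in>words _. P x y z"]) simp_all
  have T': "x \<notin> L \<longleftrightarrow> (\<exists>y\<in>words (poly q (length x) + poly q' (length x)). \<forall>z\<in>words (poly k (length x)). T' x y z)" for x
    unfolding P'(2) T'_def k
    by (subst ball_words_take, simp, subst bex_words_take[where R = "\<lambda>y. \<forall>z\<in>words _. P' x y z"]) simp_all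
  have win: "\<exists>y\<in>words (poly k (length x)). \<forall>z\<in>words (poly k (length x)). C x y z" for x
  proof (cases "x \<in> L")
    case True
    then obtain y where "y \<in> words (poly q (length x) + poly q' (length x))" "\<forall>z\<in>words (poly k (length x)). T x y z"
      using T by blast
    then show ?thesis by (intro bexI[of _ "True # y"]) (auto simp: C_def words_def k)
  next
    case False
    then obtain y where "y \<in> words (poly q (length x) + poly q' (length x))" "\<forall>z\<in>words (poly k (length x)). T' x y z"
      using T' by blast
    then show ?thesis by (intro bexI[of _ "False # y"]) (auto simp: C_def words_def k)
  qed
  \<comment> \<open>A witness of the second player would beat the winning move from
    \<open>win\<close>, so the solution belongs to the first player. A winning move cannot announce
    the wrong bit, since the remaining bits would witness a false statement about
    \<open>x\<close>.\<close>
  have sol: "take 1 (tl w) = [x \<in> L]" if "S2P_search_solution C k x w" for x w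
  proof -
    from that win[of x] obtain y where y: "y \<in> words (poly k (length x))" "w = True # y"
      "\<forall>z\<in>words (poly k (length x)). C x y z"
      unfolding S2P_search_solution_def by blast
    then obtain b y' where yb: "y = b # y'" "y' \<in> words (poly q (length x) + poly q' (length x))"
      by (cases y) (auto simp: words_def k)
    have "b \<longleftrightarrow> x \<in> L"
    proof (cases b)
      case True
      then have "\<forall>z\<in>words (poly k (length x)). T x y' z" using y(3) yb by (auto simp: C_def)
      with T[of x] yb(2) True show ?thesis by blast
    next
      case False
      then have "\<forall>z\<in>words (poly k (length x)). T' x y' z" using y(3) yb by (auto simp: C_def)
      with T'[of x] yb(2) False show ?thesis by blast
    qed
    with y(2) yb(1) show ?thesis by simp
  qed
  have "polytime3 C" unfolding C_def T_def T'_def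
    by (intro polytime3_choose_game polytime3_take P(1) P'(1))
  \<comment> \<open>The language defined by the game is everything and trivial to decide; all
    information about \<open>L\<close> lies in the search problem.\<close>
  with win have "S2P_defines C k UNIV" unfolding S2P_defines_def by blast
  with assms obtain L' c p where L': "L' \<in> S2P"
    and c: "\<And>x. \<exists>w. computes_within L' c [x] (poly p (length x)) w \<and> S2P_search_solution C k x w"
    unfolding search_reduces_to_decision_S2P_def by metis
  from L' obtain G r where G: "S2P_defines G r L'" unfolding S2P_def by blast
  have "L \<in> ZPP (query_language (sat G))"
    by (rule search_oracle_ZPP[OF G, of c p]) (use c sol in blast)
  moreover have "query_language (sat G) \<in> NP"
    using G by (intro query_language_NP polytime3_sat) (simp add: S2P_defines_def)
  ultimately show "L \<in> ZPP_NP" unfolding ZPP_NP_def by blast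
qed

end
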